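(* Let the integers $\alpha_1<\cdots<\alpha_r$, $\beta_1<\cdots<\beta_t$, $\gamma_1<\cdots<\gamma_s$ be fixed (independent of $n$), and let $\Gamma_1,\Gamma_2,\Gamma_3,\Gamma_4$ be the bicirculant graphs over $\mathbb{Z}_n$ described in the context, under the standing assumptions listed there. Put $q=s\sum_{j=1}^r\alpha_j^2+s\sum_{j=1}^t\beta_j^2+\sum_{1\le j<i\le s}(\gamma_j-\gamma_i)^2$. Then, as $n\to\infty$ (through even $n$ in (2)–(4)): (1) $\tau(\Gamma_1)\sim\frac{ns}{q}A^{n}$, where $A=\exp\left(\int_0^1\log|P_1(e^{2\pi \mathbf{i}x})|\,dx\right)$ is the Mahler measure of the Laurent polynomial $P_1(z)$; (2) $\tau(\Gamma_2)\sim\frac{ns}{4q}B^{n/2}$, where $B=\exp\left(\int_0^1\log|P_2(e^{2\pi \mathbf{i}x})P_1(e^{2\pi \mathbf{i}x})|\,dx\right)$ is the Mahler measure of $P_2(z)P_1(z)$; (3) $\tau(\Gamma_3)\sim\frac{ns}{4q}C^{n/2}$, where $C=\exp\left(\int_0^1\log|P_3(e^{2\pi \mathbf{i}x})P_1(e^{2\pi \mathbf{i}x})|\,dx\right)$ is the Mahler measure of $P_3(z)P_1(z)$; (4) $\tau(\Gamma_4)\sim\frac{ns}{4q}D^{n/2}$, where $D=\exp\left(\int_0^1\log|P_4(e^{2\pi \mathbf{i}x})P_1(e^{2\pi \mathbf{i}x})|\,dx\right)$ is the Mahler measure of $P_4(z)P_1(z)$.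
   Context: $\tau(\Gamma)$ denotes the number of spanning trees of $\Gamma$; $f(n)\sim g(n)$ means $\lim_{n\to\infty}f(n)/g(n)=1$; $\mathbf{i}$ is the imaginary unit. For $R=-R\subseteq\mathbb{Z}_n\setminus\{0\}$, $T=-T\subseteq\mathbb{Z}_n\setminus\{0\}$, $S\subseteq\mathbb{Z}_n$, the bicirculant graph $BC(\mathbb{Z}_n;R,T,S)$ is the simple undirected graph with vertex set $\{h_0: h\in\mathbb{Z}_n\}\cup\{h_1:h\in\mathbb{Z}_n\}$ ($2n$ vertices) and edges $\{h_0,g_0\}$ for $g-h\in R$, $\{h_1,g_1\}$ for $g-h\in T$, and $\{h_0,g_1\}$ for $g-h\in S$. Parameters: integers $1\le\alpha_1<\cdots<\alpha_r$, $1\le\beta_1<\cdots<\beta_t$, $0\le\gamma_1<\cdots<\gamma_s$ ($r,t\ge0$, $s\ge1$) with $\alpha_r<\frac n2$, $\beta_t<\frac n2$, $\gamma_s\le n-1$ for all sufficiently large $n$. Put $R_0=\{\pm\alpha_1,\dots,\pm\alpha_r\}$, $T_0=\{\pm\beta_1,\dots,\pm\beta_t\}$, $S=\{\gamma_1,\dots,\gamma_s\}$ in $\mathbb{Z}_n$. Then $\Gamma_1=BC(\mathbb{Z}_n;R_0,T_0,S)$, and, for $n$ even, $\Gamma_2=BC(\mathbb{Z}_n;R_0\cup\{\frac n2\},T_0,S)$, $\Gamma_3=BC(\mathbb{Z}_n;R_0,T_0\cup\{\frac n2\},S)$, $\Gamma_4=BC(\mathbb{Z}_n;R_0\cup\{\frac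 n2\},T_0\cup\{\frac n2\},S)$. Standing assumption: for all sufficiently large $n$ under consideration, at least one of the following holds: (a) $\gcd(n,\alpha_1,\dots,\alpha_r)=1$; (b) $\gcd(n,\beta_1,\dots,\beta_t)=1$; (c) the gcd of $n$ and all differences $\gamma_\ell-\gamma_m$ ($1\le m<\ell\le s$) is $1$. Since $n$ may be taken to be a multiple of any fixed integer, this means that at least one of $d_1=\gcd(\alpha_1,\dots,\alpha_r)$, $d_2=\gcd(\beta_1,\dots,\beta_t)$, $d_3=\gcd(\gamma_\ell-\gamma_m:1\le m<\ell\le s)$ equals $1$ (the gcd of an empty family is $0$). Laurent polynomials: $\mathcal{A}(z)=2r+s-\sum_{j=1}^r(z^{\alpha_j}+z^{-\alpha_j})$, $\mathcal{B}(z)=2t+s-\sum_{j=1}^t(z^{\beta_j}+z^{-\beta_j})$, $\mathcal{C}(z)=\sum_{j=1}^s z^{\gamma_j}$, and $P_1=\mathcal{A}(z)\mathcal{B}(z)-\mathcal{C}(z^{-1})\mathcal{C}(z)$, $P_2=(\mathcal{A}(z)+2)\mathcal{B}(z)-\mathcal{C}(z^{-1})\mathcal{C}(z)$, $P_3=\mathcal{A}(z)(\mathcal{B}(z)+2)-\mathcal{C}(z^{-1})\mathcal{C}(z)$, $P_4=(\mathcal{A}(z)+2)(\mathcal{B}(z)+2)-\mathcal{C}(z^{-1})\mathcal{C}(z)$. Each is invariant under $z\mapsto z^{-1}$; it is assumed throughout that they are nonzero and have the same degree $k$ (highest power of $z$ with nonzero coefficient). *)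

theory Defs
  imports
    "HOL-Analysis.Analysis"
    "HOL-Library.Landau_Symbols"
    "HOL-Library.Poly_Mapping"
begin

section \<open>Spanning trees of simple undirected graphs\<close>

text \<open>
  A simple undirected graph is a pair of a vertex set and a set of two-element sets of vertices.
  (The \<open>tree\<close> predicate of the AFP entry \<open>Graph_Theory\<close> excludes directed cycles only and is
  therefore not the notion needed for undirected graphs.)
\<close>

type_synonym 'a ugraph = "'a set \<times> 'a set set"

definition connected_graph :: "'a ugraph \<Rightarrow> bool" where
  "connected_graph G \<longleftrightarrow> fst G \<noteq> {} \<and>
     (\<forall>u\<in>fst G. \<forall>v\<in>fst G. (u, v) \<in> {(x, y). {x, y} \<in> snd G}\<^sup>*)"

definition graph_cycle :: "'a ugraph \<Rightarrow> 'a list \<Rightarrow> bool" where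
  "graph_cycle G xs \<longleftrightarrow> length xs \<ge> 3 \<and> distinct xs \<and>
     (\<forall>i<length xs. {xs ! i, xs ! (Suc i mod length xs)} \<in> snd G)"

definition is_tree :: "'a ugraph \<Rightarrow> bool" where
  "is_tree G \<longleftrightarrow> connected_graph G \<and> (\<nexists>xs. graph_cycle G xs)"

definition num_spanning_trees :: "'a ugraph \<Rightarrow> nat" where
  "num_spanning_trees G = card {F. F \<subseteq> snd G \<and> is_tree (fst G, F)}"


section \<open>Bicirculant graphs\<close>

text \<open>
  \<open>\<int>\<^sub>n\<close> is represented by the least nonnegative residues, and the vertex \<open>h\<^sub>i\<close> (\<open>i = 0, 1\<close>)
  by the pair \<open>(h, i)\<close>. The sets \<open>R\<close> and \<open>T\<close> are meant to be symmetric subsets of \<open>\<int>\<^sub>n - {0}\<close>;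
  for the families below this holds for all sufficiently large \<open>n\<close>, which suffices for asymptotics.
\<close>

definition Zmod :: "nat \<Rightarrow> int set" where
  "Zmod n = {0..<int n}"

definition bicirculant :: "nat \<Rightarrow> int set \<Rightarrow> int set \<Rightarrow> int set \<Rightarrow> (int \<times> nat) ugraph" where
  "bicirculant n R T S =
     (Zmod n \<times> {0, 1},
      {{(h, 0), (g, 0)} | h g. h \<in> Zmod n \<and> g \<in> Zmod n \<and> (g - h) mod int n \<in> R} \<union>
      {{(h, 1), (g, 1)} | h g. h \<in> Zmod n \<and> g \<in> Zmod n \<and> (g - h) mod int n \<in> T} \<union>
      {{(h, 0), (g, 1)} | h g. h \<in> Zmod n \<and> g \<in> Zmod n \<and> (g - h) mod int n \<in> S})"

text \<open>The subsets \<open>{\<plusminus>a\<^sub>1, \<dots>, \<plusminus>a\<^sub>m}\<close> and \<open>{a\<^sub>1, \<dots>, a\<^sub>m}\<close> of \<open>\<int>\<^sub>n\<close>.\<close>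

definition pm_residues :: "nat \<Rightarrow> nat \<Rightarrow> (nat \<Rightarrow> int) \<Rightarrow> int set" where
  "pm_residues n m a = (\<Union>j\<in>{1..m}. {a j mod int n, (- a j) mod int n})"

definition residues_of :: "nat \<Rightarrow> nat \<Rightarrow> (nat \<Rightarrow> int) \<Rightarrow> int set" where
  "residues_of n m a = (\<lambda>j. a j mod int n) ` {1..m}"



section \<open>Laurent polynomials\<close>

text \<open>
  The Laurent polynomial ring over \<open>\<complex>\<close> is the monoid algebra of \<open>(\<int>, +)\<close>, that is, the finitely
  supported functions from exponents to coefficients with the convolution product.
\<close>

type_synonym laurent = "int \<Rightarrow>\<^sub>0 complex"

abbreviation lmonom :: "int \<Rightarrow> laurent" where
  "lmonom m \<equiv> Poly_Mapping.single m 1"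

definition leval :: "laurent \<Rightarrow> complex \<Rightarrow> complex" where
  "leval P z = (\<Sum>m\<in>Poly_Mapping.keys P. Poly_Mapping.lookup P m * z powi m)"

text \<open>The substitution \<open>z \<mapsto> z\<inverse>\<close>.\<close>

definition linv :: "laurent \<Rightarrow> laurent" where
  "linv P = Poly_Mapping.map_key uminus P"

text \<open>The highest exponent with nonzero coefficient; meaningful for \<open>P \<noteq> 0\<close> only.\<close>

definition ldegree :: "laurent \<Rightarrow> int" where
  "ldegree P = Max (Poly_Mapping.keys P)"

definition mahler :: "laurent \<Rightarrow> real" where
  "mahler P = exp (integral {0..1} (\<lambda>x. ln (cmod (leval P (exp (2 * of_real pi * \<i> * of_real x))))))"

text \<open>
  \<open>lpoly_diag m s a\<close> is \<open>\<A>\<close> for \<open>m = r\<close>, \<open>a = \<alpha>\<close> and \<open>\<B>\<close> for \<open>m = t\<close>, \<open>a = \<beta>\<close>.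
\<close>

definition lpoly_diag :: "nat \<Rightarrow> nat \<Rightarrow> (nat \<Rightarrow> int) \<Rightarrow> laurent" where
  "lpoly_diag m s a = of_nat (2 * m + s) - (\<Sum>j=1..m. lmonom (a j) + lmonom (- a j))"

definition lpoly_C :: "nat \<Rightarrow> (nat \<Rightarrow> int) \<Rightarrow> laurent" where
  "lpoly_C s \<gamma> = (\<Sum>j=1..s. lmonom (\<gamma> j))"

definition P1 :: "nat \<Rightarrow> nat \<Rightarrow> nat \<Rightarrow> (nat \<Rightarrow> int) \<Rightarrow> (nat \<Rightarrow> int) \<Rightarrow> (nat \<Rightarrow> int) \<Rightarrow> laurent" where
  "P1 r t s \<alpha> \<beta> \<gamma> =
     lpoly_diag r s \<alpha> * lpoly_diag t s \<beta> - linv (lpoly_C s \<gamma>) * lpoly_C s \<gamma>"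

definition P2 :: "nat \<Rightarrow> nat \<Rightarrow> nat \<Rightarrow> (nat \<Rightarrow> int) \<Rightarrow> (nat \<Rightarrow> int) \<Rightarrow> (nat \<Rightarrow> int) \<Rightarrow> laurent" where
  "P2 r t s \<alpha> \<beta> \<gamma> =
     (lpoly_diag r s \<alpha> + 2) * lpoly_diag t s \<beta> - linv (lpoly_C s \<gamma>) * lpoly_C s \<gamma>"

definition P3 :: "nat \<Rightarrow> nat \<Rightarrow> nat \<Rightarrow> (nat \<Rightarrow> int) \<Rightarrow> (nat \<Rightarrow> int) \<Rightarrow> (nat \<Rightarrow> int) \<Rightarrow> laurent" where
  "P3 r t s \<alpha> \<beta> \<gamma> =
     lpoly_diag r s \<alpha> * (lpoly_diag t s \<beta> + 2) - linv (lpoly_C s \<gamma>) * lpoly_C s \<gamma>"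

definition P4 :: "nat \<Rightarrow> nat \<Rightarrow> nat \<Rightarrow> (nat \<Rightarrow> int) \<Rightarrow> (nat \<Rightarrow> int) \<Rightarrow> (nat \<Rightarrow> int) \<Rightarrow> laurent" where
  "P4 r t s \<alpha> \<beta> \<gamma> =
     (lpoly_diag r s \<alpha> + 2) * (lpoly_diag t s \<beta> + 2) - linv (lpoly_C s \<gamma>) * lpoly_C s \<gamma>"


section \<open>The four families and their constants\<close>

definition Gamma1 :: "nat \<Rightarrow> nat \<Rightarrow> nat \<Rightarrow> (nat \<Rightarrow> int) \<Rightarrow> (nat \<Rightarrow> int) \<Rightarrow> (nat \<Rightarrow> int) \<Rightarrow> nat
    \<Rightarrow> (int \<times> nat) ugraph" where
  "Gamma1 r t s \<alpha> \<beta> \<gamma> n =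
     bicirculant n (pm_residues n r \<alpha>) (pm_residues n t \<beta>) (residues_of n s \<gamma>)"

text \<open>The remaining three families are used for even \<open>n\<close> only.\<close>

definition Gamma2 :: "nat \<Rightarrow> nat \<Rightarrow> nat \<Rightarrow> (nat \<Rightarrow> int) \<Rightarrow> (nat \<Rightarrow> int) \<Rightarrow> (nat \<Rightarrow> int) \<Rightarrow> nat
    \<Rightarrow> (int \<times> nat) ugraph" where
  "Gamma2 r t s \<alpha> \<beta> \<gamma> n =
     bicirculant n (pm_residues n r \<alpha> \<union> {int n div 2}) (pm_residues n t \<beta>) (residues_of n s \<gamma>)"

definition Gamma3 :: "nat \<Rightarrow> nat \<Rightarrow> nat \<Rightarrow> (nat \<Rightarrow> int) \<Rightarrow> (nat \<Rightarrow> int) \<Rightarrow> (nat \<Rightarrow> int) \<Rightarrow> nat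
    \<Rightarrow> (int \<times> nat) ugraph" where
  "Gamma3 r t s \<alpha> \<beta> \<gamma> n =
     bicirculant n (pm_residues n r \<alpha>) (pm_residues n t \<beta> \<union> {int n div 2}) (residues_of n s \<gamma>)"

definition Gamma4 :: "nat \<Rightarrow> nat \<Rightarrow> nat \<Rightarrow> (nat \<Rightarrow> int) \<Rightarrow> (nat \<Rightarrow> int) \<Rightarrow> (nat \<Rightarrow> int) \<Rightarrow> nat
    \<Rightarrow> (int \<times> nat) ugraph" where
  "Gamma4 r t s \<alpha> \<beta> \<gamma> n =
     bicirculant n (pm_residues n r \<alpha> \<union> {int n div 2}) (pm_residues n t \<beta> \<union> {int n div 2})
       (residues_of n s \<gamma>)"

definition bicirc_q :: "nat \<Rightarrow> nat \<Rightarrow> nat \<Rightarrow> (nat \<Rightarrow> int) \<Rightarrow> (nat \<Rightarrow> int) \<Rightarrow> (nat \<Rightarrow> int) \<Rightarrow> int" where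
  "bicirc_q r t s \<alpha> \<beta> \<gamma> =
     int s * (\<Sum>j=1..r. (\<alpha> j)\<^sup>2) + int s * (\<Sum>j=1..t. (\<beta> j)\<^sup>2) +
     (\<Sum>i=1..s. \<Sum>j=1..<i. (\<gamma> j - \<gamma> i)\<^sup>2)"

abbreviation even_at_top :: "nat filter" where
  "even_at_top \<equiv> inf at_top (principal {n. even n})"

end

theory Submission
  imports Defs "Jordan_Normal_Form.Determinant" "HOL-Real_Asymp.Real_Asymp"
begin

text \<open>
  Expanding \<open>det (x I + L)\<close> row by row turns it into the generating function of rooted forests by
  number of roots; its linear coefficient is the number of vertices times \<open>\<tau>\<close>. For a bicirculant
  graph the Fourier transform diagonalizes the four blocks of \<open>x I + L\<close>, so that
  \<open>n \<tau> = s \<Prod>\<^sub>j P(\<epsilon>\<^sup>j)\<close> over the nontrivial \<open>n\<close>-th roots of unity, where \<open>P = P\<^sub>1\<close>, except that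
  the connection set element \<open>n/2\<close> replaces \<open>P\<^sub>1\<close> by \<open>P\<^sub>2\<close>, \<open>P\<^sub>3\<close> or \<open>P\<^sub>4\<close> for odd \<open>j\<close>.
  On the unit circle these three are positive, whereas \<open>P\<^sub>1(z) = |1 - z|\<^sup>2 g(z)\<close> with \<open>g\<close> positive by
  the gcd condition and \<open>g(1) = q\<close>. For a smooth positive function the product of its values at
  \<open>m\<close> equidistant points is asymptotic to the \<open>m\<close>-th power of its geometric mean, since the trapezoidal
  rule for its logarithm has error \<open>O(m\<^sup>-\<^sup>2)\<close>. The factor \<open>|1 - z|\<^sup>2\<close> has Mahler measure 1 and
  contributes \<open>m\<^sup>2\<close>.
\<close>

section \<open>Spanning trees and rooted forests\<close>

text \<open>For a ratio tending to 1 the logarithm of a product of m values must be known up to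
  o(1), while convergence of Riemann sums alone gives o(m); hence the quadratic error estimate. That
  estimate needs a smooth logarithm, and log |P_1| is singular at z = 1. So the factor |1 - z|^2 is
  split off before any estimate and its product over the nontrivial roots of unity is computed
  exactly. The spanning tree product omits z = 1, but the equidistant product for g contains it: the
  surplus factor g(1) is what puts q into the denominator. If n/2 is a connection element and n =
  2m, even j give the m-th roots of unity and odd j the midpoints between them, so sampling has to
  allow an offset within each cell. Keeping the variable x, instead of deleting a row and a column
  of the Laplacian, leaves the four circulant blocks intact.\<close>

abbreviation edge_rel :: "'a set set \<Rightarrow> ('a \<times> 'a) set" where
  "edge_rel F \<equiv> {(x, y). {x, y} \<in> F}"

lemma edge_rel_rtrancl_sym:
  assumes "(u, v) \<in> (edge_rel F)\<^sup>*"
  shows "(v, u) \<in> (edge_rel F)\<^sup>*"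
proof -
  have "sym (edge_rel F)" by (auto intro!: symI simp: insert_commute)
  thus ?thesis using assms by (rule symD[OF sym_rtrancl])
qed

text \<open>If the new first vertex already occurs on the path, the part in front of that occurrence
  is dropped. Such a path, closed by one more edge, is a \<open>graph_cycle\<close>.\<close>

lemma rtrancl_distinct_path:
  assumes "(u, v) \<in> r\<^sup>*"
  shows "\<exists>xs. xs \<noteq> [] \<and> hd xs = u \<and> last xs = v \<and> distinct xs \<and> successively (\<lambda>x y. (x, y) \<in> r) xs"
  using assms
proof (induction rule: converse_rtrancl_induct)
  case base
  show ?case by (rule exI[of _ "[v]"]) auto
next
  case (step a b)
  then obtain xs where xs: "xs \<noteq> []" "hd xs = b" "last xs = v" "distinct xs"
    "successively (\<lambda>x y. (x, y) \<in> r) xs" by blast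
  show ?case
  proof (cases "a \<in> set xs")
    case True
    then obtain ys zs where "xs = ys @ a # zs" by (meson split_list)
    thus ?thesis using xs by (intro exI[of _ "a # zs"]) (auto simp: successively_append_iff)
  next
    case False
    thus ?thesis using xs step(1)
      by (intro exI[of _ "a # xs"]) (auto simp: successively_Cons)
  qed
qed

text \<open>
  A rooted forest is encoded by its parent map; the roots are the vertices whose parent is the
  extra point \<open>\<omega>\<close>.
\<close>

definition rooted_forests :: "'a set \<Rightarrow> 'a \<Rightarrow> 'a set set \<Rightarrow> ('a \<Rightarrow> 'a) set" where
  "rooted_forests V \<omega> E = {f \<in> V \<rightarrow>\<^sub>E insert \<omega> V.
     (\<forall>v\<in>V. f v \<noteq> \<omega> \<longrightarrow> {v, f v} \<in> E) \<and> (\<forall>v\<in>V. \<exists>k. (f ^^ k) v = \<omega>)}"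

definition forest_roots :: "'a set \<Rightarrow> 'a \<Rightarrow> ('a \<Rightarrow> 'a) \<Rightarrow> 'a set" where
  "forest_roots V \<omega> f = {v \<in> V. f v = \<omega>}"

definition forest_edges :: "'a set \<Rightarrow> 'a \<Rightarrow> ('a \<Rightarrow> 'a) \<Rightarrow> 'a set set" where
  "forest_edges V \<omega> f = {{v, f v} | v. v \<in> V \<and> f v \<noteq> \<omega>}"

text \<open>The measure for the inductions below: in a forest it drops by exactly one at every step
  to the parent. The \<open>LEAST\<close> is meaningful because every vertex of a forest reaches
  \<omega>.\<close>

definition depth :: "'a \<Rightarrow> ('a \<Rightarrow> 'a) \<Rightarrow> 'a \<Rightarrow> nat" where
  "depth \<omega> f v = (LEAST k. (f ^^ k) v = \<omega>)"

lemma depth_step: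
  assumes "\<exists>k. (f ^^ k) v = \<omega>" "v \<noteq> \<omega>"
  shows "depth \<omega> f v = Suc (depth \<omega> f (f v))"
proof -
  obtain k where k: "(f ^^ k) v = \<omega>" using assms by blast
  have "(LEAST k. (f ^^ k) v = \<omega>) = Suc (LEAST k. (f ^^ Suc k) v = \<omega>)"
    by (rule Least_Suc[of "\<lambda>k. (f ^^ k) v = \<omega>", OF k]) (use assms in auto)
  thus ?thesis unfolding depth_def by (simp add: funpow_swap1)
qed

lemma rooted_forestsD:
  assumes "f \<in> rooted_forests V \<omega> E" "v \<in> V"
  shows "f v \<in> insert \<omega> V" "f v \<noteq> \<omega> \<Longrightarrow> {v, f v} \<in> E" "\<exists>k. (f ^^ k) v = \<omega>"
  using assms by (auto simp: rooted_forests_def PiE_iff)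

lemma forest_depth_step:
  assumes "f \<in> rooted_forests V \<omega> E" "v \<in> V" "\<omega> \<notin> V"
  shows "depth \<omega> f v = Suc (depth \<omega> f (f v))"
  using assms(2,3) by (intro depth_step rooted_forestsD(3)[OF assms(1,2)]) auto

text \<open>The parent of a vertex of least depth would be less deep, so it cannot lie in
  \<open>V\<close>. This later allows a factor x to be divided out of the forest polynomial.\<close>

lemma forest_root_exists:
  assumes "f \<in> rooted_forests V \<omega> E" "V \<noteq> {}" "\<omega> \<notin> V"
  shows "forest_roots V \<omega> f \<noteq> {}"
proof -
  obtain v where v: "v \<in> V" "\<And>u. u \<in> V \<Longrightarrow> depth \<omega> f v \<le> depth \<omega> f u"
    using assms(2) ex_has_least_nat[of "\<lambda>v. v \<in> V" _ "depth \<omega> f"] by blast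
  have "f v = \<omega>"
    using v(2)[of "f v"] forest_depth_step[OF assms(1) v(1) assms(3)] rooted_forestsD(1)[OF assms(1) v(1)]
    by auto
  thus ?thesis using v by (auto simp: forest_roots_def)
qed

lemma forest_reaches_root:
  assumes f: "f \<in> rooted_forests V \<omega> E" and \<omega>: "\<omega> \<notin> V" and r: "forest_roots V \<omega> f = {r}"
    and "v \<in> V"
  shows "(v, r) \<in> (edge_rel (forest_edges V \<omega> f))\<^sup>*"
  using \<open>v \<in> V\<close>
proof (induction "depth \<omega> f v" arbitrary: v rule: less_induct)
  case less
  show ?case
  proof (cases "f v = \<omega>")
    case True
    hence "v = r" using less(2) r by (auto simp: forest_roots_def)
    thus ?thesis by auto
  next
    case False
    hence fv: "f v \<in> V" using rooted_forestsD(1)[OF f less(2)] by auto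
    have "(f v, r) \<in> (edge_rel (forest_edges V \<omega> f))\<^sup>*"
      using less(1)[OF _ fv] forest_depth_step[OF f less(2) \<omega>] by auto
    moreover have "(v, f v) \<in> edge_rel (forest_edges V \<omega> f)"
      using False less(2) by (auto simp: forest_edges_def)
    ultimately show ?thesis by (rule converse_rtrancl_into_rtrancl[rotated])
  qed
qed

lemma single_root_forest_connected:
  assumes f: "f \<in> rooted_forests V \<omega> E" and \<omega>: "\<omega> \<notin> V" and r: "forest_roots V \<omega> f = {r}"
  shows "connected_graph (V, forest_edges V \<omega> f)"
  unfolding connected_graph_def
proof (intro conjI ballI)
  show "fst (V, forest_edges V \<omega> f) \<noteq> {}" using r by (auto simp: forest_roots_def)
next
  fix u v assume "u \<in> fst (V, forest_edges V \<omega> f)" "v \<in> fst (V, forest_edges V \<omega> f)"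
  hence ur: "(u, r) \<in> (edge_rel (forest_edges V \<omega> f))\<^sup>*"
    and vr: "(v, r) \<in> (edge_rel (forest_edges V \<omega> f))\<^sup>*"
    using forest_reaches_root[OF f \<omega> r] by simp_all
  show "(u, v) \<in> {(x, y). {x, y} \<in> snd (V, forest_edges V \<omega> f)}\<^sup>*"
    using rtrancl_trans[OF ur edge_rel_rtrancl_sym[OF vr]] by simp
qed

text \<open>At a deepest vertex of a cycle both neighbours would be its parent.\<close>

lemma forest_no_cycle:
  assumes f: "f \<in> rooted_forests V \<omega> E" and \<omega>: "\<omega> \<notin> V"
  shows "\<not> graph_cycle (V, forest_edges V \<omega> f) xs"
proof
  assume c: "graph_cycle (V, forest_edges V \<omega> f) xs"
  define n where "n = length xs"
  have n: "n \<ge> 3" and dist: "distinct xs"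
    and e: "\<And>i. i < n \<Longrightarrow> {xs ! i, xs ! (Suc i mod n)} \<in> forest_edges V \<omega> f"
    using c by (auto simp: graph_cycle_def n_def)
  let ?d = "\<lambda>i. depth \<omega> f (xs ! i)"
  obtain i where i: "i < n" "\<And>j. j < n \<Longrightarrow> ?d j \<le> ?d i"
  proof -
    have ne: "?d ` {..<n} \<noteq> {}" using n by (auto simp: lessThan_empty_iff)
    have "Max (?d ` {..<n}) \<in> ?d ` {..<n}" using Max_in[OF _ ne] by auto
    then obtain i where "i < n" "?d i = Max (?d ` {..<n})" by auto
    moreover have "j < n \<Longrightarrow> ?d j \<le> Max (?d ` {..<n})" for j by (intro Max_ge) auto
    ultimately show ?thesis using that by metis
  qed
  have par: "f (xs ! i) = xs ! j" if jn: "j < n" and je: "{xs ! i, xs ! j} \<in> forest_edges V \<omega> f" for j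
  proof -
    obtain v where v: "v \<in> V" "f v \<noteq> \<omega>" "{xs ! i, xs ! j} = {v, f v}"
      using je by (auto simp: forest_edges_def)
    have "depth \<omega> f v = Suc (depth \<omega> f (f v))" by (rule forest_depth_step[OF f v(1) \<omega>])
    thus ?thesis using v(3) i(2)[OF jn] by (auto simp: doubleton_eq_iff)
  qed
  \<comment> \<open>The cyclic predecessor of \<open>i\<close>. It coincides with the successor only
    on cycles of length at most 2.\<close>
  define j where "j = (if i = 0 then n - 1 else i - 1)"
  have j: "j < n" "Suc j mod n = i" using i(1) n by (auto simp: j_def)
  have "f (xs ! i) = xs ! (Suc i mod n)" using par e[OF i(1)] n by auto
  moreover have "f (xs ! i) = xs ! j"
    using par[OF j(1)] e[OF j(1)] j(2) by (simp add: insert_commute)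
  ultimately have "Suc i mod n = j"
    using dist j(1) n by (metis n_def nth_eq_iff_index_eq mod_less_divisor gr0I not_numeral_le_zero)
  thus False using n i(1) unfolding j_def
    by (cases "Suc i = n") (auto split: if_splits)
qed

lemma single_root_forest_is_tree:
  assumes "f \<in> rooted_forests V \<omega> E" "\<omega> \<notin> V" "forest_roots V \<omega> f = {r}"
  shows "is_tree (V, forest_edges V \<omega> f)"
  using single_root_forest_connected[OF assms] forest_no_cycle[OF assms(1,2)]
  by (auto simp: is_tree_def)

text \<open>Induction on depth. The edge from \<open>v\<close> to \<open>f v\<close> is also an edge
  of \<open>g\<close>, oriented either the same way or backwards. In the latter case the induction
  hypothesis at \<open>f v\<close> gives \<open>f (f v) = v\<close>, which contradicts the decrease
  of depth.\<close>

lemma forest_determined_by_edges: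
  assumes f: "f \<in> rooted_forests V \<omega> E" and g: "g \<in> rooted_forests V \<omega> E" and \<omega>: "\<omega> \<notin> V"
    and r: "forest_roots V \<omega> f = forest_roots V \<omega> g"
    and e: "forest_edges V \<omega> f = forest_edges V \<omega> g"
  shows "f = g"
proof -
  have "g v = f v" if "v \<in> V" for v
    using that
  proof (induction "depth \<omega> f v" arbitrary: v rule: less_induct)
    case less
    show ?case
    proof (cases "f v = \<omega>")
      case True
      thus ?thesis using r less(2) by (auto simp: forest_roots_def)
    next
      case False
      hence fv: "f v \<in> V" using rooted_forestsD(1)[OF f less(2)] by auto
      have d: "depth \<omega> f v = Suc (depth \<omega> f (f v))" by (rule forest_depth_step[OF f less(2) \<omega>])
      have "{v, f v} \<in> forest_edges V \<omega> g" using e False less(2) by (auto simp: forest_edges_def)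
      then obtain u where u: "u \<in> V" "g u \<noteq> \<omega>" "{v, f v} = {u, g u}" by (auto simp: forest_edges_def)
      show ?thesis
      proof (cases "u = v")
        case True thus ?thesis using u by (auto simp: doubleton_eq_iff)
      next
        case False
        hence uv: "u = f v" "g u = v" using u by (auto simp: doubleton_eq_iff)
        have "g (f v) = f (f v)" using less(1)[OF _ fv] d by auto
        hence "f (f v) = v" using uv by simp
        hence "depth \<omega> f (f v) = Suc (depth \<omega> f v)" using forest_depth_step[OF f fv \<omega>] by simp
        thus ?thesis using d by simp
      qed
    qed
  qed
  thus ?thesis using f g by (intro PiE_ext[of f V _ g]) (auto simp: rooted_forests_def)
qed

text \<open>Orient every edge of the tree towards the chosen root along shortest paths.\<close>

lemma tree_is_forest_edges:
  assumes t: "is_tree (V, F)" and r: "r \<in> V" and \<omega>: "\<omega> \<notin> V" and FE: "F \<subseteq> E"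
    and E: "\<And>u v. {u, v} \<in> E \<Longrightarrow> u \<noteq> v \<and> u \<in> V \<and> v \<in> V"
    and E2: "\<And>e. e \<in> E \<Longrightarrow> \<exists>u v. e = {u, v}"
  shows "\<exists>f\<in>rooted_forests V \<omega> E. forest_roots V \<omega> f = {r} \<and> forest_edges V \<omega> f = F"
proof -
  let ?R = "edge_rel F"
  have conn: "(u, v) \<in> ?R\<^sup>*" if "u \<in> V" "v \<in> V" for u v
    using t that by (auto simp: is_tree_def connected_graph_def)
  define D where "D v = (LEAST k. (v, r) \<in> ?R ^^ k)" for v
  have D: "(v, r) \<in> ?R ^^ D v" if "v \<in> V" for v
    using conn[OF that r] unfolding D_def rtrancl_is_UN_relpow by (auto intro: LeastI)
  have ex: "\<exists>u\<in>V. {v, u} \<in> F \<and> D u < D v" if v: "v \<in> V" "v \<noteq> r" for v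
  proof -
    have "D v \<noteq> 0" using D[OF v(1)] v(2) by (metis relpow_0_E)
    then obtain k where k: "D v = Suc k" by (cases "D v") auto
    then obtain u where u: "(v, u) \<in> ?R" "(u, r) \<in> ?R ^^ k"
      using D[OF v(1)] by (metis relpow_Suc_D2)
    have "D u \<le> k" unfolding D_def by (rule Least_le) (rule u(2))
    thus ?thesis using u(1) E FE k by (intro bexI[of _ u]) auto
  qed
  then obtain p where p: "\<And>v. v \<in> V \<Longrightarrow> v \<noteq> r \<Longrightarrow> p v \<in> V \<and> {v, p v} \<in> F \<and> D (p v) < D v"
    by metis
  define f where "f = restrict (p(r := \<omega>)) V"
  have fr: "f r = \<omega>" and fp: "\<And>v. v \<in> V \<Longrightarrow> v \<noteq> r \<Longrightarrow> f v = p v" using r by (auto simp: f_def)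
  have reach: "\<exists>k. (f ^^ k) v = \<omega>" if "v \<in> V" for v
    using that
  proof (induction "D v" arbitrary: v rule: less_induct)
    case less
    show ?case
    proof (cases "v = r")
      case True
      thus ?thesis using fr by (intro exI[of _ 1]) auto
    next
      case False
      then obtain k where "(f ^^ k) (p v) = \<omega>" using less p by blast
      hence "(f ^^ Suc k) v = \<omega>" using fp[OF less(2) False] by (simp add: funpow_swap1)
      thus ?thesis by blast
    qed
  qed
  have f: "f \<in> rooted_forests V \<omega> E"
    unfolding rooted_forests_def
  proof (intro CollectI conjI ballI impI)
    show "f \<in> V \<rightarrow>\<^sub>E insert \<omega> V" using p by (auto simp: f_def)
    show "{v, f v} \<in> E" if "v \<in> V" "f v \<noteq> \<omega>" for v
      using that p[of v] fp[of v] fr FE by (cases "v = r") auto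
  qed (rule reach)
  have rts: "forest_roots V \<omega> f = {r}"
  proof -
    have "v = r" if "v \<in> V" "f v = \<omega>" for v using that p[of v] fp[of v] \<omega> by (cases "v = r") auto
    thus ?thesis unfolding forest_roots_def using r fr by blast
  qed
  have sub: "forest_edges V \<omega> f \<subseteq> F"
  proof
    fix e assume "e \<in> forest_edges V \<omega> f"
    then obtain v where v: "e = {v, f v}" "v \<in> V" "f v \<noteq> \<omega>" by (auto simp: forest_edges_def)
    thus "e \<in> F" using fr fp[of v] p[of v] by (cases "v = r") auto
  qed
  \<comment> \<open>An edge of \<open>F\<close> outside the forest would close the forest path
    between its ends to a cycle of \<open>F\<close>. This path has at least three vertices, because
    its ends are distinct and not adjacent in the forest.\<close>
  moreover have "F \<subseteq> forest_edges V \<omega> f"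
  proof (rule ccontr)
    assume "\<not> F \<subseteq> forest_edges V \<omega> f"
    then obtain u v where uv: "{u, v} \<in> F" "{u, v} \<notin> forest_edges V \<omega> f"
      using E2 FE by blast
    hence ne: "u \<noteq> v" "u \<in> V" "v \<in> V" using E FE by blast+
    have "(u, v) \<in> (edge_rel (forest_edges V \<omega> f))\<^sup>*"
      using single_root_forest_connected[OF f \<omega> rts] ne by (auto simp: connected_graph_def)
    from rtrancl_distinct_path[OF this] obtain xs where xs: "xs \<noteq> []" "hd xs = u" "last xs = v"
      "distinct xs" "successively (\<lambda>x y. {x, y} \<in> forest_edges V \<omega> f) xs" by auto
    have l: "length xs \<ge> 3"
    proof (rule ccontr)
      assume "\<not> length xs \<ge> 3"
      then consider x where "xs = [x]" | x y where "xs = [x, y]"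
        using xs(1) by (cases xs; cases "tl xs"; cases "tl (tl xs)") auto
      thus False using xs ne uv by cases auto
    qed
    have "{xs ! i, xs ! (Suc i mod length xs)} \<in> F" if "i < length xs" for i
    proof (cases "Suc i = length xs")
      case True
      hence "xs ! i = v" using xs by (metis diff_Suc_1 last_conv_nth)
      moreover have "xs ! 0 = u" using xs by (simp add: hd_conv_nth)
      ultimately show ?thesis using uv True by (simp add: insert_commute)
    next
      case False
      hence "Suc i < length xs" using that by simp
      thus ?thesis using xs(5) sub by (auto simp: successively_conv_nth)
    qed
    hence "graph_cycle (V, F) xs" using l xs(4) by (auto simp: graph_cycle_def)
    thus False using t by (auto simp: is_tree_def)
  qed
  ultimately show ?thesis using f rts by blast
qed

text \<open>A forest with a single root is a spanning tree with a distinguished vertex: the root and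
  the edge set determine it and can be prescribed freely. The choice of the root accounts for the
  factor \<open>card V\<close>.\<close>

lemma card_single_root_forests:
  assumes fin: "finite V" and \<omega>: "\<omega> \<notin> V"
    and E: "\<And>u v. {u, v} \<in> E \<Longrightarrow> u \<noteq> v \<and> u \<in> V \<and> v \<in> V"
    and E2: "\<And>e. e \<in> E \<Longrightarrow> \<exists>u v. e = {u, v}"
  shows "card {f \<in> rooted_forests V \<omega> E. card (forest_roots V \<omega> f) = 1} =
    card V * num_spanning_trees (V, E)"
proof -
  let ?A = "{f \<in> rooted_forests V \<omega> E. card (forest_roots V \<omega> f) = 1}"
  let ?B = "V \<times> {F. F \<subseteq> E \<and> is_tree (V, F)}"
  let ?h = "\<lambda>f. (the_elem (forest_roots V \<omega> f), forest_edges V \<omega> f)"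
  have "bij_betw ?h ?A ?B"
  proof (rule bij_betwI')
    fix f g assume f: "f \<in> ?A" and g: "g \<in> ?A"
    show "(?h f = ?h g) = (f = g)"
    proof
      assume "?h f = ?h g"
      moreover obtain a b where "forest_roots V \<omega> f = {a}" "forest_roots V \<omega> g = {b}"
        using f g by (auto simp: card_1_singleton_iff)
      ultimately show "f = g" using forest_determined_by_edges[of f V \<omega> E g] f g \<omega> by auto
    qed auto
  next
    fix f assume f: "f \<in> ?A"
    then obtain r where r: "forest_roots V \<omega> f = {r}" by (auto simp: card_1_singleton_iff)
    have "r \<in> V" using r by (auto simp: forest_roots_def)
    moreover have "forest_edges V \<omega> f \<subseteq> E"
      using f by (auto simp: forest_edges_def rooted_forests_def)
    ultimately show "?h f \<in> ?B" using single_root_forest_is_tree[of f V \<omega> E r] f \<omega> r by auto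
  next
    fix y assume "y \<in> ?B"
    then obtain r F where y: "y = (r, F)" "r \<in> V" "F \<subseteq> E" "is_tree (V, F)" by auto
    from tree_is_forest_edges[OF y(4,2) \<omega> y(3) E E2] obtain f where
      "f \<in> rooted_forests V \<omega> E" "forest_roots V \<omega> f = {r}" "forest_edges V \<omega> f = F" by blast
    thus "\<exists>f\<in>?A. y = ?h f" using y(1) by (intro bexI[of _ f]) auto
  qed
  hence "card ?A = card ?B" by (rule bij_betw_same_card)
  thus ?thesis by (simp add: num_spanning_trees_def card_cartesian_product)
qed

section \<open>Transport of trees along injective relabellings\<close>

lemma is_tree_image:
  assumes t: "is_tree (V, F)" and inj: "inj_on \<phi> V" and F: "F \<subseteq> Pow V"
  shows "is_tree (\<phi> ` V, (`) \<phi> ` F)"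
proof -
  have "(\<phi> u, \<phi> v) \<in> (edge_rel ((`) \<phi> ` F))\<^sup>*" if "(u, v) \<in> (edge_rel F)\<^sup>*" for u v
    using that
  proof (induction rule: rtrancl_induct)
    case (step y z)
    have "\<phi> ` {y, z} \<in> (`) \<phi> ` F" using step(2) by (intro imageI) simp
    hence "(\<phi> y, \<phi> z) \<in> edge_rel ((`) \<phi> ` F)" by simp
    thus ?case using step(3) by (rule rtrancl_into_rtrancl[rotated])
  qed auto
  hence "connected_graph (\<phi> ` V, (`) \<phi> ` F)"
    using t by (auto simp: is_tree_def connected_graph_def)
  moreover have "\<not> graph_cycle (\<phi> ` V, (`) \<phi> ` F) xs" for xs
  proof
    assume c: "graph_cycle (\<phi> ` V, (`) \<phi> ` F) xs"
    \<comment> \<open>A cycle in the image is pulled back along the inverse of \<phi> on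
      \<open>V\<close>.\<close>
    let ?n = "length xs" and ?\<psi> = "inv_into V \<phi>"
    have n: "?n \<ge> 3" and d: "distinct xs" using c by (auto simp: graph_cycle_def)
    have e: "{?\<psi> (xs ! i), ?\<psi> (xs ! (Suc i mod ?n))} \<in> F \<and> xs ! i \<in> \<phi> ` V" if "i < ?n" for i
    proof -
      have "{xs ! i, xs ! (Suc i mod ?n)} \<in> (`) \<phi> ` F" using c that by (auto simp: graph_cycle_def)
      then obtain f where f: "f \<in> F" "{xs ! i, xs ! (Suc i mod ?n)} = \<phi> ` f" by auto
      have "?\<psi> ` \<phi> ` f = f" using f(1) F inj by (meson PowD inv_into_image_cancel subsetD)
      hence "{?\<psi> (xs ! i), ?\<psi> (xs ! (Suc i mod ?n))} = f" using f(2)[symmetric] by simp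
      moreover have "\<phi> ` f \<subseteq> \<phi> ` V" using f(1) F by auto
      ultimately show ?thesis using f by (metis insert_subset)
    qed
    have "set xs \<subseteq> \<phi> ` V" using e by (auto simp: in_set_conv_nth)
    hence "distinct (map ?\<psi> xs)" using d by (simp add: distinct_map inj_on_inv_into)
    moreover have "{map ?\<psi> xs ! i, map ?\<psi> xs ! (Suc i mod ?n)} \<in> F" if "i < ?n" for i
    proof -
      have "Suc i mod ?n < ?n" by (rule mod_less_divisor) (use n in linarith)
      thus ?thesis using e[OF that] that by simp
    qed
    ultimately have "graph_cycle (V, F) (map ?\<psi> xs)" using n by (auto simp: graph_cycle_def)
    thus False using t by (auto simp: is_tree_def)
  qed
  ultimately show ?thesis by (auto simp: is_tree_def)
qed

text \<open>Makes it possible to number the vertices, so that they can index a matrix. Surjectivity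
  comes from \<open>is_tree_image\<close> for the inverse relabelling.\<close>

lemma num_spanning_trees_image:
  assumes inj: "inj_on \<phi> V" and E: "E \<subseteq> Pow V"
  shows "num_spanning_trees (\<phi> ` V, (`) \<phi> ` E) = num_spanning_trees (V, E)"
proof -
  have inj': "inj_on ((`) \<phi>) (Pow V)" using inj by (simp add: inj_on_image_Pow)
  have "bij_betw ((`) ((`) \<phi>)) {F. F \<subseteq> E \<and> is_tree (V, F)}
     {F. F \<subseteq> (`) \<phi> ` E \<and> is_tree (\<phi> ` V, F)}"
    unfolding bij_betw_def
  proof (intro conjI equalityI subsetI)
    have "inj_on ((`) ((`) \<phi>)) (Pow (Pow V))" using inj' by (simp add: inj_on_image_Pow)
    thus "inj_on ((`) ((`) \<phi>)) {F. F \<subseteq> E \<and> is_tree (V, F)}"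
      by (rule inj_on_subset) (use E in auto)
  next
    fix G assume "G \<in> (`) ((`) \<phi>) ` {F. F \<subseteq> E \<and> is_tree (V, F)}"
    then obtain F where "G = (`) \<phi> ` F" "F \<subseteq> E" "is_tree (V, F)" by auto
    thus "G \<in> {F. F \<subseteq> (`) \<phi> ` E \<and> is_tree (\<phi> ` V, F)}"
      using is_tree_image[of V F \<phi>] inj E by blast
  next
    fix G assume "G \<in> {F. F \<subseteq> (`) \<phi> ` E \<and> is_tree (\<phi> ` V, F)}"
    then obtain F where F: "F \<subseteq> E" "G = (`) \<phi> ` F" and t: "is_tree (\<phi> ` V, G)"
      by (auto simp: subset_image_iff)
    let ?\<psi> = "inv_into V \<phi>"
    have "is_tree (?\<psi> ` \<phi> ` V, (`) ?\<psi> ` G)"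
      by (rule is_tree_image[OF t]) (use F E in \<open>auto simp: inj_on_inv_into\<close>)
    moreover have "?\<psi> ` \<phi> ` V = V" using inj by auto
    moreover have "(`) ?\<psi> ` G = F"
    proof -
      have "?\<psi> ` \<phi> ` f = f" if "f \<in> F" for f using that F E inj by (meson PowD inv_into_image_cancel subsetD)
      thus ?thesis unfolding F(2) image_image by force
    qed
    ultimately show "G \<in> (`) ((`) \<phi>) ` {F. F \<subseteq> E \<and> is_tree (V, F)}" using F by auto
  qed
  from bij_betw_same_card[OF this] show ?thesis by (simp add: num_spanning_trees_def)
qed

section \<open>The determinantal forest theorem\<close>

text \<open>In the Leibniz formula a nonzero term forces \<open>f x = p x\<close> at every point
  moved by \<open>p\<close>. The image of a moved point is again moved, so its orbit under
  \<open>f\<close> stays below \<open>N\<close>, contrary to \<open>reach\<close>. Only the identity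
  survives, and its diagonal entries are 1 because \<open>f\<close> has no fixed point below
  \<open>N\<close>.\<close>

lemma det_acyclic_function:
  fixes f :: "nat \<Rightarrow> nat"
  assumes reach: "\<And>i. i < N \<Longrightarrow> \<exists>k. (f ^^ k) i = N"
  shows "det (mat N N (\<lambda>(i, j). (if i = j then 1 else 0) - (if f i = j then 1 else 0))) =
    (1 :: 'a :: idom)" (is "det ?M = 1")
proof -
  let ?U = "{0..<N}"
  let ?t = "\<lambda>p. signof p * (\<Prod>i = 0..<N. ?M $$ (i, p i))"
  have "?t p = 0" if p: "p permutes ?U" "p \<noteq> id" for p
  proof (rule ccontr)
    assume nz: "?t p \<noteq> 0"
    obtain i where i: "p i \<noteq> i" using p(2) by (auto simp: fun_eq_iff)
    hence iN: "i < N" using p(1) by (metis permutes_not_in atLeast0LessThan lessThan_iff)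
    have fp: "f x = p x" if "x < N" "p x \<noteq> x" for x
    proof (rule ccontr)
      assume "f x \<noteq> p x"
      moreover have "p x < N" using permutes_in_image[OF p(1), of x] that by simp
      ultimately have "?M $$ (x, p x) = 0" using that by simp
      hence "(\<Prod>i = 0..<N. ?M $$ (i, p i)) = 0" using that(1) by (intro prod_zero) auto
      thus False using nz by simp
    qed
    have "(f ^^ k) i < N \<and> p ((f ^^ k) i) \<noteq> (f ^^ k) i" for k
    proof (induction k)
      case 0 show ?case using i iN by simp
    next
      case (Suc k)
      let ?x = "(f ^^ k) i"
      have "f ?x = p ?x" using fp Suc by blast
      moreover have "p ?x < N" using permutes_in_image[OF p(1), of ?x] Suc by simp
      moreover have "p (p ?x) \<noteq> p ?x" using Suc permutes_inj[OF p(1)] by (metis injD)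
      ultimately show ?case by simp
    qed
    thus False using reach[OF iN] by (metis less_irrefl)
  qed
  hence "(\<Sum>p | p permutes ?U. ?t p) = (\<Sum>p\<in>{id}. ?t p)"
    by (intro sum.mono_neutral_right) (auto simp: finite_permutations permutes_id)
  also have "\<dots> = 1"
  proof -
    have "f i \<noteq> i" if "i < N" for i
    proof
      assume "f i = i"
      hence "(f ^^ k) i = i" for k by (induction k) auto
      thus False using reach[OF that] that by auto
    qed
    thus ?thesis by simp
  qed
  finally show ?thesis by (subst det_def'[of _ N]) auto
qed

text \<open>The indicator function of the points that never reach \<open>N\<close> lies in the kernel.\<close>

lemma det_cyclic_function:
  fixes f :: "nat \<Rightarrow> nat"
  assumes i: "i < N" "\<And>k. (f ^^ k) i \<noteq> N" and f: "\<And>j. j < N \<Longrightarrow> f j \<le> N"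
  shows "det (mat N N (\<lambda>(i, j). (if i = j then 1 else 0) - (if f i = j then 1 else 0))) =
    (0 :: 'a :: field)" (is "det ?M = 0")
proof -
  define S where "S = {j. j < N \<and> (\<forall>k. (f ^^ k) j \<noteq> N)}"
  define v :: "'a Matrix.vec" where "v = Matrix.vec N (\<lambda>j. if j \<in> S then 1 else 0)"
  \<comment> \<open>Membership in \<open>S\<close> passes along \<open>f\<close> in both directions.
    Row \<open>j\<close> applied to \<open>v\<close> is the difference of the indicators at
    \<open>j\<close> and \<open>f j\<close>, hence zero.\<close>
  have S: "f j \<in> S \<longleftrightarrow> j \<in> S" if j: "j < N" for j
  proof -
    have "(\<exists>k. (f ^^ k) j = N) \<longleftrightarrow> (\<exists>k. (f ^^ Suc k) j = N)"
      using j by (metis funpow_0 less_irrefl not0_implies_Suc)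
    also have "\<dots> \<longleftrightarrow> (\<exists>k. (f ^^ k) (f j) = N)" by (simp add: funpow_swap1)
    finally have "(\<exists>k. (f ^^ k) j = N) \<longleftrightarrow> (\<exists>k. (f ^^ k) (f j) = N)" .
    moreover have "f j < N" if "\<And>k. (f ^^ k) (f j) \<noteq> N"
      using f[OF j] that[of 0] by simp
    ultimately show ?thesis using j by (auto simp: S_def)
  qed
  have "?M *\<^sub>v v = 0\<^sub>v N"
  proof (rule eq_vecI)
    fix j assume "j < dim_vec (0\<^sub>v N :: 'a Matrix.vec)"
    hence j: "j < N" by simp
    have "(?M *\<^sub>v v) $ j = (\<Sum>k = 0..<N. ((if j = k then 1 else 0) - (if f j = k then 1 else 0)) * (if k \<in> S then 1 else 0))"
      using j by (simp add: scalar_prod_def v_def)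
    also have "\<dots> = (\<Sum>k = 0..<N. (if k = j then (if k \<in> S then 1 else 0) else 0)) -
                     (\<Sum>k = 0..<N. (if k = f j then (if k \<in> S then 1 else 0) else 0))"
      unfolding sum_subtractf[symmetric] by (intro sum.cong) auto
    also have "\<dots> = (if j \<in> S then 1 else 0) - (if f j \<in> S then 1 else 0)"
      using j by (auto simp: S_def)
    also have "\<dots> = 0" using S[OF j] by simp
    finally show "(?M *\<^sub>v v) $ j = 0\<^sub>v N $ j" using j by simp
  qed simp
  moreover have "v \<noteq> 0\<^sub>v N"
  proof
    assume "v = 0\<^sub>v N"
    hence "v $ i = 0" using i(1) by simp
    thus False using i by (simp add: v_def S_def)
  qed
  moreover have "v \<in> carrier_vec N" by (simp add: v_def)
  ultimately show ?thesis by (subst det_0_iff_vec_prod_zero[of _ N]) auto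
qed

text \<open>
  Every row is expanded as \<open>\<Sum>k\<le>N. W i k (e\<^sub>i - e\<^sub>k)\<close> with \<open>e\<^sub>N = 0\<close>.
\<close>

lemma det_weighted_forests:
  fixes W :: "nat \<Rightarrow> nat \<Rightarrow> 'a :: field"
  shows "det (mat N N (\<lambda>(i, j). (if i = j then (\<Sum>k = 0..N. W i k) else 0) - W i j)) =
    (\<Sum>f | f \<in> {0..<N} \<rightarrow>\<^sub>E {0..N} \<and> (\<forall>i<N. \<exists>k. (f ^^ k) i = N). \<Prod>i = 0..<N. W i (f i))"
proof -
  let ?U = "{0..<N}"
  let ?F = "?U \<rightarrow>\<^sub>E {0..N}"
  let ?\<delta> = "\<lambda>f i j. (if i = j then 1 else 0) - (if f i = j then 1 else (0::'a))"
  let ?L = "mat N N (\<lambda>(i, j). (if i = j then (\<Sum>k = 0..N. W i k) else 0) - W i j)"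
  have fin: "finite ?F" by (intro finite_PiE) auto
  \<comment> \<open>The summand \<open>k = N\<close> contributes to the diagonal only, as the matrix
    has no column \<open>N\<close>. It represents the choice of \<open>i\<close> as a root.\<close>
  have entry: "?L $$ (i, j) = (\<Sum>k = 0..N. W i k * ((if i = j then 1 else 0) - (if k = j then 1 else 0)))"
    if "i < N" "j < N" for i j
  proof -
    have "(\<Sum>k = 0..N. W i k * ((if i = j then 1 else 0) - (if k = j then 1 else 0))) =
      (\<Sum>k = 0..N. if i = j then W i k else 0) - (\<Sum>k = 0..N. if k = j then W i k else 0)"
      unfolding sum_subtractf[symmetric] by (intro sum.cong) auto
    thus ?thesis using that by auto
  qed
  have "det ?L = (\<Sum>p | p permutes ?U. signof p * (\<Prod>i = 0..<N. ?L $$ (i, p i)))"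
    by (rule det_def') auto
  also have "\<dots> = (\<Sum>p | p permutes ?U. signof p *
      (\<Prod>i = 0..<N. \<Sum>k = 0..N. W i k * ((if i = p i then 1 else 0) - (if k = p i then 1 else 0))))"
    by (intro sum.cong refl arg_cong2[of _ _ _ _ "(*)"] prod.cong entry)
       (auto dest: permutes_in_image)
  \<comment> \<open>Choosing one \<open>k\<close> in each row amounts to choosing a function
    \<open>f\<close>. After exchanging the sums, the sum over \<open>p\<close> is the determinant
    belonging to \<open>f\<close>, which is 1 or 0 by the two preceding lemmas.\<close>
  also have "\<dots> = (\<Sum>p | p permutes ?U. signof p * (\<Sum>f\<in>?F. \<Prod>i = 0..<N. W i (f i) * ?\<delta> f i (p i)))"
    by (subst prod_sum_PiE) auto
  also have "\<dots> = (\<Sum>f\<in>?F. \<Sum>p | p permutes ?U. signof p * (\<Prod>i = 0..<N. W i (f i) * ?\<delta> f i (p i)))"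
    unfolding sum_distrib_left by (rule sum.swap)
  also have "\<dots> = (\<Sum>f\<in>?F. (\<Prod>i = 0..<N. W i (f i)) * det (mat N N (\<lambda>(i, j). ?\<delta> f i j)))"
  proof (rule sum.cong[OF refl])
    fix f
    have "det (mat N N (\<lambda>(i, j). ?\<delta> f i j)) =
      (\<Sum>p | p permutes ?U. signof p * (\<Prod>i = 0..<N. mat N N (\<lambda>(i, j). ?\<delta> f i j) $$ (i, p i)))"
      by (rule det_def') auto
    also have "\<dots> = (\<Sum>p | p permutes ?U. signof p * (\<Prod>i = 0..<N. ?\<delta> f i (p i)))"
    proof (intro sum.cong refl arg_cong2[of _ _ _ _ "(*)"] prod.cong)
      fix p i assume "p \<in> {p. p permutes ?U}" "i \<in> ?U"
      hence "i < N" "p i < N" using permutes_in_image[of p ?U i] by auto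
      thus "mat N N (\<lambda>(i, j). ?\<delta> f i j) $$ (i, p i) = ?\<delta> f i (p i)" by simp
    qed
    finally have *: "det (mat N N (\<lambda>(i, j). ?\<delta> f i j)) =
      (\<Sum>p | p permutes ?U. signof p * (\<Prod>i = 0..<N. ?\<delta> f i (p i)))" .
    show "(\<Sum>p | p permutes ?U. signof p * (\<Prod>i = 0..<N. W i (f i) * ?\<delta> f i (p i))) =
      (\<Prod>i = 0..<N. W i (f i)) * det (mat N N (\<lambda>(i, j). ?\<delta> f i j))"
      unfolding * sum_distrib_left prod.distrib by (intro sum.cong refl) (simp only: mult_ac)
  qed
  also have "\<dots> = (\<Sum>f\<in>?F. if \<forall>i<N. \<exists>k. (f ^^ k) i = N then \<Prod>i = 0..<N. W i (f i) else 0)"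
  proof (rule sum.cong[OF refl])
    fix f assume f: "f \<in> ?F"
    show "(\<Prod>i = 0..<N. W i (f i)) * det (mat N N (\<lambda>(i, j). ?\<delta> f i j)) =
      (if \<forall>i<N. \<exists>k. (f ^^ k) i = N then \<Prod>i = 0..<N. W i (f i) else 0)"
    proof (cases "\<forall>i<N. \<exists>k. (f ^^ k) i = N")
      case True
      hence "det (mat N N (\<lambda>(i, j). ?\<delta> f i j)) = 1" by (intro det_acyclic_function) auto
      thus ?thesis using True by simp
    next
      case False
      then obtain i where i: "i < N" "\<And>k. (f ^^ k) i \<noteq> N" by auto
      have d: "det (mat N N (\<lambda>(i, j). ?\<delta> f i j)) = 0"
        by (rule det_cyclic_function[OF i]) (use f in \<open>auto simp: PiE_iff\<close>)
      show ?thesis unfolding d if_not_P[OF False] by simp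
    qed
  qed
  also have "\<dots> = (\<Sum>f | f \<in> ?F \<and> (\<forall>i<N. \<exists>k. (f ^^ k) i = N). \<Prod>i = 0..<N. W i (f i))"
    using fin by (simp add: sum.inter_filter)
  finally show ?thesis .
qed

text \<open>The weight x is given to the extra point \<open>N\<close> and the weight 1 to the edges.
  Row sums become x plus the degree, each root contributes one factor x, and parent maps using a
  non-edge drop out. Without loops the diagonal weights vanish, which matches the matrix.\<close>

lemma det_laplacian_forests:
  fixes x :: "'a :: field" and E :: "nat set set"
  assumes loop: "\<And>i. {i} \<notin> E"
  shows "det (mat N N (\<lambda>(i, j). if i = j then x + of_nat (card {k. k < N \<and> {i, k} \<in> E})
      else - (if {i, j} \<in> E then 1 else 0))) =
    (\<Sum>f\<in>rooted_forests {0..<N} N E. x ^ card (forest_roots {0..<N} N f))"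
proof -
  define W where "W i j = (if j = N then x else if {i, j} \<in> E then 1 else (0 :: 'a))" for i j
  let ?A = "{f. f \<in> {0..<N} \<rightarrow>\<^sub>E {0..N} \<and> (\<forall>i<N. \<exists>k. (f ^^ k) i = N)}"
  have "(\<Sum>k = 0..N. W i k) = x + of_nat (card {k. k < N \<and> {i, k} \<in> E})" for i
  proof -
    have "(\<Sum>k = 0..N. W i k) = x + (\<Sum>k = 0..<N. if {i, k} \<in> E then 1 else 0)"
      by (subst atLeastLessThanSuc_atLeastAtMost[symmetric]) (simp add: W_def add.commute)
    also have "(\<Sum>k = 0..<N. if {i, k} \<in> E then 1 else (0::'a)) = of_nat (card {k. k < N \<and> {i, k} \<in> E})"
      by (simp add: sum.If_cases Int_def)
    finally show ?thesis .
  qed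
  hence "mat N N (\<lambda>(i, j). if i = j then x + of_nat (card {k. k < N \<and> {i, k} \<in> E})
      else - (if {i, j} \<in> E then 1 else 0)) =
    mat N N (\<lambda>(i, j). (if i = j then (\<Sum>k = 0..N. W i k) else 0) - W i j)"
    using loop by (intro eq_matI) (auto simp: W_def)
  hence "det (mat N N (\<lambda>(i, j). if i = j then x + of_nat (card {k. k < N \<and> {i, k} \<in> E})
      else - (if {i, j} \<in> E then 1 else 0))) = (\<Sum>f\<in>?A. \<Prod>i = 0..<N. W i (f i))"
    by (simp add: det_weighted_forests)
  also have "\<dots> = (\<Sum>f\<in>rooted_forests {0..<N} N E. \<Prod>i = 0..<N. W i (f i))"
  proof (rule sum.mono_neutral_right)
    show "finite ?A" by (rule finite_subset[of _ "{0..<N} \<rightarrow>\<^sub>E {0..N}"]) (auto intro!: finite_PiE)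
    have "insert N {0..<N} = {0..N}" by auto
    thus "rooted_forests {0..<N} N E \<subseteq> ?A" by (auto simp: rooted_forests_def)
    show "\<forall>f\<in>?A - rooted_forests {0..<N} N E. (\<Prod>i = 0..<N. W i (f i)) = 0"
    proof
      fix f assume f: "f \<in> ?A - rooted_forests {0..<N} N E"
      then obtain i where "i < N" "f i \<noteq> N" "{i, f i} \<notin> E"
        using \<open>insert N {0..<N} = {0..N}\<close> by (auto simp: rooted_forests_def)
      thus "(\<Prod>i = 0..<N. W i (f i)) = 0" by (intro prod_zero) (auto simp: W_def)
    qed
  qed
  also have "\<dots> = (\<Sum>f\<in>rooted_forests {0..<N} N E. x ^ card (forest_roots {0..<N} N f))"
  proof (rule sum.cong[OF refl])
    fix f assume f: "f \<in> rooted_forests {0..<N} N E"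
    have "(\<Prod>i = 0..<N. W i (f i)) = (\<Prod>i = 0..<N. if f i = N then x else 1)"
      using f by (intro prod.cong) (auto simp: W_def rooted_forests_def)
    also have "\<dots> = x ^ card (forest_roots {0..<N} N f)"
      by (simp add: prod.If_cases forest_roots_def Int_def)
    finally show "(\<Prod>i = 0..<N. W i (f i)) = x ^ card (forest_roots {0..<N} N f)" .
  qed
  finally show ?thesis .
qed

section \<open>Block circulant matrices\<close>

definition zeta :: "nat \<Rightarrow> int \<Rightarrow> complex" where
  "zeta n a = cis (2 * pi * of_int a / of_nat n)"

lemma zeta_add: "zeta n (a + b) = zeta n a * zeta n b"
  by (simp add: zeta_def cis_mult add_divide_distrib distrib_left)

lemma zeta_0 [simp]: "zeta n 0 = 1"
  by (simp add: zeta_def)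

lemma zeta_eq_1_iff:
  assumes "n > 0"
  shows "zeta n a = 1 \<longleftrightarrow> int n dvd a"
proof
  assume "zeta n a = 1"
  hence "cos (2 * pi * of_int a / of_nat n) = 1" by (simp add: zeta_def complex_eq_iff)
  then obtain k :: int where "2 * pi * of_int a / of_nat n = of_int k * 2 * pi"
    unfolding cos_one_2pi_int by auto
  hence "of_int a = (of_int (k * int n) :: real)" using assms by (simp add: field_simps)
  thus "int n dvd a" unfolding of_int_eq_iff by simp
next
  assume "int n dvd a"
  then obtain k where "a = int n * k" by auto
  hence "2 * pi * of_int a / of_nat n = 2 * pi * of_int k" using assms by simp
  thus "zeta n a = 1" unfolding zeta_def by (simp only: cis_multiple_2pi Ints_of_int)
qed

lemma zeta_cong:
  assumes "a mod int n = b mod int n"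
  shows "zeta n a = zeta n b"
proof (cases "n = 0")
  case False
  have "int n dvd a - b" using assms by (simp add: mod_eq_dvd_iff)
  hence "zeta n (a - b) = 1" using False by (simp add: zeta_eq_1_iff)
  hence "zeta n (a - b + b) = zeta n b" unfolding zeta_add by simp
  thus ?thesis by simp
qed (use assms in simp)

lemma zeta_power: "zeta n a ^ k = zeta n (a * int k)"
  by (induction k) (simp_all add: zeta_add distrib_left mult.commute)

lemma sum_zeta:
  assumes n: "n > 0"
  shows "(\<Sum>k = 0..<n. zeta n (a * int k)) = (if int n dvd a then of_nat n else 0)"
proof (cases "int n dvd a")
  case True
  hence "zeta n (a * int k) = 1" for k using n by (simp add: zeta_eq_1_iff)
  thus ?thesis using True by simp
next
  case False
  have "zeta n a ^ n = 1" using n by (simp add: zeta_power zeta_eq_1_iff)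
  hence "(1 - zeta n a) * (\<Sum>k<n. zeta n a ^ k) = 0" by (simp add: one_diff_power_eq[symmetric])
  hence "(\<Sum>k<n. zeta n a ^ k) = 0" using False n by (simp add: zeta_eq_1_iff[symmetric])
  thus ?thesis using False by (simp add: zeta_power atLeast0LessThan)
qed

definition circulant :: "nat \<Rightarrow> (int \<Rightarrow> complex) \<Rightarrow> complex mat" where
  "circulant n \<phi> = mat n n (\<lambda>(i, k). \<phi> ((int k - int i) mod int n))"

definition fourier_mat :: "nat \<Rightarrow> complex mat" where
  "fourier_mat n = mat n n (\<lambda>(i, j). zeta n (int i * int j))"

definition dg :: "nat \<Rightarrow> (nat \<Rightarrow> complex) \<Rightarrow> complex mat" where
  "dg n f = mat n n (\<lambda>(i, j). if i = j then f i else 0)"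

definition dft :: "nat \<Rightarrow> (int \<Rightarrow> complex) \<Rightarrow> nat \<Rightarrow> complex" where
  "dft n \<phi> j = (\<Sum>a\<in>Zmod n. \<phi> a * zeta n (a * int j))"

lemma carrier_circ [simp]:
  "circulant n \<phi> \<in> carrier_mat n n" "fourier_mat n \<in> carrier_mat n n" "dg n f \<in> carrier_mat n n"
  by (simp_all add: circulant_def fourier_mat_def dg_def)

lemma mult_dg_index:
  assumes A: "A \<in> carrier_mat n n" and ij: "i < n" "j < n"
  shows "(A * dg n f) $$ (i, j) = A $$ (i, j) * f j"
proof -
  have "(A * dg n f) $$ (i, j) = (\<Sum>k = 0..<n. A $$ (i, k) * (if k = j then f k else 0))"
    using A ij by (simp add: dg_def scalar_prod_def)
  also have "\<dots> = (\<Sum>k = 0..<n. if k = j then A $$ (i, k) * f k else 0)"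
    by (intro sum.cong) auto
  finally show ?thesis using ij by simp
qed

lemma bij_betw_shift_Zmod:
  assumes "n > 0"
  shows "bij_betw (\<lambda>k. (int k - c) mod int n) {0..<n} (Zmod n)"
proof (rule bij_betw_byWitness[where f' = "\<lambda>a. nat ((a + c) mod int n)"])
  show "\<forall>k\<in>{0..<n}. nat (((int k - c) mod int n + c) mod int n) = k"
    by (auto simp: mod_simps)
  show "\<forall>a\<in>Zmod n. (int (nat ((a + c) mod int n)) - c) mod int n = a"
    using assms by (auto simp: Zmod_def mod_simps)
qed (use assms in \<open>auto simp: Zmod_def nat_less_iff\<close>)

text \<open>The characters of the cyclic group are common eigenvectors of all circulants: the shift
  \<open>a = (k - i) mod n\<close> of the summation index pulls out the factor
  \<open>zeta n (i * j)\<close>.\<close>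

lemma circulant_fourier:
  assumes n: "n > 0"
  shows "circulant n \<phi> * fourier_mat n = fourier_mat n * dg n (dft n \<phi>)"
proof (rule eq_matI)
  fix i j assume "i < dim_row (fourier_mat n * dg n (dft n \<phi>))" "j < dim_col (fourier_mat n * dg n (dft n \<phi>))"
  hence ij: "i < n" "j < n" by (auto simp: fourier_mat_def dg_def)
  have "(circulant n \<phi> * fourier_mat n) $$ (i, j) =
    (\<Sum>k = 0..<n. \<phi> ((int k - int i) mod int n) * zeta n (int k * int j))"
    using ij by (simp add: circulant_def fourier_mat_def scalar_prod_def)
  also have "\<dots> = (\<Sum>k = 0..<n. \<phi> ((int k - int i) mod int n) *
       zeta n (((int k - int i) mod int n) * int j) * zeta n (int i * int j))"
  proof (rule sum.cong[OF refl])
    fix k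
    have "zeta n (int k * int j) = zeta n ((int k - int i) mod int n * int j + int i * int j)"
    proof (rule zeta_cong)
      have "((int k - int i) mod int n * int j + int i * int j) mod int n =
            ((int k - int i) * int j + int i * int j) mod int n" by (metis mod_add_left_eq mod_mult_left_eq)
      thus "(int k * int j) mod int n = ((int k - int i) mod int n * int j + int i * int j) mod int n"
        by (simp add: algebra_simps)
    qed
    thus "\<phi> ((int k - int i) mod int n) * zeta n (int k * int j) = \<phi> ((int k - int i) mod int n) *
       zeta n (((int k - int i) mod int n) * int j) * zeta n (int i * int j)"
      by (simp add: zeta_add)
  qed
  also have "\<dots> = dft n \<phi> j * zeta n (int i * int j)"
    unfolding dft_def sum_distrib_right
    by (rule sum.reindex_bij_betw[OF bij_betw_shift_Zmod[OF n], of "\<lambda>a. \<phi> a * zeta n (a * int j) * zeta n (int i * int j)"])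
  also have "\<dots> = (fourier_mat n * dg n (dft n \<phi>)) $$ (i, j)"
    unfolding mult_dg_index[OF carrier_circ(2) ij] using ij by (simp add: fourier_mat_def)
  finally show "(circulant n \<phi> * fourier_mat n) $$ (i, j) = (fourier_mat n * dg n (dft n \<phi>)) $$ (i, j)" .
qed (auto simp: circulant_def fourier_mat_def dg_def)

lemma det_dg: "det (dg n f) = (\<Prod>i<n. f i)"
proof -
  have "det (dg n f) = prod_list (diag_mat (dg n f))"
    by (rule det_upper_triangular[of _ n]) (auto simp: dg_def upper_triangular_def)
  thus ?thesis by (simp add: prod_list_diag_prod dg_def atLeast0LessThan)
qed

lemma dg_mult: "dg n f * dg n g = dg n (\<lambda>i. f i * g i)"
proof (rule eq_matI)
  fix i j assume "i < dim_row (dg n (\<lambda>i. f i * g i))" "j < dim_col (dg n (\<lambda>i. f i * g i))"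
  hence ij: "i < n" "j < n" by (auto simp: dg_def)
  show "(dg n f * dg n g) $$ (i, j) = dg n (\<lambda>i. f i * g i) $$ (i, j)"
    unfolding mult_dg_index[OF carrier_circ(3) ij] using ij by (simp add: dg_def)
qed (auto simp: dg_def)

lemma dg_minus: "dg n f - dg n g = dg n (\<lambda>i. f i - g i)"
  by (rule eq_matI) (auto simp: dg_def)

text \<open>By orthogonality of the characters, the product with the conjugate matrix is
  \<open>n\<close> times the identity.\<close>

lemma det_fourier_mat:
  assumes n: "n > 0"
  shows "det (fourier_mat n) \<noteq> 0"
proof -
  let ?G = "mat n n (\<lambda>(i, j). zeta n (- int i * int j))"
  have "fourier_mat n * ?G = dg n (\<lambda>_. of_nat n)"
  proof (rule eq_matI)
    fix i j assume "i < dim_row (dg n (\<lambda>_. of_nat n :: complex))" "j < dim_col (dg n (\<lambda>_. of_nat n :: complex))"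
    hence ij: "i < n" "j < n" by (auto simp: dg_def)
    have "(fourier_mat n * ?G) $$ (i, j) = (\<Sum>k = 0..<n. zeta n ((int i - int j) * int k))"
      using ij by (simp add: fourier_mat_def scalar_prod_def zeta_add[symmetric] algebra_simps)
    also have "\<dots> = (if int n dvd int i - int j then of_nat n else 0)" by (rule sum_zeta[OF n])
    also have "int n dvd int i - int j \<longleftrightarrow> i = j"
      using ij by (simp add: mod_eq_dvd_iff[symmetric])
    finally show "(fourier_mat n * ?G) $$ (i, j) = dg n (\<lambda>_. of_nat n) $$ (i, j)"
      using ij by (simp add: dg_def)
  qed (auto simp: fourier_mat_def dg_def)
  moreover have "det (fourier_mat n * ?G) = det (fourier_mat n) * det ?G"
    by (rule det_mult) auto
  ultimately have "det (fourier_mat n) * det ?G = of_nat n ^ n" by (simp add: det_dg)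
  thus ?thesis using n by auto
qed

text \<open>Right multiplication by a block diagonal of two Fourier matrices diagonalizes all four
  blocks at once. Diagonal blocks commute, so the determinant reduces to that of A D - B C. The
  Fourier factor cancels because its determinant is nonzero; no inverse matrix has to be
  formed.\<close>

lemma det_block_circulant:
  assumes n: "n > 0"
  shows "det (four_block_mat (circulant n a) (circulant n b) (circulant n c) (circulant n d)) =
    (\<Prod>j<n. dft n a j * dft n d j - dft n b j * dft n c j)"
proof -
  let ?F = "fourier_mat n" and ?D = "\<lambda>f. dg n (dft n f)"
  let ?Z = "0\<^sub>m n n :: complex mat"
  let ?FF = "four_block_mat ?F ?Z ?Z ?F"
  let ?M = "four_block_mat (circulant n a) (circulant n b) (circulant n c) (circulant n d)"
  let ?MD = "four_block_mat (?D a) (?D b) (?D c) (?D d)"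
  have M: "?M \<in> carrier_mat (n + n) (n + n)" and FF: "?FF \<in> carrier_mat (n + n) (n + n)"
    and MD: "?MD \<in> carrier_mat (n + n) (n + n)"
    by (intro four_block_carrier_mat; simp)+
  have c: "circulant n \<phi> * ?Z = ?Z" "?Z * ?F = ?Z" "?F * ?Z = ?Z" "?Z * ?D \<phi> = ?Z" for \<phi>
    by (auto intro!: left_mult_zero_mat right_mult_zero_mat)
  have z: "?F * ?D \<phi> + ?Z = ?F * ?D \<phi>" "?Z + ?F * ?D \<phi> = ?F * ?D \<phi>" for \<phi>
    by (auto intro!: left_add_zero_mat right_add_zero_mat mult_carrier_mat[of _ n n _ n])
  have "?M * ?FF = four_block_mat (?F * ?D a) (?F * ?D b) (?F * ?D c) (?F * ?D d)"
    by (subst mult_four_block_mat[of _ n n _ n _ n _ _ n _ n]) (simp_all add: circulant_fourier[OF n] c z)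
  also have "\<dots> = ?FF * ?MD"
    by (subst mult_four_block_mat[of _ n n _ n _ n _ _ n _ n]) (simp_all add: c z)
  finally have "det (?M * ?FF) = det (?FF * ?MD)" by simp
  hence "det ?M * det ?FF = det ?FF * det ?MD"
    by (simp add: det_mult[OF M FF] det_mult[OF FF MD])
  moreover have "det ?FF = det ?F * det ?F"
    by (rule det_four_block_mat_upper_right_zero) auto
  hence "det ?FF \<noteq> 0" using det_fourier_mat[OF n] by simp
  ultimately have "det ?M = det ?MD" by simp
  also have "\<dots> = det (?D a * ?D d - ?D b * ?D c)"
    by (rule det_four_block_mat[of _ n]) (auto simp: dg_mult mult.commute)
  also have "\<dots> = (\<Prod>j<n. dft n a j * dft n d j - dft n b j * dft n c j)"
    by (simp add: dg_mult dg_minus det_dg)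
  finally show ?thesis .
qed

section \<open>Spanning trees of bicirculant graphs\<close>

definition exp_sum :: "nat \<Rightarrow> int set \<Rightarrow> int \<Rightarrow> complex" where
  "exp_sum n X j = (\<Sum>a\<in>X. zeta n (a * j))"

lemma exp_sum_0 [simp]: "exp_sum n X 0 = of_nat (card X)"
  by (simp add: exp_sum_def)

lemma dft_diag:
  assumes "n > 0" "X \<subseteq> Zmod n"
  shows "dft n (\<lambda>a. (if a = 0 then x else 0) - (if a \<in> X then 1 else 0)) j = x - exp_sum n X (int j)"
proof -
  have [simp]: "finite (Zmod n)" by (simp add: Zmod_def)
  have "dft n (\<lambda>a. (if a = 0 then x else 0) - (if a \<in> X then 1 else 0)) j =
    (\<Sum>a\<in>Zmod n. if a = 0 then x else 0) - (\<Sum>a\<in>Zmod n. if a \<in> X then zeta n (a * int j) else 0)"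
    unfolding dft_def sum_subtractf[symmetric] by (intro sum.cong) (auto simp: algebra_simps)
  also have "(\<Sum>a\<in>Zmod n. if a \<in> X then zeta n (a * int j) else 0) = exp_sum n X (int j)"
    using assms(2) by (simp add: exp_sum_def sum.inter_restrict[symmetric] Int_absorb1)
  also have "(\<Sum>a\<in>Zmod n. if a = 0 then x else 0) = x"
    using assms(1) by (simp add: Zmod_def)
  finally show ?thesis .
qed

lemma dft_off:
  assumes "n > 0" "X \<subseteq> Zmod n"
  shows "dft n (\<lambda>a. - (if a \<in> X then 1 else 0)) j = - exp_sum n X (int j)"
  using dft_diag[OF assms, of 0 j] by simp

lemma bij_betw_neg_Zmod:
  assumes "n > 0"
  shows "bij_betw (\<lambda>a. (- a) mod int n) (Zmod n) (Zmod n)"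
  by (rule bij_betw_byWitness[where f' = "\<lambda>a. (- a) mod int n"])
     (use assms in \<open>auto simp: Zmod_def mod_simps\<close>)

text \<open>The lower left block is the transpose of the upper right one. The substitution of
  \<open>- a\<close> for \<open>a\<close> moves the sign into the frequency.\<close>

lemma dft_off_neg:
  assumes n: "n > 0" and X: "X \<subseteq> Zmod n"
  shows "dft n (\<lambda>a. - (if (- a) mod int n \<in> X then 1 else 0)) j = - exp_sum n X (- int j)"
proof -
  have "dft n (\<lambda>a. - (if (- a) mod int n \<in> X then 1 else 0)) j =
    (\<Sum>a\<in>Zmod n. - (if (- a) mod int n \<in> X then 1 else 0) * zeta n ((- a) mod int n * - int j))"
    unfolding dft_def
  proof (intro sum.cong refl arg_cong2[of _ _ _ _ "(*)"] zeta_cong)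
    fix a
    have "((- a) mod int n * - int j) mod int n = ((- a) * - int j) mod int n" by (rule mod_mult_left_eq)
    thus "a * int j mod int n = ((- a) mod int n * - int j) mod int n" by simp
  qed
  also have "\<dots> = (\<Sum>a\<in>Zmod n. - (if a \<in> X then 1 else 0) * zeta n (a * - int j))"
    by (rule sum.reindex_bij_betw[OF bij_betw_neg_Zmod[OF n], of "\<lambda>a. - (if a \<in> X then 1 else 0) * zeta n (a * - int j)"])
  also have "\<dots> = - (\<Sum>a\<in>Zmod n. if a \<in> X then zeta n (a * - int j) else 0)"
    unfolding sum_negf[symmetric] by (intro sum.cong) auto
  also have "(\<Sum>a\<in>Zmod n. if a \<in> X then zeta n (a * - int j) else 0) = exp_sum n X (- int j)"
    using X by (simp add: exp_sum_def sum.inter_restrict[symmetric] Int_absorb1 Zmod_def)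
  finally show ?thesis .
qed

text \<open>The numbers below \<open>n\<close> run through layer 0 and the next \<open>n\<close>
  through layer 1, so that the Laplacian falls into four \<open>n\<close> by \<open>n\<close>
  circulant blocks.\<close>

definition vertex_at :: "nat \<Rightarrow> nat \<Rightarrow> int \<times> nat" where
  "vertex_at n i = (if i < n then (int i, 0) else (int i - int n, 1))"

lemma vertex_at_image: "vertex_at n ` {0..<2 * n} = Zmod n \<times> {0, 1}"
proof (intro equalityI subsetI)
  fix v :: "int \<times> nat" assume "v \<in> Zmod n \<times> {0, 1}"
  then obtain h :: int and e :: nat where v: "v = (h, e)" "0 \<le> h" "h < int n" "e = 0 \<or> e = 1"
    by (auto simp: Zmod_def)
  hence "v = vertex_at n (nat h + e * n)" "nat h + e * n \<in> {0..<2 * n}"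
    by (auto simp: vertex_at_def)
  thus "v \<in> vertex_at n ` {0..<2 * n}" by blast
qed (auto simp: vertex_at_def Zmod_def)

lemma inj_vertex_at: "inj_on (vertex_at n) {0..<2 * n}"
  by (auto simp: inj_on_def vertex_at_def split: if_splits)

text \<open>An unordered edge within a layer records a difference only up to sign, hence the
  symmetry of \<open>R\<close> and \<open>T\<close>. Between the layers the second components fix
  the orientation.\<close>

lemma bicirculant_edges:
  assumes R: "\<And>a. a \<in> R \<Longrightarrow> (- a) mod int n \<in> R" and T: "\<And>a. a \<in> T \<Longrightarrow> (- a) mod int n \<in> T"
  shows "{(h, 0), (g, 0)} \<in> snd (bicirculant n R T S) \<longleftrightarrow> h \<in> Zmod n \<and> g \<in> Zmod n \<and> (g - h) mod int n \<in> R"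
    and "{(h, 1), (g, 1)} \<in> snd (bicirculant n R T S) \<longleftrightarrow> h \<in> Zmod n \<and> g \<in> Zmod n \<and> (g - h) mod int n \<in> T"
    and "{(h, 0), (g, 1)} \<in> snd (bicirculant n R T S) \<longleftrightarrow> h \<in> Zmod n \<and> g \<in> Zmod n \<and> (g - h) mod int n \<in> S"
proof -
  have "(h - g) mod int n \<in> R \<Longrightarrow> (g - h) mod int n \<in> R"
    "(h - g) mod int n \<in> T \<Longrightarrow> (g - h) mod int n \<in> T" for g h :: int
    using R[of "(h - g) mod int n"] T[of "(h - g) mod int n"] by (auto simp: mod_minus_eq)
  thus "{(h, 0), (g, 0)} \<in> snd (bicirculant n R T S) \<longleftrightarrow> h \<in> Zmod n \<and> g \<in> Zmod n \<and> (g - h) mod int n \<in> R"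
    "{(h, 1), (g, 1)} \<in> snd (bicirculant n R T S) \<longleftrightarrow> h \<in> Zmod n \<and> g \<in> Zmod n \<and> (g - h) mod int n \<in> T"
    "{(h, 0), (g, 1)} \<in> snd (bicirculant n R T S) \<longleftrightarrow> h \<in> Zmod n \<and> g \<in> Zmod n \<and> (g - h) mod int n \<in> S"
    by (auto simp: bicirculant_def doubleton_eq_iff)
qed

lemma bicirculant_edges_subset: "snd (bicirculant n R T S) \<subseteq> Pow (Zmod n \<times> {0, 1})"
  by (auto simp: bicirculant_def)

lemma card_shifted:
  assumes "n > 0" "X \<subseteq> Zmod n"
  shows "card {k. k < n \<and> (int k - c) mod int n \<in> X} = card X"
proof -
  have b: "bij_betw (\<lambda>k. (int k - c) mod int n) {0..<n} (Zmod n)" by (rule bij_betw_shift_Zmod[OF assms(1)])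
  have "bij_betw (\<lambda>k. (int k - c) mod int n) {k. k < n \<and> (int k - c) mod int n \<in> X} X"
    unfolding bij_betw_def
  proof (intro conjI)
    show "inj_on (\<lambda>k. (int k - c) mod int n) {k. k < n \<and> (int k - c) mod int n \<in> X}"
      by (rule inj_on_subset[OF bij_betw_imp_inj_on[OF b]]) auto
    show "(\<lambda>k. (int k - c) mod int n) ` {k. k < n \<and> (int k - c) mod int n \<in> X} = X"
      using bij_betw_imp_surj_on[OF b] assms(2) by force
  qed
  thus ?thesis by (rule bij_betw_same_card)
qed

lemma card_shifted_neg:
  assumes "n > 0" "X \<subseteq> Zmod n"
  shows "card {k. k < n \<and> (c - int k) mod int n \<in> X} = card X"
proof -
  let ?Y = "(\<lambda>a. (- a) mod int n) ` X"
  have inv: "(- ((- a) mod int n)) mod int n = a" if "a \<in> Zmod n" for a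
    using that by (simp add: mod_minus_eq Zmod_def)
  have Y: "?Y \<subseteq> Zmod n" using assms(1) by (auto simp: Zmod_def)
  have "(c - int k) mod int n \<in> X \<longleftrightarrow> (int k - c) mod int n \<in> ?Y" for k
  proof
    assume "(c - int k) mod int n \<in> X"
    thus "(int k - c) mod int n \<in> ?Y" by (rule rev_image_eqI) (simp add: mod_minus_eq)
  next
    assume "(int k - c) mod int n \<in> ?Y"
    then obtain a where a: "a \<in> X" "(int k - c) mod int n = (- a) mod int n" by auto
    have "(- ((int k - c) mod int n)) mod int n = a" unfolding a(2) using inv a(1) assms(2) by auto
    thus "(c - int k) mod int n \<in> X" using a(1) by (simp add: mod_minus_eq)
  qed
  hence "card {k. k < n \<and> (c - int k) mod int n \<in> X} = card ?Y"
    using card_shifted[OF assms(1) Y, of c] by simp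
  also have "\<dots> = card X"
    by (rule card_image) (rule inj_on_subset[OF bij_betw_imp_inj_on[OF bij_betw_neg_Zmod[OF assms(1)]] assms(2)])
  finally show ?thesis .
qed

lemma card_split_double:
  fixes n :: nat
  shows "card {k. k < 2 * n \<and> P k} = card {k. k < n \<and> P k} + card {k. k < n \<and> P (k + n)}"
proof -
  have "{k. k < 2 * n \<and> P k} = {k. k < n \<and> P k} \<union> (\<lambda>k. k + n) ` {k. k < n \<and> P (k + n)}"
  proof (intro equalityI subsetI)
    fix k assume k: "k \<in> {k. k < 2 * n \<and> P k}"
    show "k \<in> {k. k < n \<and> P k} \<union> (\<lambda>k. k + n) ` {k. k < n \<and> P (k + n)}"
    proof (cases "k < n")
      case False
      hence "k = (k - n) + n" "k - n < n" using k by auto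
      thus ?thesis using k by (intro UnI2 image_eqI[of _ _ "k - n"]) auto
    qed (use k in auto)
  qed auto
  moreover have "card ((\<lambda>k. k + n) ` {k. k < n \<and> P (k + n)}) = card {k. k < n \<and> P (k + n)}"
    by (rule card_image) auto
  moreover have "card ({k. k < n \<and> P k} \<union> (\<lambda>k. k + n) ` {k. k < n \<and> P (k + n)}) =
    card {k. k < n \<and> P k} + card ((\<lambda>k. k + n) ` {k. k < n \<and> P (k + n)})"
    by (rule card_Un_disjoint) auto
  ultimately show ?thesis by simp
qed

lemma bicirculant_forests:
  fixes x :: complex
  assumes n: "n > 0" and sub: "R \<subseteq> Zmod n" "T \<subseteq> Zmod n" "S \<subseteq> Zmod n"
    and R: "\<And>a. a \<in> R \<Longrightarrow> (- a) mod int n \<in> R" and T: "\<And>a. a \<in> T \<Longrightarrow> (- a) mod int n \<in> T"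
    and 0: "0 \<notin> R" "0 \<notin> T"
    and E: "E = {e. e \<subseteq> {0..<2 * n} \<and> vertex_at n ` e \<in> snd (bicirculant n R T S)}"
  shows "(\<Sum>f\<in>rooted_forests {0..<2 * n} (2 * n) E. x ^ card (forest_roots {0..<2 * n} (2 * n) f)) =
    (\<Prod>j<n. (x + of_nat (card R + card S) - exp_sum n R (int j)) *
      (x + of_nat (card T + card S) - exp_sum n T (int j)) - exp_sum n S (int j) * exp_sum n S (- int j))"
proof -
  note edges = bicirculant_edges[where n = n and R = R and T = T and S = S, OF R T, simplified]
  have edge: "{i, j} \<in> E \<longleftrightarrow> i < 2 * n \<and> j < 2 * n \<and>
    {vertex_at n i, vertex_at n j} \<in> snd (bicirculant n R T S)" for i j by (auto simp: E)
  have e00: "{i, j} \<in> E \<longleftrightarrow> (int j - int i) mod int n \<in> R" if "i < n" "j < n" for i j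
    using that by (simp add: edge vertex_at_def edges Zmod_def)
  have e11: "{i + n, j + n} \<in> E \<longleftrightarrow> (int j - int i) mod int n \<in> T" if "i < n" "j < n" for i j
    using that by (simp add: edge vertex_at_def edges Zmod_def)
  have e01: "{i, j + n} \<in> E \<longleftrightarrow> (int j - int i) mod int n \<in> S" if "i < n" "j < n" for i j
    using that by (simp add: edge vertex_at_def edges Zmod_def)
  have e10: "{i + n, j} \<in> E \<longleftrightarrow> (int i - int j) mod int n \<in> S" if "i < n" "j < n" for i j
    using e01[OF that(2,1)] by (simp add: insert_commute)
  have loop: "{i} \<notin> E" for i
  proof
    assume i: "{i} \<in> E"
    show False
    proof (cases "i < n")
      case True thus ?thesis using e00[of i i] i 0 by simp
    next
      case False
      moreover have "i < 2 * n" using i by (auto simp: E)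
      ultimately have "i - n < n" "i = (i - n) + n" by auto
      thus ?thesis using e11[of "i - n" "i - n"] i 0 by simp
    qed
  qed
  have deg0: "card {k. k < 2 * n \<and> {i, k} \<in> E} = card R + card S" if i: "i < n" for i
  proof -
    have "{k. k < n \<and> {i, k} \<in> E} = {k. k < n \<and> (int k - int i) mod int n \<in> R}"
      "{k. k < n \<and> {i, k + n} \<in> E} = {k. k < n \<and> (int k - int i) mod int n \<in> S}"
      using e00[OF i] e01[OF i] by auto
    thus ?thesis by (simp add: card_split_double card_shifted n sub)
  qed
  have deg1: "card {k. k < 2 * n \<and> {i + n, k} \<in> E} = card T + card S" if i: "i < n" for i
  proof -
    have "{k. k < n \<and> {i + n, k} \<in> E} = {k. k < n \<and> (int i - int k) mod int n \<in> S}"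
      "{k. k < n \<and> {i + n, k + n} \<in> E} = {k. k < n \<and> (int k - int i) mod int n \<in> T}"
      using e10[OF i] e11[OF i] by auto
    thus ?thesis by (simp add: card_split_double card_shifted card_shifted_neg n sub)
  qed
  \<comment> \<open>The entries of the four blocks of x I + L as functions of column minus row. The
    sign in \<open>c\<close> reflects that an edge is always measured from layer 0 to layer
    1.\<close>
  define a where "a = (\<lambda>h. (if h = 0 then x + of_nat (card R + card S) else 0) - (if h \<in> R then 1 else 0))"
  define d where "d = (\<lambda>h. (if h = 0 then x + of_nat (card T + card S) else 0) - (if h \<in> T then 1 else 0))"
  define b where "b = (\<lambda>h. - (if h \<in> S then 1 else (0 :: complex)))"
  define c where "c = (\<lambda>h. - (if (- h) mod int n \<in> S then 1 else (0 :: complex)))"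
  have diff0: "(int j - int i) mod int n = 0 \<longleftrightarrow> i = j" if "i < n" "j < n" for i j
    using that by (auto simp: mod_eq_dvd_iff[symmetric] mod_eq_0_iff_dvd)
  let ?L = "mat (2 * n) (2 * n) (\<lambda>(i, j). if i = j then x + of_nat (card {k. k < 2 * n \<and> {i, k} \<in> E})
      else - (if {i, j} \<in> E then 1 else 0))"
  have "?L = four_block_mat (circulant n a) (circulant n b) (circulant n c) (circulant n d)" (is "_ = ?B")
  proof (rule eq_matI)
    fix i j assume "i < dim_row ?B" "j < dim_col ?B"
    hence ij: "i < 2 * n" "j < 2 * n" by (auto simp: circulant_def)
    consider "i < n" "j < n" | "i < n" "\<not> j < n" | "\<not> i < n" "j < n" | "\<not> i < n" "\<not> j < n" by blast
    thus "?L $$ (i, j) = ?B $$ (i, j)"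
    proof cases
      case 1
      thus ?thesis using e00[OF 1] deg0[OF 1(1)] 0 diff0[OF 1]
        by (auto simp: circulant_def a_def)
    next
      case 2
      then obtain j' where j': "j = j' + n" "j' < n" using ij by (metis add.commute le_add_diff_inverse2 less_diff_conv2 linorder_not_less mult_2)
      thus ?thesis using e01[OF 2(1) j'(2)] 2
        by (auto simp: circulant_def b_def)
    next
      case 3
      then obtain i' where i': "i = i' + n" "i' < n" using ij by (metis add.commute le_add_diff_inverse2 less_diff_conv2 linorder_not_less mult_2)
      thus ?thesis using e10[OF i'(2) 3(2)] 3
        by (auto simp: circulant_def c_def mod_minus_eq)
    next
      case 4
      then obtain i' j' where i': "i = i' + n" "i' < n" "j = j' + n" "j' < n" using ij by (metis add.commute le_add_diff_inverse2 less_diff_conv2 linorder_not_less mult_2)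
      thus ?thesis using e11[OF i'(2,4)] deg1[OF i'(2)] 0 diff0[OF i'(2,4)]
        by (auto simp: circulant_def d_def)
    qed
  qed (auto simp: circulant_def)
  hence "det ?L = (\<Prod>j<n. dft n a j * dft n d j - dft n b j * dft n c j)"
    using det_block_circulant[OF n] by simp
  also have "\<dots> = (\<Prod>j<n. (x + of_nat (card R + card S) - exp_sum n R (int j)) *
      (x + of_nat (card T + card S) - exp_sum n T (int j)) - exp_sum n S (int j) * exp_sum n S (- int j))"
    unfolding a_def b_def c_def d_def
    using dft_diag[OF n sub(1)] dft_diag[OF n sub(2)] dft_off[OF n sub(3)] dft_off_neg[OF n sub(3)] by simp
  finally show ?thesis using det_laplacian_forests[where N = "2 * n" and x = x and E = E, OF loop] by simp
qed

text \<open>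
  The coefficient of \<open>x\<close> in the forest polynomial counts the rooted spanning trees; on the spectral
  side the trivial character contributes the factor \<open>x (x + 2|S|)\<close>.
\<close>

lemma bicirculant_num_spanning_trees:
  assumes n: "n > 0" and sub: "R \<subseteq> Zmod n" "T \<subseteq> Zmod n" "S \<subseteq> Zmod n"
    and R: "\<And>a. a \<in> R \<Longrightarrow> (- a) mod int n \<in> R" and T: "\<And>a. a \<in> T \<Longrightarrow> (- a) mod int n \<in> T"
    and 0: "0 \<notin> R" "0 \<notin> T"
  shows "of_nat (n * num_spanning_trees (bicirculant n R T S)) = of_nat (card S) *
    (\<Prod>j=1..<n. (of_nat (card R + card S) - exp_sum n R (int j)) *
      (of_nat (card T + card S) - exp_sum n T (int j)) - exp_sum n S (int j) * exp_sum n S (- int j))"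
proof -
  define E where "E = {e. e \<subseteq> {0..<2 * n} \<and> vertex_at n ` e \<in> snd (bicirculant n R T S)}"
  let ?V = "{0..<2 * n}"
  let ?F = "rooted_forests ?V (2 * n) E" and ?r = "\<lambda>f. card (forest_roots ?V (2 * n) f)"
  define Q where "Q = (\<lambda>x j. (x + of_nat (card R + card S) - exp_sum n R (int j)) *
      (x + of_nat (card T + card S) - exp_sum n T (int j)) - exp_sum n S (int j) * exp_sum n S (- int j))"
  have img: "(`) (vertex_at n) ` E = snd (bicirculant n R T S)"
  proof (intro equalityI subsetI)
    fix e assume e: "e \<in> snd (bicirculant n R T S)"
    hence "e \<subseteq> vertex_at n ` ?V" using bicirculant_edges_subset vertex_at_image by fastforce
    then obtain e' where "e' \<subseteq> ?V" "e = vertex_at n ` e'" by (auto simp: subset_image_iff)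
    thus "e \<in> (`) (vertex_at n) ` E" using e by (auto simp: E_def)
  qed (auto simp: E_def)
  have "num_spanning_trees (bicirculant n R T S) =
    num_spanning_trees (vertex_at n ` ?V, (`) (vertex_at n) ` E)"
    unfolding img vertex_at_image by (simp add: bicirculant_def)
  also have "\<dots> = num_spanning_trees (?V, E)"
    by (rule num_spanning_trees_image[OF inj_vertex_at]) (auto simp: E_def)
  finally have iso: "num_spanning_trees (bicirculant n R T S) = num_spanning_trees (?V, E)" .
  have E1: "\<exists>u v. e = {u, v} \<and> u \<noteq> v" if "e \<in> E" for e
  proof -
    have e: "e \<subseteq> ?V" "vertex_at n ` e \<in> snd (bicirculant n R T S)" using that by (auto simp: E_def)
    have "\<exists>p q. vertex_at n ` e = {p, q} \<and> p \<noteq> q"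
      using e(2) 0 by (auto simp: bicirculant_def) (metis diff_self mod_0 prod.inject)+
    hence "card (vertex_at n ` e) = 2" by (auto simp: card_2_iff)
    hence "card e = 2" using card_image[OF inj_on_subset[OF inj_vertex_at e(1)]] by simp
    thus ?thesis by (auto simp: card_2_iff)
  qed
  have count: "card {f \<in> ?F. ?r f = 1} = 2 * n * num_spanning_trees (?V, E)"
  proof -
    have "u \<noteq> v \<and> u \<in> ?V \<and> v \<in> ?V" if "{u, v} \<in> E" for u v
    proof -
      have "u \<noteq> v" using E1[OF that] by (auto simp: doubleton_eq_iff)
      moreover have "{u, v} \<subseteq> ?V" using that by (auto simp only: E_def)
      ultimately show ?thesis by auto
    qed
    moreover have "\<exists>u v. e = {u, v}" if "e \<in> E" for e using E1[OF that] by blast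
    ultimately show ?thesis using card_single_root_forests[of ?V "2 * n" E] by simp
  qed
  have fin: "finite ?F"
    by (rule finite_subset[of _ "?V \<rightarrow>\<^sub>E insert (2 * n) ?V"]) (auto simp: rooted_forests_def intro!: finite_PiE)
  have pos: "?r f > 0" if "f \<in> ?F" for f
  proof -
    have "finite (forest_roots ?V (2 * n) f)" by (auto simp: forest_roots_def)
    thus ?thesis using forest_root_exists[OF that] n by (simp add: card_gt_0_iff)
  qed
  \<comment> \<open>The forest polynomial divided by x. The truncated subtraction is exact since
    every forest has a root.\<close>
  let ?p = "\<lambda>x::complex. \<Sum>f\<in>?F. x ^ (?r f - 1)"
  let ?q = "\<lambda>x. (x + 2 * of_nat (card S)) * (\<Prod>j=1..<n. Q x j)"
  have eq: "?p x = ?q x" if x: "x \<noteq> 0" for x :: complex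
  proof -
    have "x * ?p x = (\<Sum>f\<in>?F. x ^ ?r f)"
      unfolding sum_distrib_left
    proof (rule sum.cong[OF refl])
      fix f assume "f \<in> ?F"
      thus "x * x ^ (?r f - 1) = x ^ ?r f" using pos[of f] by (simp add: power_eq_if)
    qed
    also have "\<dots> = (\<Prod>j<n. Q x j)"
      unfolding Q_def by (rule bicirculant_forests[OF n sub R T 0 E_def])
    also have "\<dots> = Q x 0 * (\<Prod>j=1..<n. Q x j)"
      using n by (simp add: lessThan_atLeast0 prod.atLeast_Suc_lessThan)
    also have "Q x 0 = x * (x + 2 * of_nat (card S))" by (simp add: Q_def algebra_simps)
    finally show ?thesis using x by simp
  qed
  \<comment> \<open>The division excluded x = 0, which is the value of interest; continuity of both
    polynomials recovers it.\<close>
  have "isCont ?p 0" by (intro continuous_intros)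
  hence p: "?p \<midarrow>0\<rightarrow> ?p 0" by (simp only: isCont_def)
  have "isCont ?q 0" unfolding Q_def by (intro continuous_intros)
  hence q: "?q \<midarrow>0\<rightarrow> ?q 0" by (simp only: isCont_def)
  have "(?p \<midarrow>0\<rightarrow> ?p 0) = (?q \<midarrow>0\<rightarrow> ?p 0)" by (rule LIM_equal) (use eq in auto)
  hence "?p 0 = ?q 0" using p q by (intro LIM_unique[of ?q]) simp_all
  \<comment> \<open>As \<open>0 ^ 0 = 1\<close>, evaluation at 0 keeps precisely the forests with
    one root.\<close>
  moreover have "?p 0 = (\<Sum>f\<in>?F. if ?r f = 1 then 1 else 0)"
  proof (rule sum.cong[OF refl])
    fix f assume "f \<in> ?F"
    thus "(0::complex) ^ (?r f - 1) = (if ?r f = 1 then 1 else 0)" using pos[of f] by (auto simp: power_0_left)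
  qed
  moreover have "(\<Sum>f\<in>?F. if ?r f = 1 then 1 else 0) = (of_nat (card {f \<in> ?F. ?r f = 1}) :: complex)"
    using fin by (simp add: sum.If_cases Int_def conj_commute)
  ultimately have "of_nat (2 * n * num_spanning_trees (?V, E)) = 2 * of_nat (card S) * (\<Prod>j=1..<n. Q 0 j)"
    using count by simp
  thus ?thesis unfolding iso Q_def by simp
qed

section \<open>Riemann sums of periodic functions\<close>

text \<open>The smoothness consumed by the Taylor estimate below. Derivatives are taken on the whole
  line, so no one-sided derivatives occur at 0 and 1.\<close>

definition twice_cont_diff :: "(real \<Rightarrow> real) \<Rightarrow> bool" where
  "twice_cont_diff f \<longleftrightarrow> (\<exists>f' f''. (\<forall>x. (f has_real_derivative f' x) (at x)) \<and>
     (\<forall>x. (f' has_real_derivative f'' x) (at x)) \<and> continuous_on UNIV f'')"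

lemma twice_cont_diffI:
  assumes "\<And>x. (f has_real_derivative f' x) (at x)" "\<And>x. (f' has_real_derivative f'' x) (at x)"
    "continuous_on UNIV f''"
  shows "twice_cont_diff f"
  using assms unfolding twice_cont_diff_def by blast

lemma has_real_derivative_imp_continuous:
  assumes "\<And>x. (f has_real_derivative f' x) (at x)"
  shows "continuous_on UNIV f"
  using assms by (intro continuous_at_imp_continuous_on) (auto intro: DERIV_isCont)

lemma twice_cont_diff_const: "twice_cont_diff (\<lambda>x. c)"
  by (rule twice_cont_diffI[of _ "\<lambda>_. 0" "\<lambda>_. 0"]) auto

lemma twice_cont_diff_cos: "twice_cont_diff (\<lambda>x. cos (c * x))"
  by (rule twice_cont_diffI[of _ "\<lambda>x. - c * sin (c * x)" "\<lambda>x. - c * (c * cos (c * x))"])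
     (auto intro!: derivative_eq_intros continuous_intros)

lemma twice_cont_diff_sin: "twice_cont_diff (\<lambda>x. sin (c * x))"
  by (rule twice_cont_diffI[of _ "\<lambda>x. c * cos (c * x)" "\<lambda>x. - c * (c * sin (c * x))"])
     (auto intro!: derivative_eq_intros continuous_intros)

lemma twice_cont_diff_add:
  assumes "twice_cont_diff f" "twice_cont_diff g"
  shows "twice_cont_diff (\<lambda>x. f x + g x)"
proof -
  obtain f' f'' g' g'' where *: "\<And>x. (f has_real_derivative f' x) (at x)" "\<And>x. (f' has_real_derivative f'' x) (at x)"
    "continuous_on UNIV f''" "\<And>x. (g has_real_derivative g' x) (at x)" "\<And>x. (g' has_real_derivative g'' x) (at x)"
    "continuous_on UNIV g''" using assms unfolding twice_cont_diff_def by blast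
  show ?thesis
    by (rule twice_cont_diffI[of _ "\<lambda>x. f' x + g' x" "\<lambda>x. f'' x + g'' x"]) (intro DERIV_add continuous_intros *)+
qed

lemma twice_cont_diff_mult:
  assumes "twice_cont_diff f" "twice_cont_diff g"
  shows "twice_cont_diff (\<lambda>x. f x * g x)"
proof -
  obtain f' f'' g' g'' where *: "\<And>x. (f has_real_derivative f' x) (at x)" "\<And>x. (f' has_real_derivative f'' x) (at x)"
    "continuous_on UNIV f''" "\<And>x. (g has_real_derivative g' x) (at x)" "\<And>x. (g' has_real_derivative g'' x) (at x)"
    "continuous_on UNIV g''" using assms unfolding twice_cont_diff_def by blast
  note c = has_real_derivative_imp_continuous[of f, OF *(1)] has_real_derivative_imp_continuous[of f', OF *(2)]
    has_real_derivative_imp_continuous[of g, OF *(4)] has_real_derivative_imp_continuous[of g', OF *(5)]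
  show ?thesis
  proof (rule twice_cont_diffI[of _ "\<lambda>x. f x * g' x + f' x * g x" "\<lambda>x. (f x * g'' x + f' x * g' x) + (f' x * g' x + f'' x * g x)"])
    show "continuous_on UNIV (\<lambda>x. (f x * g'' x + f' x * g' x) + (f' x * g' x + f'' x * g x))"
      by (intro continuous_intros * c)
  qed (intro DERIV_add DERIV_mult' *)+
qed

lemma twice_cont_diff_sum:
  assumes "finite I" "\<And>i. i \<in> I \<Longrightarrow> twice_cont_diff (f i)"
  shows "twice_cont_diff (\<lambda>x. \<Sum>i\<in>I. f i x)"
  using assms by (induction I rule: finite_induct) (auto intro: twice_cont_diff_add twice_cont_diff_const)

lemma twice_cont_diff_ln:
  assumes "twice_cont_diff f" "\<And>x. f x > 0"
  shows "twice_cont_diff (\<lambda>x. ln (f x))"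
proof -
  obtain f' f'' where *: "\<And>x. (f has_real_derivative f' x) (at x)" "\<And>x. (f' has_real_derivative f'' x) (at x)"
    "continuous_on UNIV f''" using assms(1) unfolding twice_cont_diff_def by blast
  have nz: "f x \<noteq> 0" for x using assms(2)[of x] by simp
  show ?thesis
  proof (rule twice_cont_diffI[of _ "\<lambda>x. 1 / f x * f' x" "\<lambda>x. (f'' x * f x - f' x * f' x) / (f x * f x)"])
    show "((\<lambda>x. ln (f x)) has_real_derivative 1 / f x * f' x) (at x)" for x
      by (rule DERIV_chain2[OF DERIV_ln_divide[OF assms(2)] *(1)])
    show "((\<lambda>x. 1 / f x * f' x) has_real_derivative (f'' x * f x - f' x * f' x) / (f x * f x)) (at x)" for x
      using DERIV_divide[OF *(2)[of x] *(1)[of x] nz[of x]] by simp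
    show "continuous_on UNIV (\<lambda>x. (f'' x * f x - f' x * f' x) / (f x * f x))"
      by (intro continuous_intros *(3) has_real_derivative_imp_continuous[of f, OF *(1)]
            has_real_derivative_imp_continuous[of f', OF *(2)]) (use nz in auto)
  qed
qed

lemma twice_cont_diff_continuous: "twice_cont_diff f \<Longrightarrow> continuous_on A f"
  using has_real_derivative_imp_continuous continuous_on_subset unfolding twice_cont_diff_def by (metis subset_UNIV)

text \<open>
  By Taylor's formula, sampling a cell at the relative position \<open>\<delta>\<close> instead of averaging over it
  costs, up to third order, a multiple of the increment of the function over the cell. Summing over
  a period these increments telescope to zero.
\<close>

lemma cell_sample_error:
  fixes h h' h'' H :: "real \<Rightarrow> real"
  assumes H: "\<And>x. x \<in> {0..1} \<Longrightarrow> (H has_real_derivative h x) (at x)"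
    and h: "\<And>x. (h has_real_derivative h' x) (at x)" and h': "\<And>x. (h' has_real_derivative h'' x) (at x)"
    and B: "\<And>x. x \<in> {0..1} \<Longrightarrow> \<bar>h'' x\<bar> \<le> B"
    and a: "0 \<le> a" "a + \<epsilon> \<le> 1" "0 < \<epsilon>" and \<delta>: "0 \<le> \<delta>" "\<delta> \<le> 1"
  shows "\<bar>\<epsilon> * h (a + \<delta> * \<epsilon>) - (H (a + \<epsilon>) - H a) - (\<delta> - 1/2) * \<epsilon> * (h (a + \<epsilon>) - h a)\<bar> \<le> B * \<epsilon> ^ 3"
proof -
  have B0: "B \<ge> 0" using B[of 0] by auto
  have T2: "\<bar>h (a + u) - h a - h' a * u\<bar> \<le> B * \<epsilon>\<^sup>2 / 2" if u: "0 \<le> u" "u \<le> \<epsilon>" for u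
  proof (cases "u = 0")
    case False
    define d where "d = (\<lambda>m::nat. if m = 0 then h else if m = 1 then h' else h'')"
    have "\<exists>t>a. t < a + u \<and> h (a + u) = (\<Sum>m<2. (d m a / fact m) * (a + u - a)^m) + (d 2 t / fact 2) * (a + u - a)^2"
      by (rule Taylor_up[where n = 2 and f = h and a = a and b = "a + u" and c = a and diff = d])
         (use False u h h' in \<open>auto simp: d_def less_2_cases_iff\<close>)
    then obtain t where t: "t > a" "t < a + u" "h (a + u) = h a + h' a * u + h'' t / 2 * u\<^sup>2"
      by (auto simp: d_def numeral_2_eq_2)
    have "\<bar>h'' t\<bar> \<le> B" using t u a by (intro B) auto
    moreover have "u\<^sup>2 \<le> \<epsilon>\<^sup>2" using u by (simp add: power_mono)
    ultimately have "\<bar>h'' t\<bar> * u\<^sup>2 \<le> B * \<epsilon>\<^sup>2" using B0 by (intro mult_mono) auto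
    thus ?thesis using t(3) by (simp add: abs_mult)
  qed (use B0 in simp)
  have T3: "\<bar>H (a + \<epsilon>) - H a - h a * \<epsilon> - h' a * \<epsilon>\<^sup>2 / 2\<bar> \<le> B * \<epsilon> ^ 3 / 6"
  proof -
    define d where "d = (\<lambda>m::nat. if m = 0 then H else if m = 1 then h else if m = 2 then h' else h'')"
    have "\<exists>t>a. t < a + \<epsilon> \<and> H (a + \<epsilon>) = (\<Sum>m<3. (d m a / fact m) * (a + \<epsilon> - a)^m) + (d 3 t / fact 3) * (a + \<epsilon> - a)^3"
    proof (rule Taylor_up[where n = 3 and f = H and a = a and b = "a + \<epsilon>" and c = a and diff = d])
      show "\<forall>m t. m < 3 \<and> a \<le> t \<and> t \<le> a + \<epsilon> \<longrightarrow> (d m has_real_derivative d (Suc m) t) (at t)"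
      proof (intro allI impI)
        fix m t assume *: "m < (3::nat) \<and> a \<le> t \<and> t \<le> a + \<epsilon>"
        hence "m = 0 \<or> m = 1 \<or> m = 2" "t \<in> {0..1}" using a by auto
        thus "(d m has_real_derivative d (Suc m) t) (at t)" using H h h' by (auto simp: d_def)
      qed
    qed (use a in \<open>auto simp: d_def\<close>)
    then obtain t where t: "t > a" "t < a + \<epsilon>"
      "H (a + \<epsilon>) = H a + h a * \<epsilon> + h' a * \<epsilon>\<^sup>2 / 2 + h'' t / 6 * \<epsilon> ^ 3"
      by (auto simp: d_def numeral_3_eq_3 fact_numeral eval_nat_numeral)
    have "\<bar>h'' t\<bar> \<le> B" using t a by (intro B) auto
    hence "\<bar>h'' t\<bar> * \<epsilon> ^ 3 \<le> B * \<epsilon> ^ 3" using a by (intro mult_right_mono) auto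
    thus ?thesis using t(3) a by (simp add: abs_mult)
  qed
  \<comment> \<open>The Taylor remainders at \<open>a\<close> of the sample, of the increment of
    \<open>h\<close> and of the primitive. In the combination \<open>eq\<close> the terms with
    \<open>h' a\<close> cancel, which explains the coefficient
    \<open>\<delta> - 1/2\<close>.\<close>
  define e1 where "e1 = h (a + \<delta> * \<epsilon>) - h a - h' a * (\<delta> * \<epsilon>)"
  define e2 where "e2 = h (a + \<epsilon>) - h a - h' a * \<epsilon>"
  define e3 where "e3 = H (a + \<epsilon>) - H a - h a * \<epsilon> - h' a * \<epsilon>\<^sup>2 / 2"
  have b1: "\<bar>e1\<bar> \<le> B * \<epsilon>\<^sup>2 / 2" unfolding e1_def using a \<delta> by (intro T2) (auto intro: mult_left_le_one_le)
  have b2: "\<bar>e2\<bar> \<le> B * \<epsilon>\<^sup>2 / 2" unfolding e2_def using a by (intro T2) auto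
  have b3: "\<bar>e3\<bar> \<le> B * \<epsilon> ^ 3 / 6" unfolding e3_def by (rule T3)
  have eq: "\<epsilon> * h (a + \<delta> * \<epsilon>) - (H (a + \<epsilon>) - H a) - (\<delta> - 1/2) * \<epsilon> * (h (a + \<epsilon>) - h a) =
    \<epsilon> * e1 - e3 - (\<delta> - 1/2) * (\<epsilon> * e2)"
    unfolding e1_def e2_def e3_def by (simp add: field_simps power2_eq_square)
  have c1: "\<bar>\<epsilon> * e1\<bar> \<le> B * \<epsilon> ^ 3 / 2"
    using mult_left_mono[OF b1, of \<epsilon>] a by (simp add: abs_mult power2_eq_square power3_eq_cube mult_ac)
  have c2: "\<bar>\<epsilon> * e2\<bar> \<le> B * \<epsilon> ^ 3 / 2"
    using mult_left_mono[OF b2, of \<epsilon>] a by (simp add: abs_mult power2_eq_square power3_eq_cube mult_ac)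
  have d12: "\<bar>\<delta> - 1/2\<bar> \<le> 1/2" using \<delta> by linarith
  have "\<bar>(\<delta> - 1/2) * (\<epsilon> * e2)\<bar> \<le> 1/2 * (B * \<epsilon> ^ 3 / 2)"
    unfolding abs_mult[of "\<delta> - 1/2"] by (intro mult_mono c2 d12) auto
  moreover have "0 \<le> B * \<epsilon> ^ 3" using B0 a by simp
  \<comment> \<open>The three bounds add up to 1/2 + 1/6 + 1/4, which is below 1.\<close>
  ultimately show ?thesis unfolding eq using c1 b3 by linarith
qed

text \<open>Each of the m cells contributes an error of at most B / m^3, so the average is off by at
  most B / m^2 and the sum by at most B / m. The correction terms of
  \<open>cell_sample_error\<close> telescope to a multiple of \<open>h 1 - h 0 = 0\<close>.\<close>

lemma periodic_riemann_sum:
  fixes h :: "real \<Rightarrow> real"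
  assumes h: "twice_cont_diff h" and per: "h 1 = h 0" and \<delta>: "0 \<le> \<delta>" "\<delta> \<le> 1"
  shows "(\<lambda>m. (\<Sum>j<m. h ((real j + \<delta>) / real m)) - real m * integral {0..1} h) \<longlonglongrightarrow> 0"
proof -
  obtain h' h'' where *: "\<And>x. (h has_real_derivative h' x) (at x)" "\<And>x. (h' has_real_derivative h'' x) (at x)"
    "continuous_on UNIV h''" using h unfolding twice_cont_diff_def by blast
  have "compact (h'' ` {0..1})" by (intro compact_continuous_image continuous_on_subset[OF *(3)]) auto
  from compact_imp_bounded[OF this] obtain B where "\<forall>y\<in>h'' ` {0..1}. norm y \<le> B"
    unfolding bounded_iff by blast
  hence B: "\<And>x. x \<in> {0..1} \<Longrightarrow> \<bar>h'' x\<bar> \<le> B" by simp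
  \<comment> \<open>Integration starts at -1 so that 0 is an interior point and \<open>H\<close> has
    two-sided derivatives on all of \<open>{0..1}\<close>.\<close>
  define H where "H = (\<lambda>x. integral {-1..x} h)"
  have H: "(H has_real_derivative h x) (at x)" if "x \<in> {0..1}" for x
  proof -
    have "(H has_real_derivative h x) (at x within {-1..2})"
      unfolding H_def by (rule integral_has_real_derivative) (use that twice_cont_diff_continuous[OF h] in auto)
    thus ?thesis using that by (subst (asm) at_within_Icc_at) auto
  qed
  have I: "integral {0..1} h = H 1 - H 0"
  proof (rule integral_unique, rule fundamental_theorem_of_calculus)
    fix x :: real assume "x \<in> {0..1}"
    thus "(H has_vector_derivative h x) (at x within {0..1})"
      using H[of x] by (simp add: has_real_derivative_iff_has_vector_derivative has_vector_derivative_at_within)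
  qed simp
  let ?S = "\<lambda>m. (\<Sum>j<m. h ((real j + \<delta>) / real m)) - real m * integral {0..1} h"
  have bound: "\<bar>?S m\<bar> \<le> B * (1 / real m)" if m: "m > 0" for m
  proof -
    define \<epsilon> where "\<epsilon> = 1 / real m"
    have e: "\<epsilon> > 0" "real m * \<epsilon> = 1" using m by (auto simp: \<epsilon>_def)
    let ?E = "\<lambda>j. \<epsilon> * h (real j * \<epsilon> + \<delta> * \<epsilon>) - (H (real j * \<epsilon> + \<epsilon>) - H (real j * \<epsilon>)) -
       (\<delta> - 1/2) * \<epsilon> * (h (real j * \<epsilon> + \<epsilon>) - h (real j * \<epsilon>))"
    have tel: "(\<Sum>j<m. f (real j * \<epsilon> + \<epsilon>) - f (real j * \<epsilon>)) = f 1 - f 0" for f :: "real \<Rightarrow> real"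
    proof -
      have "(\<Sum>j<m. f (real j * \<epsilon> + \<epsilon>) - f (real j * \<epsilon>)) = (\<Sum>j<m. f (real (Suc j) * \<epsilon>) - f (real j * \<epsilon>))"
        by (intro sum.cong refl) (simp add: algebra_simps)
      thus ?thesis using sum_lessThan_telescope[of "\<lambda>j. f (real j * \<epsilon>)" m] e(2) by simp
    qed
    have "\<bar>\<Sum>j<m. ?E j\<bar> \<le> (\<Sum>j<m. B * \<epsilon> ^ 3)"
    proof (rule order_trans[OF sum_abs sum_mono], rule cell_sample_error[OF H *(1,2) B])
      fix j assume "j \<in> {..<m}"
      hence "real (Suc j) * \<epsilon> \<le> real m * \<epsilon>" using e by (intro mult_right_mono) auto
      thus "real j * \<epsilon> + \<epsilon> \<le> 1" using e by (simp add: algebra_simps)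
    qed (use e \<delta> in auto)
    moreover have "(\<Sum>j<m. ?E j) = \<epsilon> * (\<Sum>j<m. h (real j * \<epsilon> + \<delta> * \<epsilon>)) - (H 1 - H 0)"
      unfolding sum_subtractf[of _ _ "{..<m}", of "\<lambda>j. \<epsilon> * h (real j * \<epsilon> + \<delta> * \<epsilon>) - (H (real j * \<epsilon> + \<epsilon>) - H (real j * \<epsilon>))"]
        sum_subtractf[of "\<lambda>j. \<epsilon> * h (real j * \<epsilon> + \<delta> * \<epsilon>)"] sum_distrib_left[symmetric] tel
      using per by simp
    ultimately have "\<bar>\<epsilon> * (\<Sum>j<m. h (real j * \<epsilon> + \<delta> * \<epsilon>)) - (H 1 - H 0)\<bar> \<le> real m * (B * \<epsilon> ^ 3)" by simp
    hence "real m * \<bar>\<epsilon> * (\<Sum>j<m. h (real j * \<epsilon> + \<delta> * \<epsilon>)) - (H 1 - H 0)\<bar> \<le> real m * (real m * (B * \<epsilon> ^ 3))"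
      by (rule mult_left_mono) simp
    moreover have "real m * \<bar>\<epsilon> * (\<Sum>j<m. h (real j * \<epsilon> + \<delta> * \<epsilon>)) - (H 1 - H 0)\<bar> = \<bar>?S m\<bar>"
    proof -
      have "real m * \<bar>\<epsilon> * (\<Sum>j<m. h (real j * \<epsilon> + \<delta> * \<epsilon>)) - (H 1 - H 0)\<bar> =
        \<bar>real m * (\<epsilon> * (\<Sum>j<m. h (real j * \<epsilon> + \<delta> * \<epsilon>)) - (H 1 - H 0))\<bar>" by (simp add: abs_mult)
      also have "real m * (\<epsilon> * (\<Sum>j<m. h (real j * \<epsilon> + \<delta> * \<epsilon>)) - (H 1 - H 0)) =
        (real m * \<epsilon>) * (\<Sum>j<m. h (real j * \<epsilon> + \<delta> * \<epsilon>)) - real m * integral {0..1} h"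
        unfolding I by (simp add: algebra_simps)
      also have "\<dots> = ?S m" unfolding e(2) by (simp add: \<epsilon>_def add_divide_distrib)
      finally show ?thesis .
    qed
    moreover have "real m * (real m * (B * \<epsilon> ^ 3)) = B * (1 / real m)"
      using m by (simp add: \<epsilon>_def power3_eq_cube)
    ultimately show ?thesis by simp
  qed
  have "(\<lambda>m. B * (1 / real m)) \<longlonglongrightarrow> B * 0" by (intro tendsto_intros lim_1_over_n)
  hence "(\<lambda>m. B * (1 / real m)) \<longlonglongrightarrow> 0" by simp
  thus ?thesis
    by (rule Lim_null_comparison[rotated]) (use bound in \<open>auto intro!: eventually_mono[OF eventually_gt_at_top[of 0]]\<close>)
qed

lemma periodic_sample_product:
  fixes g :: "real \<Rightarrow> real"
  assumes g: "twice_cont_diff g" "\<And>x. g x > 0" and per: "g 1 = g 0" and \<delta>: "0 \<le> \<delta>" "\<delta> \<le> 1"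
  shows "(\<lambda>m. (\<Prod>j<m. g ((real j + \<delta>) / real m)) / exp (integral {0..1} (\<lambda>x. ln (g x))) ^ m) \<longlonglongrightarrow> 1"
proof -
  have "(\<lambda>m. exp ((\<Sum>j<m. ln (g ((real j + \<delta>) / real m))) - real m * integral {0..1} (\<lambda>x. ln (g x)))) \<longlonglongrightarrow> exp 0"
    by (intro tendsto_exp periodic_riemann_sum twice_cont_diff_ln g \<delta>) (simp add: per)
  thus ?thesis using g(2) by (simp add: exp_diff exp_sum exp_of_nat_mult)
qed

section \<open>The factor vanishing at the trivial character\<close>

text \<open>The square |1 - z|^2 of the chord length from 1 to z = exp (2 pi i x); see
  \<open>norm_one_minus_cis\<close>.\<close>

definition chord :: "real \<Rightarrow> real" where
  "chord x = 2 - 2 * cos (2 * pi * x)"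

lemma chord_alt: "chord x = (2 * sin (pi * x))\<^sup>2"
  using cos_double_sin[of "pi * x"] by (simp add: chord_def power_mult_distrib mult.assoc)

lemma chord_pos: "0 < x \<Longrightarrow> x < 1 \<Longrightarrow> chord x > 0"
  unfolding chord_alt by (auto simp: zero_less_power2 intro!: sin_gt_zero less_imp_neq[THEN not_sym])

text \<open>This is |1 - z^2|^2 = |1 - z|^2 |1 + z|^2. Writing the last factor as a chord at
  \<open>1/2 - x\<close> keeps the argument within \<open>{0..1/2}\<close>.\<close>

lemma chord_double: "chord (2 * x) = chord x * chord (1/2 - x)"
proof -
  have "sin (pi * (1/2 - x)) = cos (pi * x)" by (simp add: cos_sin_eq algebra_simps)
  moreover have "sin (pi * (2 * x)) = 2 * sin (pi * x) * cos (pi * x)"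
    using sin_double[of "pi * x"] by (simp add: mult_ac)
  ultimately show ?thesis by (simp add: chord_alt power_mult_distrib mult_ac)
qed

lemma chord_reflect: "chord (1 - x) = chord x"
proof -
  have "sin (pi * (1 - x)) = sin (pi * x)" by (simp add: algebra_simps)
  thus ?thesis by (simp add: chord_alt)
qed

text \<open>Concavity of the sine on \<open>{0..pi/2}\<close> puts it above its secant, that is
  \<open>sin (pi * x) \<ge> 2 * x\<close>. The bound controls the logarithmic singularity at
  0.\<close>

lemma chord_lower:
  assumes "0 \<le> x" "x \<le> 1/2"
  shows "chord x \<ge> 16 * x\<^sup>2"
proof -
  have "convex_on {0..pi/2} (\<lambda>x. - sin x)"
  proof (rule f''_ge0_imp_convex)
    show "((\<lambda>x. - sin x) has_real_derivative - cos x) (at x)" for x by (auto intro!: derivative_eq_intros)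
    show "((\<lambda>x. - cos x) has_real_derivative sin x) (at x)" for x by (auto intro!: derivative_eq_intros)
    show "0 \<le> sin x" if "x \<in> {0..pi/2}" for x using that by (intro sin_ge_zero) auto
  qed auto
  from convex_onD_Icc'[OF this, of "pi * x"] have "2 * x \<le> sin (pi * x)"
    using assms by (simp add: field_simps)
  hence "(4 * x)\<^sup>2 \<le> (2 * sin (pi * x))\<^sup>2" using assms by (intro power_mono) auto
  thus ?thesis by (simp add: chord_alt power2_eq_square)
qed

section \<open>The integral of the logarithm of \<open>chord\<close>\<close>

lemma neg_ln_integrable: "(\<lambda>x::real. - ln x) integrable_on {0..1/2}"
proof -
  \<comment> \<open>The primitive is x - x ln x. At 0 the term \<open>0 * ln 0 = 0\<close> is its
    continuous extension, and differentiability is required in the interior only.\<close>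
  have "((\<lambda>x::real. - ln x) has_integral ((1/2 - 1/2 * ln (1/2)) - (0 - 0 * ln 0))) {0..1/2}"
  proof (rule fundamental_theorem_of_calculus_interior)
    show "continuous_on {0..1/2} (\<lambda>x::real. x - x * ln x)"
    proof (intro continuous_on_diff continuous_on_id)
      show "continuous_on {0..1/2} (\<lambda>x::real. x * ln x)"
        unfolding continuous_on_def
      proof
        fix x :: real assume x: "x \<in> {0..1/2}"
        show "((\<lambda>x. x * ln x) \<longlongrightarrow> x * ln x) (at x within {0..1/2})"
        proof (cases "x = 0")
          case True
          have "((\<lambda>x::real. x * ln x) \<longlongrightarrow> 0) (at_right 0)" by real_asymp
          moreover have "at (0::real) within {0..1/2} \<le> at_right 0"
          proof -
            have "at (0::real) within {0..1/2} = at 0 within ({0..1/2} - {0})" by (simp add: at_within_def)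
            also have "\<dots> \<le> at 0 within {0<..}" by (intro at_le) auto
            finally show ?thesis .
          qed
          ultimately show ?thesis using True by (auto intro: tendsto_mono)
        qed (use x in \<open>auto intro!: tendsto_intros\<close>)
      qed
    qed
    show "((\<lambda>x. x - x * ln x) has_vector_derivative - ln x) (at x)" if "x \<in> {0<..<1/2}" for x :: real
      using that unfolding has_real_derivative_iff_has_vector_derivative[symmetric]
      by (auto intro!: derivative_eq_intros)
  qed auto
  thus ?thesis by blast
qed

lemma ln_chord_integrable_half: "(\<lambda>x. ln (chord x)) integrable_on {0..1/2}"
proof -
  let ?S = "{0<..1/2::real}"
  have spike: "f integrable_on ?S \<longleftrightarrow> f integrable_on {0..1/2}" for f :: "real \<Rightarrow> real"
    by (rule integrable_spike_set_eq, rule negligible_subset[of "{0}"]) auto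
  have "(\<lambda>x. ln (chord x)) integrable_on ?S"
  proof (rule measurable_bounded_by_integrable_imp_integrable)
    have "continuous_on ?S (\<lambda>x. ln (chord x))"
    proof (intro continuous_on_ln)
      show "continuous_on ?S chord" unfolding chord_def by (intro continuous_intros)
      show "\<forall>x\<in>?S. chord x \<noteq> 0" using chord_pos by force
    qed
    thus "(\<lambda>x. ln (chord x)) \<in> borel_measurable (lebesgue_on ?S)"
      by (rule continuous_imp_measurable_on_sets_lebesgue) auto
    \<comment> \<open>The majorant covers both sides: from above ln (chord x) is at most 4 - 1, from
      below it is at least ln 16 + 2 ln x, and ln x is at most 0 here.\<close>
    show "(\<lambda>x::real. 4 + 2 * - ln x) integrable_on ?S"
      unfolding spike
      by (rule integrable_add[OF integrable_on_const integrable_on_cmult_left[OF neg_ln_integrable, of 2, unfolded of_real_numeral]]) auto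
    fix x assume x: "x \<in> ?S"
    have "ln (16 * x\<^sup>2) \<le> ln (chord x)" using chord_lower[of x] x by (subst ln_le_cancel_iff) (auto intro: chord_pos)
    moreover have "ln (16 * x\<^sup>2) = ln 16 + 2 * ln x" using x by (simp add: ln_mult ln_realpow)
    moreover have "ln (chord x) \<le> chord x - 1" using x chord_pos[of x] by (intro ln_le_minus_one) auto
    moreover have "chord x \<le> 4" using cos_ge_minus_one[of "2 * pi * x"] unfolding chord_def by linarith
    moreover have "ln x \<le> 0" using x by simp
    moreover have "ln 16 \<ge> (0::real)" by simp
    ultimately show "norm (ln (chord x)) \<le> 4 + 2 * - ln x" unfolding real_norm_def by linarith
  qed auto
  thus ?thesis unfolding spike .
qed

text \<open>Let J be the integral over \<open>{0..1/2}\<close>. By reflection the whole integral is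
  2 J, so integrating \<open>ln (chord (2 * x))\<close> over \<open>{0..1/2}\<close> gives J after
  rescaling. By \<open>chord_double\<close> the same integral is J + J, hence J = 0.\<close>

lemma has_integral_ln_chord: "((\<lambda>x. ln (chord x)) has_integral 0) {0..1}"
proof -
  let ?f = "\<lambda>x. ln (chord x)"
  obtain J where J: "(?f has_integral J) {0..1/2}" using ln_chord_integrable_half by blast
  have "((\<lambda>x. ?f (- 1 *\<^sub>R x + 1)) has_integral (1 / (\<bar>- 1\<bar> ^ DIM(real))) *\<^sub>R J)
      ((\<lambda>x. (1 / - 1) *\<^sub>R x + - ((1 / - 1) *\<^sub>R 1)) ` cbox 0 (1/2))"
    using J by (intro has_integral_affinity) auto
  moreover have "(\<lambda>x. (1 / - 1) *\<^sub>R x + - ((1 / - 1) *\<^sub>R 1)) ` cbox 0 (1/2) = {1/2..1::real}"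
    using image_affinity_atLeastAtMost[of "-1" 1 0 "1/2::real"] by simp
  ultimately have J2: "(?f has_integral J) {1/2..1}" using chord_reflect by simp
  have whole: "(?f has_integral (J + J)) {0..1}"
    by (rule has_integral_combine[OF _ _ J J2]) auto
  have "((\<lambda>x. ?f (- 1 *\<^sub>R x + 1/2)) has_integral (1 / (\<bar>- 1\<bar> ^ DIM(real))) *\<^sub>R J)
      ((\<lambda>x. (1 / - 1) *\<^sub>R x + - ((1 / - 1) *\<^sub>R (1/2))) ` cbox 0 (1/2))"
    using J by (intro has_integral_affinity) auto
  moreover have "(\<lambda>x. (1 / - 1) *\<^sub>R x + - ((1 / - 1) *\<^sub>R (1/2))) ` cbox 0 (1/2) = {0..1/2::real}"
    using image_affinity_atLeastAtMost[of "-1" "1/2" 0 "1/2::real"] by simp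
  ultimately have J3: "((\<lambda>x. ?f (1/2 - x)) has_integral J) {0..1/2}" by simp
  have "((\<lambda>x. ?f (2 * x)) has_integral (1 / \<bar>2\<bar>) *\<^sub>R (J + J)) ((\<lambda>x. x / 2) ` {0..1})"
    by (rule has_integral_stretch_real[OF whole]) simp
  moreover have "(\<lambda>x. x / 2) ` {0..1} = {0..1/2::real}"
    using image_divide_atLeastAtMost[of 2 0 "1::real"] by simp
  ultimately have dbl: "((\<lambda>x. ?f (2 * x)) has_integral J) {0..1/2}" by simp
  have "((\<lambda>x. ?f (2 * x)) has_integral (J + J)) {0..1/2}"
  proof (rule has_integral_spike_finite[OF _ _ has_integral_add[OF J J3]])
    fix x :: real assume "x \<in> {0..1/2} - {0, 1/2}"
    hence "chord x > 0" "chord (1/2 - x) > 0" by (auto intro!: chord_pos)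
    thus "?f (2 * x) = ?f x + ?f (1/2 - x)" by (simp add: chord_double ln_mult)
  qed auto
  from has_integral_unique[OF dbl this] have "J = 0" by simp
  thus ?thesis using whole by simp
qed

text \<open>The polynomials with factors X minus a nontrivial root and 1 + X + ... + X^(n-1) have
  equal leading coefficients in degree n - 1 and common zeros at the n - 1 nontrivial roots, so they
  are equal. Evaluation at 1 gives the claim.\<close>

lemma prod_one_minus_roots_of_unity:
  assumes n: "n > 0"
  shows "(\<Prod>j=1..<n. 1 - zeta n (int j)) = of_nat n"
proof -
  let ?p = "\<Prod>j=1..<n. [:- zeta n (int j), 1:]" and ?q = "\<Sum>i<n. Polynomial.monom (1::complex) i"
  let ?A = "(\<lambda>j. zeta n (int j)) ` {1..<n}"
  have deg: "degree ?p = n - 1" by (subst degree_prod_eq_sum_degree) auto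
  have inj: "inj_on (\<lambda>j. zeta n (int j)) {1..<n}"
  proof (rule inj_onI)
    fix i j assume ij: "i \<in> {1..<n}" "j \<in> {1..<n}" "zeta n (int i) = zeta n (int j)"
    have "zeta n (int i - int j) * zeta n (int j) = 1 * zeta n (int j)"
      using ij(3) by (simp add: zeta_add[symmetric])
    hence "zeta n (int i - int j) = 1" by (simp add: zeta_def)
    hence "int i mod int n = int j mod int n" using n by (simp add: zeta_eq_1_iff mod_eq_dvd_iff)
    thus "i = j" using ij by simp
  qed
  have "?p = ?q"
  proof (rule poly_eqI_degree_lead_coeff[where n = "n - 1" and A = ?A])
    have "lead_coeff ?p = 1" by (simp add: lead_coeff_prod)
    hence "poly.coeff ?p (n - 1) = 1" unfolding deg .
    moreover have "poly.coeff ?q (n - 1) = 1" using n by (simp add: coeff_sum)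
    ultimately show "poly.coeff ?p (n - 1) = poly.coeff ?q (n - 1)" by (simp only:)
    show "card ?A \<ge> n - 1" using card_image[OF inj] by simp
    show "degree ?p \<le> n - 1" using deg by simp
    show "degree ?q \<le> n - 1" by (intro degree_sum_le) (auto intro: order_trans[OF degree_monom_le])
    fix z assume "z \<in> ?A"
    then obtain j where j: "j \<in> {1..<n}" "z = zeta n (int j)" by auto
    have "poly ?p z = 0" using j by (auto simp: poly_prod)
    moreover have "\<not> int n dvd int j" using j by (auto dest: zdvd_imp_le)
    hence "poly ?q z = 0"
      using sum_zeta[OF n, of "int j"] j by (simp add: poly_sum poly_monom zeta_power atLeast0LessThan)
    ultimately show "poly ?p z = poly ?q z" by simp
  qed
  hence "poly ?p 1 = poly ?q 1" by simp
  thus ?thesis by (simp add: poly_prod poly_sum poly_monom)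
qed

lemma norm_one_minus_cis: "(cmod (1 - cis (2 * pi * x)))\<^sup>2 = chord x"
  using sin_cos_squared_add[of "2 * pi * x"]
  unfolding cmod_power2 by (simp add: chord_def power2_eq_square algebra_simps)

lemma prod_chord:
  assumes n: "n > 0"
  shows "(\<Prod>j=1..<n. chord (real j / real n)) = (real n)\<^sup>2"
proof -
  have "(\<Prod>j=1..<n. chord (real j / real n)) = (\<Prod>j=1..<n. (cmod (1 - zeta n (int j)))\<^sup>2)"
    by (simp add: norm_one_minus_cis[symmetric] zeta_def)
  also have "\<dots> = (cmod (\<Prod>j=1..<n. 1 - zeta n (int j)))\<^sup>2"
    unfolding prod_norm[symmetric] prod_power_distrib by (rule refl)
  finally show ?thesis unfolding prod_one_minus_roots_of_unity[OF n] by simp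
qed

section \<open>Evaluation of Laurent polynomials on the unit circle\<close>

lemma leval_eq_sum:
  assumes "finite A" "Poly_Mapping.keys P \<subseteq> A"
  shows "leval P z = (\<Sum>m\<in>A. Poly_Mapping.lookup P m * z powi m)"
  unfolding leval_def using assms by (intro sum.mono_neutral_left) (auto simp: in_keys_iff)

lemma leval_add: "leval (P + Q) z = leval P z + leval Q z"
proof -
  let ?A = "Poly_Mapping.keys P \<union> Poly_Mapping.keys Q"
  have "leval (P + Q) z = (\<Sum>m\<in>?A. Poly_Mapping.lookup (P + Q) m * z powi m)"
    by (rule leval_eq_sum) (auto dest: subsetD[OF keys_add])
  also have "\<dots> = (\<Sum>m\<in>?A. Poly_Mapping.lookup P m * z powi m) + (\<Sum>m\<in>?A. Poly_Mapping.lookup Q m * z powi m)"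
    by (simp add: lookup_add distrib_right sum.distrib)
  also have "\<dots> = leval P z + leval Q z" by (subst (1 2) leval_eq_sum[of ?A]) auto
  finally show ?thesis .
qed

lemma leval_single: "leval (Poly_Mapping.single m c) z = c * z powi m"
  by (subst leval_eq_sum[of "{m}"]) (auto split: if_splits)

lemma leval_0: "leval 0 z = 0"
  by (simp add: leval_def)

lemma leval_uminus: "leval (- P) z = - leval P z"
  using leval_add[of P "- P" z] by (simp add: leval_0 eq_neg_iff_add_eq_0 add.commute)

lemma leval_diff: "leval (P - Q) z = leval P z - leval Q z"
  using leval_add[of P "- Q" z] by (simp add: leval_uminus)

lemma leval_sum: "leval (\<Sum>i\<in>I. f i) z = (\<Sum>i\<in>I. leval (f i) z)"
  by (induction I rule: infinite_finite_induct) (auto simp: leval_0 leval_add)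

lemma leval_of_nat: "leval (of_nat n) z = of_nat n"
  using leval_single[of 0 "of_nat n" z] by simp

lemma leval_numeral: "leval (numeral w) z = numeral w"
  using leval_single[of 0 "numeral w" z] by simp

lemma poly_mapping_sum_singles:
  "P = (\<Sum>m\<in>Poly_Mapping.keys P. Poly_Mapping.single m (Poly_Mapping.lookup P m))"
  by (rule poly_mapping_eqI)
     (auto simp: lookup_sum lookup_single when_def in_keys_iff)

lemma leval_mult:
  assumes z: "z \<noteq> 0"
  shows "leval (P * Q) z = leval P z * leval Q z"
proof -
  let ?s = "\<lambda>P m. Poly_Mapping.single m (Poly_Mapping.lookup P m)"
  have "P * Q = (\<Sum>m\<in>Poly_Mapping.keys P. ?s P m) * (\<Sum>n\<in>Poly_Mapping.keys Q. ?s Q n)"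
    by (simp add: poly_mapping_sum_singles[symmetric])
  also have "\<dots> = (\<Sum>m\<in>Poly_Mapping.keys P. \<Sum>n\<in>Poly_Mapping.keys Q.
      Poly_Mapping.single (m + n) (Poly_Mapping.lookup P m * Poly_Mapping.lookup Q n))"
    by (simp add: sum_product mult_single)
  finally have "leval (P * Q) z = (\<Sum>m\<in>Poly_Mapping.keys P. \<Sum>n\<in>Poly_Mapping.keys Q.
      Poly_Mapping.lookup P m * Poly_Mapping.lookup Q n * z powi (m + n))"
    by (simp add: leval_sum leval_single)
  thus ?thesis unfolding leval_def[of P] leval_def[of Q] sum_product
    using z by (simp add: power_int_add mult_ac)
qed

lemma leval_linv: "leval (linv P) z = leval P (inverse z)"
proof -
  have inj: "inj (uminus :: int \<Rightarrow> int)" by (auto intro: injI)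
  have keys: "Poly_Mapping.keys (linv P) = uminus -` Poly_Mapping.keys P"
    unfolding linv_def by (rule keys_map_key[OF inj])
  have lookup: "Poly_Mapping.lookup (linv P) m = Poly_Mapping.lookup P (- m)" for m
    unfolding linv_def by (simp add: map_key.rep_eq[OF inj])
  show ?thesis unfolding leval_def keys lookup
    by (rule sum.reindex_bij_witness[of _ uminus uminus])
       (auto simp: power_int_minus power_int_inverse)
qed

abbreviation unit_pt :: "real \<Rightarrow> complex" where
  "unit_pt x \<equiv> cis (2 * pi * x)"

lemma leval_lmonom_cis: "leval (lmonom m) (unit_pt x) = unit_pt (of_int m * x)"
  by (simp add: leval_single cis_power_int mult_ac)

section \<open>Values on the unit circle in terms of chords\<close>

definition chord_sum :: "nat \<Rightarrow> (nat \<Rightarrow> int) \<Rightarrow> real \<Rightarrow> real" where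
  "chord_sum m a x = (\<Sum>j=1..m. chord (of_int (a j) * x))"

definition chord_pairs :: "nat \<Rightarrow> (nat \<Rightarrow> int) \<Rightarrow> real \<Rightarrow> real" where
  "chord_pairs s \<gamma> x = (\<Sum>i=1..s. \<Sum>j=1..<i. chord (of_int (\<gamma> j - \<gamma> i) * x))"

text \<open>The pairs (u, v) = (0, 0), (2, 0), (0, 2), (2, 2) give P_1, P_2, P_3, P_4 on the unit
  circle (\<open>leval_symb\<close>). In this form positivity and the common factor
  \<open>chord x\<close> of P_1 can be read off.\<close>

definition symb :: "nat \<Rightarrow> nat \<Rightarrow> nat \<Rightarrow> (nat \<Rightarrow> int) \<Rightarrow> (nat \<Rightarrow> int) \<Rightarrow> (nat \<Rightarrow> int) \<Rightarrow>
    real \<Rightarrow> real \<Rightarrow> real \<Rightarrow> real" where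
  "symb r t s \<alpha> \<beta> \<gamma> u v x =
     (of_nat s + chord_sum r \<alpha> x + u) * (of_nat s + chord_sum t \<beta> x + v) - (of_nat s)\<^sup>2 + chord_pairs s \<gamma> x"

lemma unit_pt_add_uminus: "unit_pt y + unit_pt (- y) = of_real (2 - chord y)"
  by (simp add: chord_def complex_eq_iff)

lemma sum_unit_pt_pm:
  "(\<Sum>j=1..m. unit_pt (of_int (a j) * x) + unit_pt (- (of_int (a j) * x))) = of_real (2 * of_nat m - chord_sum m a x)"
  unfolding unit_pt_add_uminus of_real_sum[symmetric] chord_sum_def by (simp add: sum_subtractf)

lemma leval_lpoly_diag:
  "leval (lpoly_diag m s a) (unit_pt x) = of_real (of_nat s + chord_sum m a x)"
proof -
  have "leval (lpoly_diag m s a) (unit_pt x) = of_nat (2 * m + s) -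
    (\<Sum>j=1..m. unit_pt (of_int (a j) * x) + unit_pt (- (of_int (a j) * x)))"
    unfolding lpoly_diag_def leval_diff leval_of_nat leval_sum leval_add leval_lmonom_cis by simp
  thus ?thesis unfolding sum_unit_pt_pm by simp
qed

text \<open>For unit numbers 2 Re (z cnj w) = 2 - |z - w|^2. Expanding the square of the sum
  therefore replaces each mixed term by 2 minus a chord, and the constants add up to s^2.\<close>

lemma norm_sum_unit_pt:
  "(cmod (\<Sum>j=1..s. unit_pt (of_int (\<gamma> j) * x)))\<^sup>2 = (of_nat s)\<^sup>2 - chord_pairs s \<gamma> x"
proof (induction s)
  case (Suc s)
  let ?C = "\<Sum>j=1..s. unit_pt (of_int (\<gamma> j) * x)" and ?c = "unit_pt (of_int (\<gamma> (Suc s)) * x)"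
  have "unit_pt a * cnj (unit_pt b) = unit_pt (a - b)" for a b
    by (simp add: cis_cnj cis_mult right_diff_distrib)
  hence "?C * cnj ?c = (\<Sum>j=1..s. unit_pt (of_int (\<gamma> j - \<gamma> (Suc s)) * x))"
    unfolding sum_distrib_right of_int_diff left_diff_distrib by (intro sum.cong refl)
  hence "Re (?C * cnj ?c) = (\<Sum>j=1..s. cos (2 * pi * (of_int (\<gamma> j - \<gamma> (Suc s)) * x)))"
    by simp
  also have "\<dots> = (\<Sum>j=1..s. 1 - chord (of_int (\<gamma> j - \<gamma> (Suc s)) * x) / 2)"
    unfolding chord_def by (intro sum.cong refl) (simp add: diff_divide_distrib)
  also have "\<dots> = of_nat s - (\<Sum>j=1..s. chord (of_int (\<gamma> j - \<gamma> (Suc s)) * x)) / 2"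
    by (simp add: sum_subtractf sum_divide_distrib)
  finally have *: "2 * Re (?C * cnj ?c) = 2 * of_nat s - (\<Sum>j=1..s. chord (of_int (\<gamma> j - \<gamma> (Suc s)) * x))"
    by simp
  have "(cmod (?C + ?c))\<^sup>2 = (cmod ?C)\<^sup>2 + (cmod ?c)\<^sup>2 + 2 * Re (?C * cnj ?c)"
    unfolding cmod_power2 by (simp add: power2_eq_square algebra_simps)
  thus ?case unfolding Suc.IH *
    by (simp add: chord_pairs_def atLeastLessThanSuc_atLeastAtMost power2_eq_square algebra_simps)
qed (simp add: chord_pairs_def)

text \<open>On the unit circle inversion is conjugation, so the product is the squared modulus of
  the value of \<C>.\<close>

lemma leval_lpoly_C_norm:
  "leval (linv (lpoly_C s \<gamma>) * lpoly_C s \<gamma>) (unit_pt x) = of_real ((of_nat s)\<^sup>2 - chord_pairs s \<gamma> x)"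
proof -
  have C: "leval (lpoly_C s \<gamma>) (unit_pt y) = (\<Sum>j=1..s. unit_pt (of_int (\<gamma> j) * y))" for y
    unfolding lpoly_C_def leval_sum leval_lmonom_cis ..
  have "leval (lpoly_C s \<gamma>) (inverse (unit_pt x)) = leval (lpoly_C s \<gamma>) (unit_pt (- x))" by simp
  also have "\<dots> = cnj (leval (lpoly_C s \<gamma>) (unit_pt x))" unfolding C by (simp add: cis_cnj)
  finally have inv: "leval (lpoly_C s \<gamma>) (inverse (unit_pt x)) = cnj (leval (lpoly_C s \<gamma>) (unit_pt x))" .
  show ?thesis
    unfolding norm_sum_unit_pt[symmetric] C[symmetric] leval_mult[OF cis_neq_zero] leval_linv inv
    by (simp only: complex_norm_square mult.commute)
qed

lemma leval_symb:
  "leval (P1 r t s \<alpha> \<beta> \<gamma>) (unit_pt x) = of_real (symb r t s \<alpha> \<beta> \<gamma> 0 0 x)"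
  "leval (P2 r t s \<alpha> \<beta> \<gamma>) (unit_pt x) = of_real (symb r t s \<alpha> \<beta> \<gamma> 2 0 x)"
  "leval (P3 r t s \<alpha> \<beta> \<gamma>) (unit_pt x) = of_real (symb r t s \<alpha> \<beta> \<gamma> 0 2 x)"
  "leval (P4 r t s \<alpha> \<beta> \<gamma>) (unit_pt x) = of_real (symb r t s \<alpha> \<beta> \<gamma> 2 2 x)"
  unfolding P1_def P2_def P3_def P4_def leval_diff leval_lpoly_C_norm
    leval_mult[OF cis_neq_zero, of "lpoly_diag r s \<alpha>"] leval_mult[OF cis_neq_zero, of "lpoly_diag r s \<alpha> + 2"]
    leval_add leval_numeral leval_lpoly_diag symb_def
  by simp_all

lemma mahler_unit_pt: "mahler P = exp (integral {0..1} (\<lambda>x. ln (cmod (leval P (unit_pt x)))))"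
  by (simp add: mahler_def cis_conv_exp mult_ac)

section \<open>Factorization of the symbol\<close>

text \<open>The quotient of \<open>chord (a * x)\<close> by \<open>chord x\<close>, which is |a|
  times a Fejer kernel. The finite geometric sum avoids dividing by zero at integers, where its
  value is a^2.\<close>

definition fejer :: "int \<Rightarrow> real \<Rightarrow> real" where
  "fejer a x = (cmod (\<Sum>l<nat \<bar>a\<bar>. unit_pt (of_nat l * x)))\<^sup>2"

lemma chord_fejer: "chord (of_int a * x) = chord x * fejer a x"
proof -
  let ?n = "nat \<bar>a\<bar>"
  have "chord (of_int a * x) = chord (of_nat ?n * x)" by (simp add: chord_def abs_if)
  also have "\<dots> = (cmod (1 - unit_pt x ^ ?n))\<^sup>2"
    by (simp add: norm_one_minus_cis[symmetric] Complex.DeMoivre mult_ac)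
  also have "1 - unit_pt x ^ ?n = (1 - unit_pt x) * (\<Sum>l<?n. unit_pt x ^ l)"
    by (rule one_diff_power_eq)
  also have "(\<Sum>l<?n. unit_pt x ^ l) = (\<Sum>l<?n. unit_pt (of_nat l * x))"
    by (simp add: Complex.DeMoivre mult_ac)
  finally show ?thesis by (simp add: norm_mult power_mult_distrib norm_one_minus_cis fejer_def)
qed

lemma fejer_nonneg: "fejer a x \<ge> 0"
  by (simp add: fejer_def)

lemma unit_pt_int: "x \<in> \<int> \<Longrightarrow> unit_pt x = 1"
  by (rule cis_multiple_2pi)

lemma fejer_int: "x \<in> \<int> \<Longrightarrow> fejer a x = (of_int a)\<^sup>2"
  by (simp add: fejer_def unit_pt_int)

lemma chord_eq_0_iff: "chord x = 0 \<longleftrightarrow> x \<in> \<int>"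
proof
  assume "chord x = 0"
  hence "cos (2 * pi * x) = 1" by (simp add: chord_def)
  then obtain k :: int where "2 * pi * x = of_int k * 2 * pi" unfolding cos_one_2pi_int by auto
  thus "x \<in> \<int>" by simp
next
  assume "x \<in> \<int>"
  thus "chord x = 0" using norm_one_minus_cis[of x] unit_pt_int[of x] by simp
qed

lemma chord_nonneg: "chord x \<ge> 0"
  by (simp add: chord_alt)

lemma twice_cont_diff_fejer: "twice_cont_diff (fejer a)"
proof -
  have "fejer a = (\<lambda>x. (\<Sum>l<nat \<bar>a\<bar>. cos (2 * pi * of_nat l * x)) * (\<Sum>l<nat \<bar>a\<bar>. cos (2 * pi * of_nat l * x)) +
      (\<Sum>l<nat \<bar>a\<bar>. sin (2 * pi * of_nat l * x)) * (\<Sum>l<nat \<bar>a\<bar>. sin (2 * pi * of_nat l * x)))"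
    unfolding fejer_def cmod_power2 by (rule ext) (simp add: power2_eq_square mult.assoc)
  moreover have "twice_cont_diff \<dots>"
    by (intro twice_cont_diff_add twice_cont_diff_mult twice_cont_diff_sum twice_cont_diff_cos twice_cont_diff_sin) auto
  ultimately show ?thesis by simp
qed

lemma twice_cont_diff_chord: "twice_cont_diff (\<lambda>x. chord (c * x))"
proof -
  have "twice_cont_diff (\<lambda>x. 2 + (- 2) * cos (2 * pi * c * x))"
    by (intro twice_cont_diff_add twice_cont_diff_mult twice_cont_diff_const twice_cont_diff_cos)
  thus ?thesis by (simp add: chord_def mult.assoc)
qed

definition fejer_sum :: "nat \<Rightarrow> (nat \<Rightarrow> int) \<Rightarrow> real \<Rightarrow> real" where
  "fejer_sum m a x = (\<Sum>j=1..m. fejer (a j) x)"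

definition fejer_pairs :: "nat \<Rightarrow> (nat \<Rightarrow> int) \<Rightarrow> real \<Rightarrow> real" where
  "fejer_pairs s \<gamma> x = (\<Sum>i=1..s. \<Sum>j=1..<i. fejer (\<gamma> j - \<gamma> i) x)"

text \<open>The function g of the overview. In \<open>symb\<close> with u = v = 0 the two terms s^2
  cancel and every remaining term carries a factor \<open>chord x\<close>; this is the quotient with
  the division carried out.\<close>

definition reduced_symb :: "nat \<Rightarrow> nat \<Rightarrow> nat \<Rightarrow> (nat \<Rightarrow> int) \<Rightarrow> (nat \<Rightarrow> int) \<Rightarrow> (nat \<Rightarrow> int) \<Rightarrow>
    real \<Rightarrow> real" where
  "reduced_symb r t s \<alpha> \<beta> \<gamma> x = of_nat s * (fejer_sum r \<alpha> x + fejer_sum t \<beta> x) + fejer_pairs s \<gamma> x +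
     chord x * (fejer_sum r \<alpha> x * fejer_sum t \<beta> x)"

lemma symb_factor: "symb r t s \<alpha> \<beta> \<gamma> 0 0 x = chord x * reduced_symb r t s \<alpha> \<beta> \<gamma> x"
proof -
  have "chord_sum m a x = chord x * fejer_sum m a x" for m a
    unfolding chord_sum_def fejer_sum_def chord_fejer sum_distrib_left ..
  moreover have "chord_pairs s \<gamma> x = chord x * fejer_pairs s \<gamma> x"
    unfolding chord_pairs_def fejer_pairs_def chord_fejer sum_distrib_left ..
  ultimately show ?thesis
    by (simp add: symb_def reduced_symb_def power2_eq_square algebra_simps)
qed

text \<open>At integers the product term vanishes with \<open>chord\<close>, and each
  \<open>fejer a\<close> becomes a^2; this is where q arises.\<close>

lemma reduced_symb_int:
  assumes "x \<in> \<int>"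
  shows "reduced_symb r t s \<alpha> \<beta> \<gamma> x = of_int (bicirc_q r t s \<alpha> \<beta> \<gamma>)"
  using assms chord_eq_0_iff[of x]
  by (simp add: reduced_symb_def fejer_sum_def fejer_pairs_def fejer_int bicirc_q_def distrib_left)

lemma Gcd_mult_in_Ints:
  fixes A :: "int set" and x :: real
  assumes "finite A" "\<And>a. a \<in> A \<Longrightarrow> of_int a * x \<in> \<int>"
  shows "of_int (Gcd A) * x \<in> \<int>"
  using assms
proof (induction A rule: finite_induct)
  case (insert a A)
  obtain u v where uv: "u * a + v * Gcd A = gcd a (Gcd A)" using bezout_int by blast
  have "of_int (Gcd (insert a A)) * x = of_int u * (of_int a * x) + of_int v * (of_int (Gcd A) * x)"
    unfolding Gcd_insert uv[symmetric] by (simp add: algebra_simps)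
  thus ?case using insert by (auto intro!: Ints_add Ints_mult)
qed simp

text \<open>If all values vanish, every \<open>a * x\<close> is an integer, and by Bezout so is x.
  But at integers \<open>fejer a x\<close> is a^2, so all elements of \<open>A\<close> would be 0
  and their gcd would be 0.\<close>

lemma exists_fejer_pos:
  assumes "finite A" "Gcd A = 1"
  shows "\<exists>a\<in>A. fejer a x > 0"
proof (rule ccontr)
  assume "\<not> ?thesis"
  hence 0: "fejer a x = 0" if "a \<in> A" for a using fejer_nonneg[of a x] that by force
  have x: "x \<in> \<int>"
  proof -
    have "of_int (Gcd A) * x \<in> \<int>"
      by (rule Gcd_mult_in_Ints[OF assms(1)]) (use 0 in \<open>simp add: chord_eq_0_iff[symmetric] chord_fejer\<close>)
    thus ?thesis using assms(2) by simp
  qed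
  have "a = 0" if "a \<in> A" for a using 0[OF that] fejer_int[OF x, of a] by simp
  hence "Gcd A = 0" by (simp add: Gcd_0_iff subset_iff)
  thus False using assms(2) by simp
qed

lemma reduced_symb_pos:
  assumes s: "s \<ge> 1"
    and gcds: "Gcd (\<alpha> ` {1..r}) = 1 \<or> Gcd (\<beta> ` {1..t}) = 1 \<or>
               Gcd {\<gamma> l - \<gamma> m | l m. 1 \<le> m \<and> m < l \<and> l \<le> s} = 1"
  shows "reduced_symb r t s \<alpha> \<beta> \<gamma> x > 0"
proof -
  have nn: "fejer_sum m a x \<ge> 0" "fejer_pairs s \<gamma> x \<ge> 0" for m a
    by (auto simp: fejer_sum_def fejer_pairs_def intro!: sum_nonneg fejer_nonneg)
  have pos: "fejer_sum m a x > 0" if g: "Gcd (a ` {1..m}) = 1" for m a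
  proof -
    obtain j where "j \<in> {1..m}" "fejer (a j) x > 0" using exists_fejer_pos[OF _ g, of x] by auto
    thus ?thesis unfolding fejer_sum_def by (intro sum_pos2[of _ j]) (auto intro: fejer_nonneg)
  qed
  have pairs: "fejer_pairs s \<gamma> x > 0" if g: "Gcd {\<gamma> l - \<gamma> m | l m. 1 \<le> m \<and> m < l \<and> l \<le> s} = 1"
  proof -
    have "{\<gamma> l - \<gamma> m | l m. 1 \<le> m \<and> m < l \<and> l \<le> s} \<subseteq> (\<lambda>(l, m). \<gamma> l - \<gamma> m) ` ({1..s} \<times> {1..s})"
      by force
    hence "finite {\<gamma> l - \<gamma> m | l m. 1 \<le> m \<and> m < l \<and> l \<le> s}" by (rule finite_subset) auto
    from exists_fejer_pos[OF this g, of x] obtain l m where lm: "1 \<le> m" "m < l" "l \<le> s" "fejer (\<gamma> l - \<gamma> m) x > 0"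
      by auto
    have "fejer (\<gamma> m - \<gamma> l) x > 0" using lm(4) by (simp add: fejer_def abs_minus_commute)
    hence *: "(\<Sum>j=1..<l. fejer (\<gamma> j - \<gamma> l) x) > 0" using lm by (intro sum_pos2[of _ m]) (auto intro: fejer_nonneg)
    show ?thesis unfolding fejer_pairs_def
      by (rule sum_pos2[of _ l]) (use lm * in \<open>auto intro!: sum_nonneg fejer_nonneg\<close>)
  qed
  have "of_nat s * (fejer_sum r \<alpha> x + fejer_sum t \<beta> x) + fejer_pairs s \<gamma> x > 0"
    using gcds
  proof (elim disjE)
    assume "Gcd {\<gamma> l - \<gamma> m | l m. 1 \<le> m \<and> m < l \<and> l \<le> s} = 1"
    thus ?thesis using pairs nn(1) by (intro add_nonneg_pos mult_nonneg_nonneg add_nonneg_nonneg) auto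
  next
    assume "Gcd (\<alpha> ` {1..r}) = 1"
    thus ?thesis using pos nn s by (intro add_pos_nonneg mult_pos_pos add_pos_nonneg) auto
  next
    assume "Gcd (\<beta> ` {1..t}) = 1"
    thus ?thesis using pos nn s by (intro add_pos_nonneg mult_pos_pos add_nonneg_pos) auto
  qed
  moreover have "chord x * (fejer_sum r \<alpha> x * fejer_sum t \<beta> x) \<ge> 0"
    by (intro mult_nonneg_nonneg chord_nonneg nn)
  ultimately show ?thesis unfolding reduced_symb_def by simp
qed

text \<open>The added 2 lifts the product strictly above s^2 even at z = 1, where all chords vanish;
  elsewhere the chords only increase the value.\<close>

lemma symb_pos:
  assumes "s \<ge> 1" "u \<ge> 0" "v \<ge> 0" "u > 0 \<or> v > 0"
  shows "symb r t s \<alpha> \<beta> \<gamma> u v x > 0"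
proof -
  have nn: "chord_sum m a x \<ge> 0" "chord_pairs s \<gamma> x \<ge> 0" for m a
    by (auto simp: chord_sum_def chord_pairs_def intro!: sum_nonneg chord_nonneg)
  have "(of_nat s)\<^sup>2 < (of_nat s + u) * (of_nat s + v)"
  proof -
    have "of_nat s * u + of_nat s * v > 0" "u * v \<ge> 0"
      using assms by (auto intro: add_pos_nonneg add_nonneg_pos)
    thus ?thesis by (simp add: power2_eq_square algebra_simps)
  qed
  also have "\<dots> \<le> (of_nat s + chord_sum r \<alpha> x + u) * (of_nat s + chord_sum t \<beta> x + v)"
    using assms nn by (intro mult_mono) auto
  finally show ?thesis unfolding symb_def using nn(2) by simp
qed

lemma twice_cont_diff_symb: "twice_cont_diff (symb r t s \<alpha> \<beta> \<gamma> u v)"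
proof -
  have "twice_cont_diff (\<lambda>x. (of_nat s + chord_sum r \<alpha> x + u) * (of_nat s + chord_sum t \<beta> x + v) + - (of_nat s)\<^sup>2 + chord_pairs s \<gamma> x)"
    unfolding chord_sum_def chord_pairs_def
    by (intro twice_cont_diff_add twice_cont_diff_mult twice_cont_diff_sum twice_cont_diff_chord twice_cont_diff_const) auto
  thus ?thesis by (simp add: symb_def[abs_def])
qed

lemma twice_cont_diff_reduced_symb: "twice_cont_diff (reduced_symb r t s \<alpha> \<beta> \<gamma>)"
  using twice_cont_diff_chord[of 1]
  unfolding reduced_symb_def[abs_def] fejer_sum_def fejer_pairs_def
  by (intro twice_cont_diff_add twice_cont_diff_mult twice_cont_diff_sum twice_cont_diff_fejer twice_cont_diff_const) auto

lemma symb_period: "symb r t s \<alpha> \<beta> \<gamma> u v 1 = symb r t s \<alpha> \<beta> \<gamma> u v 0"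
proof -
  have "chord (of_int a * 1) = chord (of_int a * 0)" for a
    using chord_eq_0_iff[of "of_int a"] chord_eq_0_iff[of 0] by simp
  thus ?thesis unfolding symb_def chord_sum_def chord_pairs_def by presburger
qed

section \<open>Mahler measures\<close>

lemma integrable_ln_twice_cont_diff:
  assumes "twice_cont_diff g" "\<And>x. g x > 0"
  shows "(\<lambda>x. ln (g x)) integrable_on {0..1}"
  by (intro integrable_continuous_interval twice_cont_diff_continuous twice_cont_diff_ln assms)

text \<open>Stated with a general smooth positive cofactor \<open>h\<close>: \<open>h = 1\<close>
  serves P_1, and the symbols of P_2, P_3, P_4 serve the products with P_1.\<close>

lemma mahler_symb_product:
  assumes "s \<ge> 1"
    and "Gcd (\<alpha> ` {1..r}) = 1 \<or> Gcd (\<beta> ` {1..t}) = 1 \<or>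
               Gcd {\<gamma> l - \<gamma> m | l m. 1 \<le> m \<and> m < l \<and> l \<le> s} = 1"
    and h: "twice_cont_diff h" "\<And>x. h x > 0"
    and P: "\<And>x. leval P (unit_pt x) = of_real (h x * symb r t s \<alpha> \<beta> \<gamma> 0 0 x)"
  shows "mahler P = exp (integral {0..1} (\<lambda>x. ln (h x))) *
    exp (integral {0..1} (\<lambda>x. ln (reduced_symb r t s \<alpha> \<beta> \<gamma> x)))"
proof -
  let ?g = "reduced_symb r t s \<alpha> \<beta> \<gamma>"
  have g: "?g x > 0" for x by (rule reduced_symb_pos[OF assms(1,2)])
  have I: "((\<lambda>x. ln (h x)) has_integral integral {0..1} (\<lambda>x. ln (h x))) {0..1}"
    "((\<lambda>x. ln (?g x)) has_integral integral {0..1} (\<lambda>x. ln (?g x))) {0..1}"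
    using integrable_ln_twice_cont_diff[OF h] integrable_ln_twice_cont_diff[OF twice_cont_diff_reduced_symb g]
    by (auto intro: integrable_integral)
  have "((\<lambda>x. ln (cmod (leval P (unit_pt x)))) has_integral
    (integral {0..1} (\<lambda>x. ln (h x)) + integral {0..1} (\<lambda>x. ln (?g x)) + 0)) {0..1}"
  \<comment> \<open>At 0 and 1 \<open>chord\<close> vanishes and the logarithm does not split; two
    points do not affect the integral.\<close>
  proof (rule has_integral_spike_finite[OF _ _ has_integral_add[OF has_integral_add[OF I] has_integral_ln_chord]])
    fix x :: real assume "x \<in> {0..1} - {0, 1}"
    hence "chord x > 0" by (intro chord_pos) auto
    thus "ln (cmod (leval P (unit_pt x))) = ln (h x) + ln (?g x) + ln (chord x)"
      using h(2)[of x] g[of x] by (simp add: P symb_factor norm_mult ln_mult)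
  qed auto
  thus ?thesis unfolding mahler_unit_pt by (simp add: integral_unique exp_add)
qed

section \<open>Counting spanning trees in the four families\<close>

lemma zeta_unit_pt: "zeta n (a * k) = unit_pt (of_int a * (of_int k / of_nat n))"
  by (simp add: zeta_def mult_ac)

lemma pm_residues_eq:
  assumes "\<forall>j\<in>{1..m}. 1 \<le> a j \<and> 2 * a j < int n"
  shows "pm_residues n m a = (\<Union>j\<in>{1..m}. {a j, int n - a j})"
  unfolding pm_residues_def
proof (intro SUP_cong refl)
  fix j assume "j \<in> {1..m}"
  hence a: "1 \<le> a j" "2 * a j < int n" using assms by auto
  have "(- a j) mod int n = int n - a j" using a by (simp add: zmod_zminus1_eq_if)
  thus "{a j mod int n, - a j mod int n} = {a j, int n - a j}" using a by simp
qed

text \<open>Since \<open>2 * a j < n\<close>, the residues \<open>a j\<close> lie in the lower half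
  and \<open>n - a j\<close> in the upper half, so all 2 m of them are distinct. Each pair
  contributes 2 minus a chord.\<close>

lemma exp_sum_pm_residues:
  assumes a: "\<forall>j\<in>{1..m}. 1 \<le> a j \<and> 2 * a j < int n" and inj: "inj_on a {1..m}"
  shows "exp_sum n (pm_residues n m a) k = of_real (2 * of_nat m - chord_sum m a (of_int k / of_nat n))"
proof -
  have "exp_sum n (pm_residues n m a) k = (\<Sum>x\<in>(\<Union>j\<in>{1..m}. {a j, int n - a j}). zeta n (x * k))"
    by (simp only: exp_sum_def pm_residues_eq[OF a])
  also have "\<dots> = (\<Sum>j\<in>{1..m}. \<Sum>x\<in>{a j, int n - a j}. zeta n (x * k))"
  proof (rule sum.UNION_disjoint[of "{1..m}" "\<lambda>j. {a j, int n - a j}" "\<lambda>x. zeta n (x * k)"])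
    show "\<forall>i\<in>{1..m}. \<forall>j\<in>{1..m}. i \<noteq> j \<longrightarrow> {a i, int n - a i} \<inter> {a j, int n - a j} = {}"
    proof (intro ballI impI)
      fix i j assume ij: "i \<in> {1..m}" "j \<in> {1..m}" "i \<noteq> j"
      have "a i \<noteq> a j" using inj_on_eq_iff[OF inj ij(1,2)] ij(3) by blast
      thus "{a i, int n - a i} \<inter> {a j, int n - a j} = {}" using bspec[OF a ij(1)] bspec[OF a ij(2)]
        by (simp add: disjoint_iff)
    qed
  qed auto
  also have "\<dots> = (\<Sum>j\<in>{1..m}. unit_pt (of_int (a j) * (of_int k / of_nat n)) + unit_pt (- (of_int (a j) * (of_int k / of_nat n))))"
  proof (rule sum.cong[OF refl])
    fix j assume j: "j \<in> {1..m}"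
    have "zeta n ((int n - a j) * k) = zeta n (- a j * k)"
      by (rule zeta_cong) (simp add: mod_eq_dvd_iff left_diff_distrib)
    also have "\<dots> = unit_pt (- (of_int (a j) * (of_int k / of_nat n)))"
      unfolding zeta_unit_pt by simp
    finally have z: "zeta n ((int n - a j) * k) = unit_pt (- (of_int (a j) * (of_int k / of_nat n)))" .
    have "a j \<noteq> int n - a j" using bspec[OF a j] by linarith
    thus "(\<Sum>x\<in>{a j, int n - a j}. zeta n (x * k)) =
       unit_pt (of_int (a j) * (of_int k / of_nat n)) + unit_pt (- (of_int (a j) * (of_int k / of_nat n)))"
      unfolding z[symmetric] zeta_unit_pt[of n "a j" k, symmetric] by simp
  qed
  also have "\<dots> = of_real (2 * of_nat m - chord_sum m a (of_int k / of_nat n))" by (rule sum_unit_pt_pm)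
  finally show ?thesis .
qed

lemma chord_sum_0: "chord_sum m a 0 = 0"
  by (simp add: chord_sum_def chord_def)

text \<open>The flag switches the element n/2 on or off, so that one argument covers all four
  families.\<close>

definition half_turn :: "nat \<Rightarrow> bool \<Rightarrow> int set" where
  "half_turn n b = (if b then {int n div 2} else {})"

lemma diag_part:
  assumes a: "\<forall>j\<in>{1..m}. 1 \<le> a j \<and> 2 * a j < int n" and inj: "inj_on a {1..m}"
    and n: "n > 0" and b: "b \<longrightarrow> even n"
  defines "X \<equiv> pm_residues n m a \<union> half_turn n b"
  shows "X \<subseteq> Zmod n" "\<And>x. x \<in> X \<Longrightarrow> (- x) mod int n \<in> X" "0 \<notin> X"
    "of_nat (card X + s) - exp_sum n X (int k) =
      of_real (of_nat s + chord_sum m a (of_nat k / of_nat n) + (if b \<and> odd k then 2 else 0))"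
proof -
  let ?R = "pm_residues n m a" and ?H = "half_turn n b"
  note R = pm_residues_eq[of m a n, OF a]
  have H: "h = int n div 2 \<and> 2 * h = int n" if "h \<in> ?H" for h
    using that b by (auto simp: half_turn_def split: if_splits)
  show "X \<subseteq> Zmod n"
  proof
    fix x assume "x \<in> X"
    then consider "x \<in> ?R" | "2 * x = int n" using H by (auto simp: X_def)
    thus "x \<in> Zmod n"
    proof cases
      case 1
      then obtain j where "j \<in> {1..m}" "x = a j \<or> x = int n - a j" unfolding R by auto
      thus ?thesis using bspec[OF a, of j] by (auto simp: Zmod_def)
    qed (use n in \<open>auto simp: Zmod_def\<close>)
  qed
  show "0 \<notin> X"
  proof
    assume "0 \<in> X"
    then consider "0 \<in> ?R" | "0 \<in> ?H" by (auto simp: X_def)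
    thus False
    proof cases
      case 1
      then obtain j where "j \<in> {1..m}" "0 = a j \<or> 0 = int n - a j" unfolding R by auto
      thus ?thesis using bspec[OF a, of j] by auto
    next
      case 2
      thus ?thesis using H[OF 2] n by simp
    qed
  qed
  show "(- x) mod int n \<in> X" if xX: "x \<in> X" for x
  proof -
    have neg: "(- x) mod int n = int n - x" if "0 < x" "x < int n" for x
      using that by (simp add: zmod_zminus1_eq_if)
    consider "x \<in> ?R" | "x \<in> ?H" using xX by (auto simp: X_def)
    thus ?thesis
    proof cases
      case 1
      then obtain j where j: "j \<in> {1..m}" "x = a j \<or> x = int n - a j" unfolding R by auto
      hence "(- x) mod int n = int n - x" using bspec[OF a, of j] by (intro neg) auto
      also have "int n - x \<in> ?R" unfolding R using j by auto
      finally show ?thesis by (simp add: X_def)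
    next
      case 2
      hence "(- x) mod int n = x" using H[OF 2] n neg[of x] by auto
      thus ?thesis using 2 by (simp add: X_def)
    qed
  qed
  have fin: "finite ?R" "finite ?H" by (auto simp: pm_residues_def half_turn_def)
  have disj: "?R \<inter> ?H = {}"
  proof (rule ccontr)
    assume "?R \<inter> ?H \<noteq> {}"
    then obtain x where x: "x \<in> ?R" "2 * x = int n" using H by blast
    then obtain j where "j \<in> {1..m}" "x = a j \<or> x = int n - a j" unfolding R by auto
    thus False using bspec[OF a, of j] x by auto
  qed
  \<comment> \<open>At frequency 0 the exponential sum counts the residues.\<close>
  have "of_nat (card ?R) = (of_real (2 * of_nat m) :: complex)"
    using exp_sum_pm_residues[of m a n 0, OF a inj] by (simp add: chord_sum_0)
  hence cR: "card ?R = 2 * m" by (metis of_nat_eq_iff of_nat_mult of_nat_numeral of_real_of_nat_eq)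
  have "exp_sum n X (int k) = exp_sum n ?R (int k) + exp_sum n ?H (int k)"
    unfolding exp_sum_def X_def by (rule sum.union_disjoint[OF fin disj])
  moreover have "card X = 2 * m + card ?H" unfolding X_def card_Un_disjoint[OF fin disj] cR ..
  \<comment> \<open>The element n/2 contributes 1 - (-1)^k, the source of the shift by 2 at odd
    frequencies.\<close>
  moreover have "of_nat (card ?H) - exp_sum n ?H (int k) = (if b \<and> odd k then 2 else 0)"
  proof (cases b)
    case True
    have "zeta n (int n div 2 * int k) = zeta n (int n div 2) ^ k" by (simp add: zeta_power)
    also have "zeta n (int n div 2) = cis pi"
    proof -
      have "2 * real_of_int (int n div 2) = real n" using b True by auto
      hence "2 * pi * of_int (int n div 2) / of_nat n = pi" using n by (simp add: field_simps)
      thus ?thesis by (simp add: zeta_def)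
    qed
    also have "cis pi ^ k = (if odd k then -1 else 1)" by simp
    finally have "zeta n (int n div 2 * int k) = (if odd k then -1 else 1)" .
    thus ?thesis using True by (simp add: half_turn_def exp_sum_def)
  qed (simp add: half_turn_def exp_sum_def)
  ultimately show "of_nat (card X + s) - exp_sum n X (int k) =
      of_real (of_nat s + chord_sum m a (of_nat k / of_nat n) + (if b \<and> odd k then 2 else 0))"
    using exp_sum_pm_residues[of m a n "int k", OF a inj] by (simp add: algebra_simps)
qed

lemma off_part:
  assumes \<gamma>: "\<forall>j\<in>{1..s}. 0 \<le> \<gamma> j \<and> \<gamma> j < int n" and inj: "inj_on \<gamma> {1..s}"
  shows "residues_of n s \<gamma> \<subseteq> Zmod n" "card (residues_of n s \<gamma>) = s"
    "exp_sum n (residues_of n s \<gamma>) (int k) * exp_sum n (residues_of n s \<gamma>) (- int k) =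
      of_real ((of_nat s)\<^sup>2 - chord_pairs s \<gamma> (of_nat k / of_nat n))"
proof -
  have R: "residues_of n s \<gamma> = \<gamma> ` {1..s}"
    unfolding residues_of_def by (intro image_cong refl) (use \<gamma> in auto)
  show "residues_of n s \<gamma> \<subseteq> Zmod n" using \<gamma> by (auto simp: R Zmod_def)
  show "card (residues_of n s \<gamma>) = s" unfolding R card_image[OF inj] by simp
  let ?C = "\<Sum>j=1..s. unit_pt (of_int (\<gamma> j) * (of_nat k / of_nat n))"
  have 1: "exp_sum n (residues_of n s \<gamma>) (int k) = ?C"
    unfolding exp_sum_def R sum.reindex[OF inj] by (simp add: zeta_unit_pt)
  have 2: "exp_sum n (residues_of n s \<gamma>) (- int k) = cnj ?C"
    unfolding exp_sum_def R sum.reindex[OF inj] zeta_unit_pt by (simp add: cis_cnj)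
  show "exp_sum n (residues_of n s \<gamma>) (int k) * exp_sum n (residues_of n s \<gamma>) (- int k) =
      of_real ((of_nat s)\<^sup>2 - chord_pairs s \<gamma> (of_nat k / of_nat n))"
    unfolding 1 2 norm_sum_unit_pt[symmetric] by (simp only: complex_norm_square)
qed

lemma num_spanning_trees_symb:
  assumes \<alpha>: "\<forall>j\<in>{1..r}. 1 \<le> \<alpha> j \<and> 2 * \<alpha> j < int n" "inj_on \<alpha> {1..r}"
    and \<beta>: "\<forall>j\<in>{1..t}. 1 \<le> \<beta> j \<and> 2 * \<beta> j < int n" "inj_on \<beta> {1..t}"
    and \<gamma>: "\<forall>j\<in>{1..s}. 0 \<le> \<gamma> j \<and> \<gamma> j < int n" "inj_on \<gamma> {1..s}"
    and n: "n > 0" and bc: "b \<longrightarrow> even n" "c \<longrightarrow> even n"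
  shows "real n * real (num_spanning_trees (bicirculant n (pm_residues n r \<alpha> \<union> half_turn n b)
      (pm_residues n t \<beta> \<union> half_turn n c) (residues_of n s \<gamma>))) =
    real s * (\<Prod>j=1..<n. symb r t s \<alpha> \<beta> \<gamma> (if b \<and> odd j then 2 else 0) (if c \<and> odd j then 2 else 0) (real j / real n))"
proof -
  note A = diag_part[of r \<alpha> n b, OF \<alpha> n bc(1)] and B = diag_part[of t \<beta> n c, OF \<beta> n bc(2)]
  note C = off_part[of s \<gamma> n, OF \<gamma>]
  have symb: "complex_of_real (symb r t s \<alpha> \<beta> \<gamma> u v x) =
    of_real (of_nat s + chord_sum r \<alpha> x + u) * of_real (of_nat s + chord_sum t \<beta> x + v) -
    of_real ((of_nat s)\<^sup>2 - chord_pairs s \<gamma> x)" for u v x by (simp add: symb_def)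
  note count = bicirculant_num_spanning_trees[OF n A(1) B(1) C(1) _ _ A(3) B(3)]
  have "of_nat (n * num_spanning_trees (bicirculant n (pm_residues n r \<alpha> \<union> half_turn n b)
      (pm_residues n t \<beta> \<union> half_turn n c) (residues_of n s \<gamma>))) =
    complex_of_real (real s * (\<Prod>j=1..<n. symb r t s \<alpha> \<beta> \<gamma> (if b \<and> odd j then 2 else 0) (if c \<and> odd j then 2 else 0) (real j / real n)))"
  proof (subst count)
    show "- x mod int n \<in> pm_residues n r \<alpha> \<union> half_turn n b" if "x \<in> pm_residues n r \<alpha> \<union> half_turn n b" for x
      using A(2) that by blast
    show "- x mod int n \<in> pm_residues n t \<beta> \<union> half_turn n c" if "x \<in> pm_residues n t \<beta> \<union> half_turn n c" for x
      using B(2) that by blast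
  qed (simp only: C(2,3) A(4) B(4) of_real_mult of_real_prod symb of_real_of_nat_eq)
  hence "complex_of_real (real (n * num_spanning_trees (bicirculant n (pm_residues n r \<alpha> \<union> half_turn n b)
      (pm_residues n t \<beta> \<union> half_turn n c) (residues_of n s \<gamma>)))) =
    complex_of_real (real s * (\<Prod>j=1..<n. symb r t s \<alpha> \<beta> \<gamma> (if b \<and> odd j then 2 else 0) (if c \<and> odd j then 2 else 0) (real j / real n)))"
    by (simp only: of_real_of_nat_eq)
  thus ?thesis by (simp only: of_real_eq_iff of_nat_mult)
qed

section \<open>Asymptotics\<close>

lemma prod_split_parity:
  fixes f :: "nat \<Rightarrow> 'a :: comm_monoid_mult"
  assumes "m > 0"
  shows "(\<Prod>j=1..<2 * m. f j) = (\<Prod>l=1..<m. f (2 * l)) * (\<Prod>l<m. f (2 * l + 1))"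
  using assms
proof (induction m rule: nat_induct_non_zero)
  case 1
  have "{1..<2} = {1::nat}" by auto
  thus ?case by simp
next
  case (Suc m)
  have "{1..<2 * Suc m} = insert (2 * m) (insert (2 * m + 1) {1..<2 * m})" using Suc by auto
  moreover have "{1..<Suc m} = insert m {1..<m}" using Suc by auto
  ultimately show ?case using Suc by (simp add: mult_ac)
qed

text \<open>The chords multiply to n^2, and the factor q completes the product of g by its value at
  j = 0.\<close>

lemma prod_symb_principal:
  assumes n: "n > 0"
  shows "(\<Prod>j=1..<n. symb r t s \<alpha> \<beta> \<gamma> 0 0 (real j / real n)) * of_int (bicirc_q r t s \<alpha> \<beta> \<gamma>) =
    (real n)\<^sup>2 * (\<Prod>j<n. reduced_symb r t s \<alpha> \<beta> \<gamma> (real j / real n))"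
proof -
  let ?g = "\<lambda>j. reduced_symb r t s \<alpha> \<beta> \<gamma> (real j / real n)"
  have "(\<Prod>j<n. ?g j) = ?g 0 * (\<Prod>j=1..<n. ?g j)"
    using n by (simp add: lessThan_atLeast0 prod.atLeast_Suc_lessThan)
  thus ?thesis
    unfolding symb_factor prod.distrib prod_chord[OF n] using reduced_symb_int[of 0 r t s \<alpha> \<beta> \<gamma>] by simp
qed

lemma eventually_large:
  fixes a :: "nat \<Rightarrow> int"
  shows "eventually (\<lambda>n. \<forall>j\<in>{1..m}. 2 * a j < int n) at_top"
proof (rule eventually_ball_finite)
  show "\<forall>j\<in>{1..m}. eventually (\<lambda>n. 2 * a j < int n) at_top"
  proof
    fix j
    show "eventually (\<lambda>n. 2 * a j < int n) at_top"
      using eventually_gt_at_top[of "nat (2 * a j)"] by eventually_elim linarith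
  qed
qed auto

lemma filterlim_half_even: "filterlim (\<lambda>n. n div 2) at_top even_at_top"
proof -
  have "filterlim (\<lambda>n::nat. n div 2) at_top at_top"
    unfolding filterlim_at_top
  proof
    fix Z :: nat
    show "eventually (\<lambda>n. Z \<le> n div 2) at_top"
      using eventually_ge_at_top[of "2 * Z"] by eventually_elim linarith
  qed
  thus ?thesis by (rule filterlim_mono) auto
qed

section \<open>Asymptotics for fixed parameters\<close>

locale bicirculant_family =
  fixes r t s :: nat and \<alpha> \<beta> \<gamma> :: "nat \<Rightarrow> int"
  assumes s: "s \<ge> 1"
    and \<alpha>: "strict_mono_on {1..r} \<alpha>" "\<forall>j\<in>{1..r}. 1 \<le> \<alpha> j"
    and \<beta>: "strict_mono_on {1..t} \<beta>" "\<forall>j\<in>{1..t}. 1 \<le> \<beta> j"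
    and \<gamma>: "strict_mono_on {1..s} \<gamma>" "\<forall>j\<in>{1..s}. 0 \<le> \<gamma> j"
    and gcds: "Gcd (\<alpha> ` {1..r}) = 1 \<or> Gcd (\<beta> ` {1..t}) = 1 \<or>
               Gcd {\<gamma> l - \<gamma> m | l m. 1 \<le> m \<and> m < l \<and> l \<le> s} = 1"
begin

abbreviation "p \<equiv> symb r t s \<alpha> \<beta> \<gamma>"
abbreviation "g \<equiv> reduced_symb r t s \<alpha> \<beta> \<gamma>"
abbreviation "q \<equiv> real_of_int (bicirc_q r t s \<alpha> \<beta> \<gamma>)"
abbreviation "\<tau> b c n \<equiv> real (num_spanning_trees (bicirculant n (pm_residues n r \<alpha> \<union> half_turn n b)
      (pm_residues n t \<beta> \<union> half_turn n c) (residues_of n s \<gamma>)))"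

lemma g_pos: "g x > 0"
  by (rule reduced_symb_pos[OF s gcds])

lemma q_pos: "q > 0"
  using g_pos[of 0] reduced_symb_int[of 0 r t s \<alpha> \<beta> \<gamma>] by simp

text \<open>Once n exceeds twice every parameter, the residues are distinct and the exact product
  formula applies, with one threshold for all choices of \<open>b\<close> and
  \<open>c\<close>.\<close>

lemma num_spanning_trees_eventually:
  "eventually (\<lambda>n. \<forall>b c. (b \<or> c \<longrightarrow> even n) \<longrightarrow> real n * \<tau> b c n =
    real s * (\<Prod>j=1..<n. p (if b \<and> odd j then 2 else 0) (if c \<and> odd j then 2 else 0) (real j / real n))) at_top"
  using eventually_large[where m = r and a = \<alpha>] eventually_large[where m = t and a = \<beta>]
    eventually_large[where m = s and a = \<gamma>] eventually_gt_at_top[of 0]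
proof eventually_elim
  case (elim n)
  have \<gamma>': "\<forall>j\<in>{1..s}. 0 \<le> \<gamma> j \<and> \<gamma> j < int n"
  proof
    fix j assume "j \<in> {1..s}"
    hence "0 \<le> \<gamma> j" "2 * \<gamma> j < int n" using elim(3) \<gamma>(2) by auto
    thus "0 \<le> \<gamma> j \<and> \<gamma> j < int n" by linarith
  qed
  show ?case
  proof (intro allI impI num_spanning_trees_symb)
    show "inj_on \<alpha> {1..r}" "inj_on \<beta> {1..t}" "inj_on \<gamma> {1..s}"
      using \<alpha>(1) \<beta>(1) \<gamma>(1) by (auto intro: strict_mono_on_imp_inj_on)
  qed (use elim \<alpha>(2) \<beta>(2) \<gamma>' in auto)
qed

lemma g_sample_product:
  "(\<lambda>m. (\<Prod>j<m. g (real j / real m)) / exp (integral {0..1} (\<lambda>x. ln (g x))) ^ m) \<longlonglongrightarrow> 1"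
proof -
  have "g 1 = g 0" using reduced_symb_int[of 0 r t s \<alpha> \<beta> \<gamma>] reduced_symb_int[of 1 r t s \<alpha> \<beta> \<gamma>] by simp
  from periodic_sample_product[OF twice_cont_diff_reduced_symb g_pos this, of 0] show ?thesis by simp
qed

lemma asymptotics_principal:
  assumes M: "M = exp (integral {0..1} (\<lambda>x. ln (g x)))"
  shows "(\<lambda>n. \<tau> False False n) \<sim>[at_top] (\<lambda>n. real n * real s / q * M ^ n)"
proof (rule asymp_equivI')
  show "(\<lambda>n. \<tau> False False n / (real n * real s / q * M ^ n)) \<longlonglongrightarrow> 1"
    using g_sample_product unfolding M[symmetric]
  proof (rule Lim_transform_eventually)
    show "eventually (\<lambda>n. (\<Prod>j<n. g (real j / real n)) / M ^ n =
      \<tau> False False n / (real n * real s / q * M ^ n)) at_top"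
      using num_spanning_trees_eventually eventually_gt_at_top[of 0]
    proof eventually_elim
      case (elim n)
      have "real n * \<tau> False False n = real s * (\<Prod>j=1..<n. p 0 0 (real j / real n))"
        using elim(1)[rule_format, of False False] by simp
      hence "real n * \<tau> False False n * q = real s * ((real n)\<^sup>2 * (\<Prod>j<n. g (real j / real n)))"
        using prod_symb_principal[OF elim(2), of r t s \<alpha> \<beta> \<gamma>] by simp
      hence eq: "\<tau> False False n * q = real n * real s * (\<Prod>j<n. g (real j / real n))"
        using elim(2) by (simp add: power2_eq_square mult_ac)
      have "M > 0" by (simp add: M)
      thus ?case using eq q_pos elim(2) s by (simp add: field_simps)
    qed
  qed
qed

text \<open>With n = 2 m, the even indices j = 2 l sample P_1 at l / m, and the odd ones j = 2 l + 1
  sample \<open>p u v\<close> at the midpoints (l + 1/2) / m. The two products are estimated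
  separately, each with m points, whence the exponent n / 2.\<close>

lemma asymptotics_even:
  assumes bc: "b \<or> c" and uv: "u = (if b then 2 else 0)" "v = (if c then 2 else 0)"
    and M: "M = exp (integral {0..1} (\<lambda>x. ln (p u v x))) * exp (integral {0..1} (\<lambda>x. ln (g x)))"
  shows "(\<lambda>n. \<tau> b c n) \<sim>[even_at_top] (\<lambda>n. real n * real s / (4 * q) * M ^ (n div 2))"
proof (rule asymp_equivI')
  let ?Mp = "exp (integral {0..1} (\<lambda>x. ln (p u v x)))" and ?Mg = "exp (integral {0..1} (\<lambda>x. ln (g x)))"
  let ?G = "\<lambda>m. \<Prod>j<m. g (real j / real m)" and ?P = "\<lambda>m. \<Prod>j<m. p u v ((real j + 1/2) / real m)"
  have "p u v x > 0" for x using bc uv s by (intro symb_pos) auto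
  from periodic_sample_product[OF twice_cont_diff_symb this symb_period, of "1/2"]
  have "(\<lambda>m. ?P m / ?Mp ^ m) \<longlonglongrightarrow> 1" by simp
  from tendsto_mult[OF this g_sample_product]
  have "(\<lambda>m. ?P m / ?Mp ^ m * (?G m / ?Mg ^ m)) \<longlonglongrightarrow> 1" by simp
  hence lim: "((\<lambda>n. ?P (n div 2) / ?Mp ^ (n div 2) * (?G (n div 2) / ?Mg ^ (n div 2))) \<longlongrightarrow> 1) even_at_top"
    by (rule filterlim_compose[OF _ filterlim_half_even])
  show "((\<lambda>n. \<tau> b c n / (real n * real s / (4 * q) * M ^ (n div 2))) \<longlongrightarrow> 1) even_at_top"
    using lim
  proof (rule Lim_transform_eventually)
    show "eventually (\<lambda>n. ?P (n div 2) / ?Mp ^ (n div 2) * (?G (n div 2) / ?Mg ^ (n div 2)) =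
      \<tau> b c n / (real n * real s / (4 * q) * M ^ (n div 2))) even_at_top"
      unfolding eventually_inf_principal
      using num_spanning_trees_eventually eventually_gt_at_top[of 0]
    proof eventually_elim
      case (elim n)
      show ?case
      proof
        assume "n \<in> {n. even n}"
        then obtain m where m: "n = 2 * m" by auto
        hence m0: "m > 0" using elim(2) by simp
        let ?f = "\<lambda>j. p (if b \<and> odd j then 2 else 0) (if c \<and> odd j then 2 else 0) (real j / real n)"
        have "real n * \<tau> b c n = real s * (\<Prod>j=1..<2 * m. ?f j)"
          using elim(1)[rule_format, of b c] m by simp
        also have "(\<Prod>j=1..<2 * m. ?f j) = (\<Prod>l=1..<m. ?f (2 * l)) * (\<Prod>l<m. ?f (2 * l + 1))"
          by (rule prod_split_parity[OF m0])
        also have "(\<Prod>l=1..<m. ?f (2 * l)) = (\<Prod>l=1..<m. p 0 0 (real l / real m))"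
          using m0 by (intro prod.cong) (simp_all add: m)
        also have "(\<Prod>l<m. ?f (2 * l + 1)) = ?P m"
        proof (rule prod.cong[OF refl])
          fix l
          have "real (2 * l + 1) / real n = (real l + 1/2) / real m" using m0 by (simp add: m field_simps)
          thus "?f (2 * l + 1) = p u v ((real l + 1/2) / real m)" by (simp add: uv)
        qed
        finally have "real n * \<tau> b c n * q = real s * ((\<Prod>l=1..<m. p 0 0 (real l / real m)) * q) * ?P m"
          by (simp add: mult_ac)
        hence "real n * \<tau> b c n * q = real s * ((real m)\<^sup>2 * ?G m) * ?P m"
          unfolding prod_symb_principal[OF m0] .
        \<comment> \<open>One factor m is cancelled against n = 2 m. The remaining m / 2 = n / 4
          explains the 4 in the denominator.\<close>
        hence "2 * \<tau> b c n * q = real s * real m * ?G m * ?P m"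
          using m0 by (simp add: m power2_eq_square mult_ac)
        hence eq: "\<tau> b c n = real s * real m * ?G m * ?P m / (2 * q)" using q_pos by (simp add: field_simps)
        have M0: "?Mp > 0" "?Mg > 0" by simp_all
        have Mm: "M ^ m = ?Mp ^ m * ?Mg ^ m" by (simp add: M power_mult_distrib)
        have n2: "n div 2 = m" "real n = 2 * real m" by (simp_all add: m)
        \<comment> \<open>Stated for variables, so that the products and powers are atoms for
          \<open>field_simps\<close>.\<close>
        have cancel: "P / X * (G / Y) = real s * real m * G * P / (2 * q) / (2 * real m * real s / (4 * q) * (X * Y))"
          if "X \<noteq> 0" "Y \<noteq> 0" for P G X Y :: real
          using that m0 q_pos s by (simp add: field_simps)
        show "?P (n div 2) / ?Mp ^ (n div 2) * (?G (n div 2) / ?Mg ^ (n div 2)) =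
           \<tau> b c n / (real n * real s / (4 * q) * M ^ (n div 2))"
          unfolding eq n2 Mm by (rule cancel) (use M0 in simp_all)
      qed
    qed
  qed
qed

lemma mahler_P1: "mahler (P1 r t s \<alpha> \<beta> \<gamma>) = exp (integral {0..1} (\<lambda>x. ln (g x)))"
  using mahler_symb_product[OF s gcds, of "\<lambda>_. 1" "P1 r t s \<alpha> \<beta> \<gamma>"]
  by (simp add: twice_cont_diff_const leval_symb)

lemma mahler_mult_P1:
  assumes "u \<ge> 0" "v \<ge> 0" "u > 0 \<or> v > 0" "\<And>x. leval P (unit_pt x) = of_real (p u v x)"
  shows "mahler (P * P1 r t s \<alpha> \<beta> \<gamma>) =
    exp (integral {0..1} (\<lambda>x. ln (p u v x))) * exp (integral {0..1} (\<lambda>x. ln (g x)))"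
  by (rule mahler_symb_product[OF s gcds twice_cont_diff_symb symb_pos[OF s assms(1-3)]])
     (simp add: leval_mult assms(4) leval_symb)

end

theorem theorem5p1:
  fixes r t s :: nat and \<alpha> \<beta> \<gamma> :: "nat \<Rightarrow> int" and k :: int
  assumes s: "s \<ge> 1"
    and \<alpha>: "strict_mono_on {1..r} \<alpha>" "\<forall>j\<in>{1..r}. 1 \<le> \<alpha> j"
    and \<beta>: "strict_mono_on {1..t} \<beta>" "\<forall>j\<in>{1..t}. 1 \<le> \<beta> j"
    and \<gamma>: "strict_mono_on {1..s} \<gamma>" "\<forall>j\<in>{1..s}. 0 \<le> \<gamma> j"
    and gcds: "Gcd (\<alpha> ` {1..r}) = 1 \<or> Gcd (\<beta> ` {1..t}) = 1 \<or>
               Gcd {\<gamma> l - \<gamma> m | l m. 1 \<le> m \<and> m < l \<and> l \<le> s} = 1"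
    and P1: "P1 r t s \<alpha> \<beta> \<gamma> \<noteq> 0" "ldegree (P1 r t s \<alpha> \<beta> \<gamma>) = k"
    and P2: "P2 r t s \<alpha> \<beta> \<gamma> \<noteq> 0" "ldegree (P2 r t s \<alpha> \<beta> \<gamma>) = k"
    and P3: "P3 r t s \<alpha> \<beta> \<gamma> \<noteq> 0" "ldegree (P3 r t s \<alpha> \<beta> \<gamma>) = k"
    and P4: "P4 r t s \<alpha> \<beta> \<gamma> \<noteq> 0" "ldegree (P4 r t s \<alpha> \<beta> \<gamma>) = k"
  shows "(\<lambda>n. real (num_spanning_trees (Gamma1 r t s \<alpha> \<beta> \<gamma> n)))
           \<sim>[at_top] (\<lambda>n. real n * real s / real_of_int (bicirc_q r t s \<alpha> \<beta> \<gamma>)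
                         * mahler (P1 r t s \<alpha> \<beta> \<gamma>) ^ n)
       \<and> (\<lambda>n. real (num_spanning_trees (Gamma2 r t s \<alpha> \<beta> \<gamma> n)))
           \<sim>[even_at_top] (\<lambda>n. real n * real s / (4 * real_of_int (bicirc_q r t s \<alpha> \<beta> \<gamma>))
                         * mahler (P2 r t s \<alpha> \<beta> \<gamma> * P1 r t s \<alpha> \<beta> \<gamma>) ^ (n div 2))
       \<and> (\<lambda>n. real (num_spanning_trees (Gamma3 r t s \<alpha> \<beta> \<gamma> n)))
           \<sim>[even_at_top] (\<lambda>n. real n * real s / (4 * real_of_int (bicirc_q r t s \<alpha> \<beta> \<gamma>))
                         * mahler (P3 r t s \<alpha> \<beta> \<gamma> * P1 r t s \<alpha> \<beta> \<gamma>) ^ (n div 2))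
       \<and> (\<lambda>n. real (num_spanning_trees (Gamma4 r t s \<alpha> \<beta> \<gamma> n)))
           \<sim>[even_at_top] (\<lambda>n. real n * real s / (4 * real_of_int (bicirc_q r t s \<alpha> \<beta> \<gamma>))
                         * mahler (P4 r t s \<alpha> \<beta> \<gamma> * P1 r t s \<alpha> \<beta> \<gamma>) ^ (n div 2))"
proof -
  interpret bicirculant_family r t s \<alpha> \<beta> \<gamma>
    using s \<alpha> \<beta> \<gamma> gcds by unfold_locales
  have "Gamma1 r t s \<alpha> \<beta> \<gamma> n = bicirculant n (pm_residues n r \<alpha> \<union> half_turn n False)
      (pm_residues n t \<beta> \<union> half_turn n False) (residues_of n s \<gamma>)"
    "Gamma2 r t s \<alpha> \<beta> \<gamma> n = bicirculant n (pm_residues n r \<alpha> \<union> half_turn n True)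
      (pm_residues n t \<beta> \<union> half_turn n False) (residues_of n s \<gamma>)"
    "Gamma3 r t s \<alpha> \<beta> \<gamma> n = bicirculant n (pm_residues n r \<alpha> \<union> half_turn n False)
      (pm_residues n t \<beta> \<union> half_turn n True) (residues_of n s \<gamma>)"
    "Gamma4 r t s \<alpha> \<beta> \<gamma> n = bicirculant n (pm_residues n r \<alpha> \<union> half_turn n True)
      (pm_residues n t \<beta> \<union> half_turn n True) (residues_of n s \<gamma>)" for n
    by (simp_all add: Gamma1_def Gamma2_def Gamma3_def Gamma4_def half_turn_def)
  note Gamma = this
  show ?thesis
    unfolding Gamma
    by (intro conjI asymptotics_principal asymptotics_even[OF _ refl refl] mahler_P1 mahler_mult_P1)
       (simp_all add: leval_symb)
qed

end
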